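(* Let $Y=\{Y_i\}_{i\ge1}$ be a sequence of centered i.i.d. random variables with $\rho:=\sup_{i\ge1}\mathbb{E}[|Y_i|^3]<\infty$. Let $\{N_n\}_{n\ge1}$ be a sequence of integers going to infinity and, for each $n$, let $f_n:[N_n]^2\to\mathbb{R}$ be a symmetric function vanishing on the diagonal. Let $G_n=I_2(g_n)$, $n\ge1$, with $g_n=\sum_{1\le i_1,i_2\le N_n}f_n(i_1,i_2)\,e_{i_1}\otimes e_{i_2}\in\mathcal{H}^{\odot2}$. Let $X\sim BG(\alpha_1,p_1,\alpha_2,p_2)$ with $\alpha_1\alpha_2>1+|\alpha_1-\alpha_2|$ and $p_1\alpha_2=p_2\alpha_1$ (so that $\mathbb{E}(X)=0$). If, as $n\to\infty$, (i) $\max_{1\le i\le N_n}\mathrm{Inf}_i(f_n)\to0$ and (ii) $\kappa_j(G_n)\to\kappa_j(X)$ for $2\le j\le6$, then $$d_3(H_2(N_n,f_n,Y),X)\to0\quad\text{as }n\to\infty;$$ that is, $H_2(N_n,f_n,Y)$ converges in distribution to $X$ as $n\to\infty$.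
   Context: $[N]=\{1,\dots,N\}$. For symmetric $f:[N]^2\to\mathbb{R}$ vanishing on the diagonal ($f(i,i)=0$), the homogeneous sum of order 2 is $H_2(N,f,Y)=\sum_{1\le i,j\le N}f(i,j)Y_iY_j=2\sum_{1\le i<j\le N}f(i,j)Y_iY_j$, and the influence of the $i$th variable is $\mathrm{Inf}_i(f)=\sum_{j=1}^Nf(i,j)^2$. Bilateral gamma: $Ga(\alpha,p)$ ($\alpha,p>0$) has density $\frac{\alpha^p}{\Gamma(p)}e^{-\alpha x}x^{p-1}$, $x>0$. If $X_1\sim Ga(\alpha_1,p_1)$ and $X_2\sim Ga(\alpha_2,p_2)$ are independent, the law of $X_1-X_2$ is denoted $BG(\alpha_1,p_1,\alpha_2,p_2)$. Metric: $d_3(Y,Z)=\sup_{h\in\mathcal{W}_3}|\mathbb{E}h(Y)-\mathbb{E}h(Z)|$, where $\mathcal{W}_3$ is the set of three times differentiable $h:\mathbb{R}\to\mathbb{R}$ with $\|h^{(k)}\|\le1$ for $k=0,1,2,3$ (supremum norm). Wiener chaos: $\mathcal{H}$ is a real separable Hilbert space with orthonormal basis $(e_i)_{i\ge1}$, $W=\{W(h):h\in\mathcal{H}\}$ an isonormal Gaussian process over $\mathcal{H}$, $\mathcal{H}^{\odot2}$ the symmetric second tensor power of $\mathcal{H}$, and $I_2:\mathcal{H}^{\odot 2}\to L^2(\Omega)$ the double Wiener–Itô integral, i.e. the continuous linear map onto the second Wiener chaos with $I_2(h\otimes h)=W(h)^2-1$ for $\|h\|_{\mathcal{H}}=1$.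 $\kappa_m(G)=(-i)^m\frac{d^m}{dt^m}\log\mathbb{E}(e^{itG})\big|_{t=0}$ is the $m$th cumulant of $G$.
   Formalization: The Y_i are additionally assumed to have unit variance; without this the claim is false (for Y_i = 0 the sum H_2 is 0, and for variance s the limit is sX instead of X). *)

theory Defs
  imports "HOL-Probability.Probability"
begin

subsection \<open>Homogeneous sums of order 2\<close>

definition homogeneous_sum2 :: "nat \<Rightarrow> (nat \<Rightarrow> nat \<Rightarrow> real) \<Rightarrow> (nat \<Rightarrow> 'w \<Rightarrow> real) \<Rightarrow> 'w \<Rightarrow> real" where
  "homogeneous_sum2 N f Y \<omega> = (\<Sum>i\<in>{1..N}. \<Sum>j\<in>{1..N}. f i j * Y i \<omega> * Y j \<omega>)"

definition influence :: "nat \<Rightarrow> (nat \<Rightarrow> nat \<Rightarrow> real) \<Rightarrow> nat \<Rightarrow> real" where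
  "influence N f i = (\<Sum>j\<in>{1..N}. (f i j)\<^sup>2)"


subsection \<open>The bilateral gamma law\<close>

definition gamma_law :: "real \<Rightarrow> real \<Rightarrow> real measure" where
  "gamma_law \<alpha> p = density lborel
     (\<lambda>x. ennreal (if 0 < x then \<alpha> powr p / Gamma p * exp (- \<alpha> * x) * x powr (p - 1) else 0))"

definition bilateral_gamma_law :: "real \<Rightarrow> real \<Rightarrow> real \<Rightarrow> real \<Rightarrow> real measure" where
  "bilateral_gamma_law \<alpha>\<^sub>1 p\<^sub>1 \<alpha>\<^sub>2 p\<^sub>2 =
     distr (gamma_law \<alpha>\<^sub>1 p\<^sub>1 \<Otimes>\<^sub>M gamma_law \<alpha>\<^sub>2 p\<^sub>2) borel (\<lambda>(x, y). x - y)"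


subsection \<open>The smooth metric\<close>

definition smooth_test_functions3 :: "(real \<Rightarrow> real) set" where
  "smooth_test_functions3 =
     {h. (\<forall>k<3. \<forall>x. (deriv ^^ k) h differentiable (at x)) \<and>
         (\<forall>k\<le>3. \<forall>x. \<bar>(deriv ^^ k) h x\<bar> \<le> 1)}"

text \<open>The two random variables may live on different spaces. On probability spaces the
  supremum is over a nonempty set bounded by 2, so the real-valued supremum is the right one.\<close>

definition d3_dist :: "'a measure \<Rightarrow> ('a \<Rightarrow> real) \<Rightarrow> 'b measure \<Rightarrow> ('b \<Rightarrow> real) \<Rightarrow> real" where
  "d3_dist M Y M' Z =
     (SUP h\<in>smooth_test_functions3. \<bar>(\<integral>\<omega>. h (Y \<omega>) \<partial>M) - (\<integral>\<omega>. h (Z \<omega>) \<partial>M')\<bar>)"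


subsection \<open>Cumulants\<close>

text \<open>The characteristic function is continuous with value 1 at 0, so near 0 the principal
  branch \<open>Ln\<close> is the logarithm meant; only the germ at 0 matters. The value is kept complex,
  as in the formula; its imaginary part is 0 whenever the \<open>m\<close>-th moment is finite.\<close>

definition cumulant :: "nat \<Rightarrow> 'a measure \<Rightarrow> ('a \<Rightarrow> real) \<Rightarrow> complex" where
  "cumulant m M G =
     (- \<i>) ^ m * ((\<lambda>\<phi> t. vector_derivative \<phi> (at t)) ^^ m) (\<lambda>t. Ln (char (distr M borel G) t)) 0"


subsection \<open>Second Wiener chaos\<close>

text \<open>A Hilbert space is a type of sort \<open>{real_inner, complete_space}\<close>. The basis is indexed
  by the integers \<open>i \<ge> 1\<close>; its existence makes the space separable.\<close>

definition orthonormal_basis :: "(nat \<Rightarrow> 'h::real_inner) \<Rightarrow> bool" where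
  "orthonormal_basis e \<longleftrightarrow>
     (\<forall>i\<ge>1. \<forall>j\<ge>1. inner (e i) (e j) = (if i = j then 1 else 0)) \<and>
     closure (span (e ` {1..})) = UNIV"

definition gaussian_law :: "real measure \<Rightarrow> bool" where
  "gaussian_law \<nu> \<longleftrightarrow>
     (\<exists>m. \<nu> = return borel m \<or> (\<exists>\<sigma>>0. \<nu> = density lborel (\<lambda>x. ennreal (normal_density m \<sigma> x))))"

definition isonormal_process :: "'w measure \<Rightarrow> ('h::real_inner \<Rightarrow> 'w \<Rightarrow> real) \<Rightarrow> bool" where
  "isonormal_process M W \<longleftrightarrow>
     (\<forall>h. W h \<in> borel_measurable M) \<and>
     (\<forall>S c. finite S \<longrightarrow> gaussian_law (distr M borel (\<lambda>\<omega>. \<Sum>h\<in>S. c h * W h \<omega>))) \<and>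
     (\<forall>h. (\<integral>\<omega>. W h \<omega> \<partial>M) = 0) \<and>
     (\<forall>h g. (\<integral>\<omega>. W h \<omega> * W g \<omega> \<partial>M) = inner h g)"

text \<open>The Hilbert space tensor square is determined up to unitary isomorphism by the following
  properties, with \<open>T a b\<close> standing for \<open>a \<otimes> b\<close> and the (complete) codomain type for the
  tensor square.\<close>

definition hilbert_tensor_square ::
    "('h::real_inner \<Rightarrow> 'h \<Rightarrow> 't::{real_inner,complete_space}) \<Rightarrow> bool" where
  "hilbert_tensor_square T \<longleftrightarrow>
     bilinear T \<and>
     (\<forall>a b c d. inner (T a b) (T c d) = inner a c * inner b d) \<and>
     closure (span {T a b | a b. True}) = UNIV"

definition symmetric_tensor_square ::
    "('h::real_inner \<Rightarrow> 'h \<Rightarrow> 't::{real_inner,complete_space}) \<Rightarrow> 't set" where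
  "symmetric_tensor_square T = closure (span {T a b + T b a | a b. True})"

text \<open>The closed linear span in \<open>L\<^sup>2\<close> of the second Hermite polynomials in \<open>W h\<close>,
  \<open>\<parallel>h\<parallel> = 1\<close>. Elements are functions, not classes of functions.\<close>

definition second_wiener_chaos :: "'w measure \<Rightarrow> ('h::real_inner \<Rightarrow> 'w \<Rightarrow> real) \<Rightarrow> ('w \<Rightarrow> real) set" where
  "second_wiener_chaos M W =
     {F. F \<in> borel_measurable M \<and> integrable M (\<lambda>\<omega>. (F \<omega>)\<^sup>2) \<and>
         (\<forall>\<epsilon>>0. \<exists>S c. finite S \<and> (\<forall>h\<in>S. norm h = 1) \<and>
            (\<integral>\<omega>. (F \<omega> - (\<Sum>h\<in>S. c h * ((W h \<omega>)\<^sup>2 - 1)))\<^sup>2 \<partial>M) < \<epsilon>)}"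

text \<open>\<open>I\<close> picks a representative of the class \<open>I\<^sub>2 t\<close>, hence the identities hold almost surely.
  Continuity of the linear map is stated as boundedness.\<close>

definition double_wiener_ito_integral ::
    "'w measure \<Rightarrow> ('h::real_inner \<Rightarrow> 'w \<Rightarrow> real) \<Rightarrow>
     ('h \<Rightarrow> 'h \<Rightarrow> 't::{real_inner,complete_space}) \<Rightarrow> ('t \<Rightarrow> 'w \<Rightarrow> real) \<Rightarrow> bool" where
  "double_wiener_ito_integral M W T I \<longleftrightarrow>
     (\<forall>t\<in>symmetric_tensor_square T. I t \<in> second_wiener_chaos M W) \<and>
     (\<forall>F\<in>second_wiener_chaos M W. \<exists>t\<in>symmetric_tensor_square T. AE \<omega> in M. I t \<omega> = F \<omega>) \<and>
     (\<forall>s\<in>symmetric_tensor_square T. \<forall>t\<in>symmetric_tensor_square T. \<forall>a b.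
        AE \<omega> in M. I (a *\<^sub>R s + b *\<^sub>R t) \<omega> = a * I s \<omega> + b * I t \<omega>) \<and>
     (\<exists>C. \<forall>t\<in>symmetric_tensor_square T. (\<integral>\<omega>. (I t \<omega>)\<^sup>2 \<partial>M) \<le> C * (norm t)\<^sup>2) \<and>
     (\<forall>h. norm h = 1 \<longrightarrow> (AE \<omega> in M. I (T h h) \<omega> = (W h \<omega>)\<^sup>2 - 1))"

end

theory Submission
  imports Defs "HOL-Real_Asymp.Real_Asymp"
begin

text \<open>Diagonalizing \<open>f\<^sub>n\<close> gives \<open>G\<^sub>n = \<Sum>\<^sub>k \<lambda>\<^sub>k (Z\<^sub>k\<^sup>2 - 1)\<close> with independent standard normal \<open>Z\<^sub>k\<close>. With
  \<open>\<mu>\<^sub>k = 2 \<lambda>\<^sub>k\<close>, \<open>a = 1/\<alpha>\<^sub>1\<close> and \<open>b = - 1/\<alpha>\<^sub>2\<close>, the hypothesis on the cumulants says that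
  \<open>(1/2) \<Sum>\<^sub>k \<mu>\<^sub>k\<^sup>j\<close> tends to \<open>p\<^sub>1 a\<^sup>j + p\<^sub>2 b\<^sup>j\<close> for \<open>2 \<le> j \<le> 6\<close>. Hence
  \<open>\<Sum>\<^sub>k \<mu>\<^sub>k\<^sup>2 (\<mu>\<^sub>k - a)\<^sup>2 (\<mu>\<^sub>k - b)\<^sup>2\<close> tends to 0, the measures \<open>\<Sum>\<^sub>k \<mu>\<^sub>k\<^sup>2 \<delta>(\<mu>\<^sub>k)\<close> concentrate at \<open>a\<close> and \<open>b\<close>,
  and the orders 2 and 3 determine the limiting masses. So the characteristic functions of \<open>G\<^sub>n\<close>
  converge to that of \<open>X\<close>. A Lindeberg replacement of the \<open>Y\<^sub>i\<close> by standard normals costs at most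
  a constant times \<open>\<Sum>\<^sub>i Inf\<^sub>i\<^bsup>3/2\<^esup>\<close>, which is at most the square root of the maximal influence times
  the bounded total influence.\<close>

subsection \<open>Diagonalization of real symmetric matrices\<close>

text \<open>The number of eigenvalues grows with n, and many small ones could add up to a Gaussian
  component in the limit. The polynomial \<open>x^2 (x - a)^2 (x - b)^2\<close> rules this out:
  after division by \<open>x^2\<close> it equals \<open>a^2 b^2 > 0\<close> at 0, so no weight
  \<open>x^2\<close> survives near 0. It is nonnegative, vanishes at a and b, and involves exactly
  the powers 2 to 6.

  The vanishing diagonal of f enters twice. It makes the trace zero, so the centered diagonal form
  coincides with the uncentered quadratic form in the variables \<open>W (e i)\<close>, the form
  that the replacement compares with the homogeneous sum. It also makes the form affine in each
  single variable; as the \<open>Y i\<close> have variance 1, the first two moments match those of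
  the normal law, and only third moments appear in the error. The cumulant of order 2 is a multiple
  of the sum of all influences, hence their boundedness.

  Characteristic functions yield weak convergence only; uniformity over the test functions comes
  from a Skorohod coupling.\<close>

lemma compact_orthogonal_frames:
  assumes "finite I"
  shows "compact {u :: 'i \<times> 'i \<Rightarrow> real.
    (\<forall>k\<in>I. \<forall>l\<in>I. (\<Sum>j\<in>I. u (k, j) * u (l, j)) = (if k = l then 1 else 0)) \<and>
    (\<forall>i\<in>I. \<forall>j\<in>I. (\<Sum>k\<in>I. u (k, i) * u (k, j)) = (if i = j then 1 else 0)) \<and>
    (\<forall>p. p \<notin> I \<times> I \<longrightarrow> u p = 0)}" (is "compact ?F")
proof -
  have "closed ?F"
    unfolding Collect_conj_eq Collect_ball_eq Collect_all_eq Collect_imp_eq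
    by (intro closed_Int closed_INT ballI allI closed_Collect_eq closed_Un)
       (auto intro!: continuous_intros continuous_on_product_coordinates)
  \<comment> \<open>Tychonoff: the cube is compact even for an infinite index type. It contains the
    frames because rows have norm 1 and the entries off \<open>I \<times> I\<close> are pinned to
    0.\<close>
  moreover have "compact (PiE UNIV (\<lambda>_. {-1..1}) :: ('i \<times> 'i \<Rightarrow> real) set)"
    using compactin_PiE[of "\<lambda>_. euclidean" UNIV "\<lambda>_::'i \<times> 'i. {-1..1::real}"]
    by (simp add: euclidean_product_topology)
  moreover have "?F \<subseteq> PiE UNIV (\<lambda>_. {-1..1})"
  proof (intro subsetI)
    fix u assume u: "u \<in> ?F"
    have "\<bar>u (k, j)\<bar> \<le> 1" for k j
    proof (cases "k \<in> I \<and> j \<in> I")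
      case True
      have "(u (k, j))\<^sup>2 \<le> (\<Sum>j\<in>I. (u (k, j))\<^sup>2)"
        using True assms by (intro member_le_sum) auto
      also have "\<dots> = 1" using u True by (auto simp: power2_eq_square)
      finally show ?thesis by (simp add: abs_square_le_1)
    qed (use u in auto)
    then show "u \<in> PiE UNIV (\<lambda>_. {-1..1})" by (auto simp: abs_le_iff minus_le_iff)
  qed
  ultimately show ?thesis
    using closed_Int_compact[of ?F "PiE UNIV (\<lambda>_. {-1..1})"] by (simp only: Int_absorb2)
qed

text \<open>The expression is the off-diagonal entry of a symmetric 2 by 2 matrix with off-diagonal
  entry b and diagonal gap d after a rotation with cosine c and sine s. It changes sign over a
  quarter turn: b at angle 0, -b at the right angle.\<close>

lemma exists_rotation_angle:
  fixes b d :: real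
  shows "\<exists>c s. c\<^sup>2 + s\<^sup>2 = 1 \<and> (c\<^sup>2 - s\<^sup>2) * b + c * s * d = 0"
proof -
  let ?p = "\<lambda>x. ((cos x)\<^sup>2 - (sin x)\<^sup>2) * b + cos x * sin x * d"
  have "\<exists>x. ?p x = 0"
  proof (cases "b \<le> 0")
    case True
    have "\<exists>x\<ge>0. x \<le> pi / 2 \<and> ?p x = 0"
      by (rule IVT') (use True in \<open>auto intro!: continuous_intros\<close>)
    then show ?thesis by blast
  next
    case False
    have "\<exists>x\<ge>0. x \<le> pi / 2 \<and> ?p x = 0"
      by (rule IVT2') (use False in \<open>auto intro!: continuous_intros\<close>)
    then show ?thesis by blast
  qed
  then show ?thesis by (metis sin_cos_squared_add2)
qed

text \<open>Jacobi's argument: among all orthogonal frames take one that maximizes the sum of squares of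
  the diagonal entries. A nonzero off-diagonal entry could be rotated away in its coordinate plane,
  which would increase that sum.\<close>

lemma real_symmetric_diagonalization:
  fixes f :: "'i \<Rightarrow> 'i \<Rightarrow> real"
  assumes fin: "finite I" and sym: "\<And>i j. i \<in> I \<Longrightarrow> j \<in> I \<Longrightarrow> f i j = f j i"
  obtains lam u where
    "\<And>k l. k \<in> I \<Longrightarrow> l \<in> I \<Longrightarrow> (\<Sum>j\<in>I. u k j * u l j) = (if k = l then 1 else 0)"
    "\<And>i j. i \<in> I \<Longrightarrow> j \<in> I \<Longrightarrow> f i j = (\<Sum>k\<in>I. lam k * u k i * u k j)"
proof -
  \<comment> \<open>Rows and columns are both required to be orthonormal: the column relations
    recover f from its matrix in the new frame, and having them in \<open>F\<close> avoids inverting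
    a matrix.\<close>
  define F where "F = {u :: 'i \<times> 'i \<Rightarrow> real.
    (\<forall>k\<in>I. \<forall>l\<in>I. (\<Sum>j\<in>I. u (k, j) * u (l, j)) = (if k = l then 1 else 0)) \<and>
    (\<forall>i\<in>I. \<forall>j\<in>I. (\<Sum>k\<in>I. u (k, i) * u (k, j)) = (if i = j then 1 else 0)) \<and>
    (\<forall>p. p \<notin> I \<times> I \<longrightarrow> u p = 0)}"
  define q where "q u k l = (\<Sum>i\<in>I. \<Sum>j\<in>I. u (k, i) * f i j * u (l, j))" for u :: "'i \<times> 'i \<Rightarrow> real" and k l
  define \<Phi> where "\<Phi> u = (\<Sum>k\<in>I. (q u k k)\<^sup>2)" for u
  have "(\<lambda>p. if p \<in> I \<times> I \<and> fst p = snd p then 1 else 0) \<in> F"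
  proof -
    have "(\<Sum>j\<in>I. (if k \<in> I \<and> j \<in> I \<and> k = j then 1::real else 0) * (if l \<in> I \<and> j \<in> I \<and> l = j then 1 else 0))
        = (if k = l then 1 else 0)" if "k \<in> I" "l \<in> I" for k l
    proof -
      have "(\<Sum>j\<in>I. (if k \<in> I \<and> j \<in> I \<and> k = j then 1::real else 0) * (if l \<in> I \<and> j \<in> I \<and> l = j then 1 else 0))
        = (\<Sum>j\<in>I. if k = j then (if l = k then 1 else 0) else 0)"
        using that by (intro sum.cong) auto
      then show ?thesis using that fin by simp
    qed
    moreover have "(\<Sum>k\<in>I. (if k \<in> I \<and> i \<in> I \<and> k = i then 1::real else 0) * (if k \<in> I \<and> j \<in> I \<and> k = j then 1 else 0))
        = (if i = j then 1 else 0)" if "i \<in> I" "j \<in> I" for i j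
    proof -
      have "(\<Sum>k\<in>I. (if k \<in> I \<and> i \<in> I \<and> k = i then 1::real else 0) * (if k \<in> I \<and> j \<in> I \<and> k = j then 1 else 0))
        = (\<Sum>k\<in>I. if k = i then (if i = j then 1 else 0) else 0)"
        using that by (intro sum.cong) auto
      then show ?thesis using that fin by simp
    qed
    ultimately show ?thesis by (auto simp: F_def)
  qed
  then have "F \<noteq> {}" by blast
  moreover have "continuous_on F \<Phi>"
    unfolding \<Phi>_def q_def
    by (intro continuous_intros continuous_on_subset[OF continuous_on_product_coordinates subset_UNIV])
  moreover have "compact F" unfolding F_def using fin by (rule compact_orthogonal_frames)
  ultimately obtain u where uF: "u \<in> F" and umax: "\<And>v. v \<in> F \<Longrightarrow> \<Phi> v \<le> \<Phi> u"
    using continuous_attains_sup[of F \<Phi>] by blast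
  have rows: "(\<Sum>j\<in>I. u (k, j) * u (l, j)) = (if k = l then 1 else 0)" if "k \<in> I" "l \<in> I" for k l
    using uF that by (auto simp: F_def)
  have cols: "(\<Sum>k\<in>I. u (k, i) * u (k, j)) = (if i = j then 1 else 0)" if "i \<in> I" "j \<in> I" for i j
    using uF that by (auto simp: F_def)
  have off: "u p = 0" if "p \<notin> I \<times> I" for p using uF that by (cases p) (auto simp: F_def)
  have qsym: "q v k l = q v l k" for v k l
    unfolding q_def by (subst sum.swap) (intro sum.cong refl, simp add: sym mult.commute)
  have diag: "q u k l = 0" if kl: "k \<in> I" "l \<in> I" "k \<noteq> l" for k l
  proof (rule ccontr)
    assume nz: "q u k l \<noteq> 0"
    obtain c s where cs: "c\<^sup>2 + s\<^sup>2 = 1" "(c\<^sup>2 - s\<^sup>2) * q u k l + c * s * (q u l l - q u k k) = 0"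
      using exists_rotation_angle by metis
    \<comment> \<open>The rotated frame: row k becomes \<open>c u_k + s u_l\<close>, row l becomes
      \<open>c u_l - s u_k\<close>, all others stay. Writing every row as \<open>a m\<close> times
      itself plus \<open>b m\<close> times its partner \<open>\<sigma> m\<close> lets a single
      bilinear expansion cover all cases.\<close>
    define \<sigma> where "\<sigma> m = (if m = k then l else if m = l then k else m)" for m
    define a where "a m = (if m = k \<or> m = l then c else 1)" for m
    define b where "b m = (if m = k then s else if m = l then - s else 0)" for m
    define v where "v p = a (fst p) * u p + b (fst p) * u (\<sigma> (fst p), snd p)" for p
    have \<sigma>I: "\<sigma> m \<in> I" if "m \<in> I" for m using that kl by (auto simp: \<sigma>_def)
    have qv: "q v m n = a m * a n * q u m n + a m * b n * q u m (\<sigma> n)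
        + b m * a n * q u (\<sigma> m) n + b m * b n * q u (\<sigma> m) (\<sigma> n)" for m n
      unfolding q_def v_def by (simp add: sum_distrib_left sum.distrib[symmetric] algebra_simps)
    have "v \<in> F"
    unfolding F_def proof (intro CollectI conjI ballI allI impI)
      fix m n assume mn: "m \<in> I" "n \<in> I"
      have "(\<Sum>j\<in>I. v (m, j) * v (n, j)) =
          a m * a n * (\<Sum>j\<in>I. u (m, j) * u (n, j)) + a m * b n * (\<Sum>j\<in>I. u (m, j) * u (\<sigma> n, j))
        + b m * a n * (\<Sum>j\<in>I. u (\<sigma> m, j) * u (n, j)) + b m * b n * (\<Sum>j\<in>I. u (\<sigma> m, j) * u (\<sigma> n, j))"
        unfolding v_def by (simp add: sum_distrib_left sum.distrib[symmetric] algebra_simps)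
      also have "\<dots> = (if m = n then 1 else 0)"
        using cs(1) kl mn by (simp add: rows \<sigma>I) (auto simp: a_def b_def \<sigma>_def power2_eq_square)
      finally show "(\<Sum>j\<in>I. v (m, j) * v (n, j)) = (if m = n then 1 else 0)" .
    next
      fix i j assume ij: "i \<in> I" "j \<in> I"
      have split: "sum h I = h k + h l + sum h (I - {k, l})" for h :: "'i \<Rightarrow> real"
        using kl fin sum.subset_diff[of "{k, l}" I h] by simp
      have "v (k, i) * v (k, j) + v (l, i) * v (l, j) = (c\<^sup>2 + s\<^sup>2) * (u (k, i) * u (k, j) + u (l, i) * u (l, j))"
        using kl by (simp add: v_def a_def b_def \<sigma>_def algebra_simps power2_eq_square)
      then have "(\<Sum>k\<in>I. v (k, i) * v (k, j)) = (\<Sum>k\<in>I. u (k, i) * u (k, j))"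
        using cs(1) by (simp add: split) (intro sum.cong refl, simp add: v_def a_def b_def)
      then show "(\<Sum>k\<in>I. v (k, i) * v (k, j)) = (if i = j then 1 else 0)" using cols ij by simp
    next
      fix p assume "p \<notin> I \<times> I"
      then show "v p = 0" using off kl unfolding v_def
        by (cases p) (auto simp: \<sigma>_def b_def)
    qed
    then have le: "\<Phi> v \<le> \<Phi> u" by (rule umax)
    define A B D where "A = q u k k" and "B = q u k l" and "D = q u l l"
    have B0: "(c\<^sup>2 - s\<^sup>2) * B + c * s * (D - A) = 0" using cs(2) by (simp add: A_def B_def D_def)
    have vk: "q v k k = c\<^sup>2 * A + 2 * c * s * B + s\<^sup>2 * D" and vl: "q v l l = s\<^sup>2 * A - 2 * c * s * B + c\<^sup>2 * D"
      using kl qsym[of u l k] by (simp_all add: qv a_def b_def \<sigma>_def A_def B_def D_def power2_eq_square algebra_simps)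
    \<comment> \<open>A rotation preserves the sum of squares of the four entries of the block. The
      bracket is the new off-diagonal entry, which the choice of c and s makes 0, so its former
      share \<open>2 * B^2\<close> passes to the diagonal.\<close>
    have "(q v k k)\<^sup>2 + (q v l l)\<^sup>2 + 2 * ((c\<^sup>2 - s\<^sup>2) * B + c * s * (D - A))\<^sup>2
        = (c\<^sup>2 + s\<^sup>2)\<^sup>2 * (A\<^sup>2 + D\<^sup>2 + 2 * B\<^sup>2)"
      unfolding vk vl by algebra
    then have gain: "(q v k k)\<^sup>2 + (q v l l)\<^sup>2 = A\<^sup>2 + D\<^sup>2 + 2 * B\<^sup>2" using B0 cs(1) by simp
    have split: "sum h I = h k + h l + sum h (I - {k, l})" for h :: "'i \<Rightarrow> real"
      using kl fin sum.subset_diff[of "{k, l}" I h] by simp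
    have "(\<Sum>m\<in>I - {k, l}. (q v m m)\<^sup>2) = (\<Sum>m\<in>I - {k, l}. (q u m m)\<^sup>2)"
      by (intro sum.cong refl) (simp add: qv a_def b_def)
    then have "\<Phi> v = \<Phi> u + 2 * B\<^sup>2"
      unfolding \<Phi>_def split using gain by (simp add: A_def D_def)
    with le nz show False by (simp add: B_def)
  qed
  show thesis
  proof (rule that[of "\<lambda>k j. u (k, j)" "\<lambda>k. q u k k"])
    show "(\<Sum>j\<in>I. u (k, j) * u (l, j)) = (if k = l then 1 else 0)" if "k \<in> I" "l \<in> I" for k l
      using rows that .
    fix i j assume ij: "i \<in> I" "j \<in> I"
    have delta: "(\<Sum>k\<in>I. (if k = i then 1 else 0) * h k) = h i" if "i \<in> I" for i and h :: "'i \<Rightarrow> real"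
      using that fin by (simp add: sum.delta' if_distrib[of "\<lambda>x. x * _"] cong: if_cong)
    have "(\<Sum>k\<in>I. q u k k * u (k, i) * u (k, j)) = (\<Sum>k\<in>I. \<Sum>l\<in>I. q u k l * u (k, i) * u (l, j))"
    proof (intro sum.cong refl)
      fix k assume k: "k \<in> I"
      have "(\<Sum>l\<in>I. q u k l * u (k, i) * u (l, j)) = (\<Sum>l\<in>I. (if l = k then 1 else 0) * (q u k l * u (k, i) * u (l, j)))"
        using k diag by (intro sum.cong) auto
      then show "q u k k * u (k, i) * u (k, j) = (\<Sum>l\<in>I. q u k l * u (k, i) * u (l, j))"
        using k by (simp add: delta)
    qed
    \<comment> \<open>Expanding q and exchanging the sums pairs each row index with its own product
      of entries, so the orthonormal columns collapse both sums over rows.\<close>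
    also have "\<dots> = (\<Sum>i'\<in>I. \<Sum>j'\<in>I. (\<Sum>k\<in>I. u (k, i') * u (k, i)) * (\<Sum>l\<in>I. u (l, j') * u (l, j)) * f i' j')"
    proof -
      have "(\<Sum>k\<in>I. \<Sum>l\<in>I. q u k l * u (k, i) * u (l, j))
          = (\<Sum>k\<in>I. \<Sum>l\<in>I. \<Sum>i'\<in>I. \<Sum>j'\<in>I. u (k, i') * u (k, i) * (u (l, j') * u (l, j)) * f i' j')"
        unfolding q_def by (simp add: sum_distrib_left sum_distrib_right mult_ac)
      also have "\<dots> = (\<Sum>k\<in>I. \<Sum>i'\<in>I. \<Sum>l\<in>I. \<Sum>j'\<in>I. u (k, i') * u (k, i) * (u (l, j') * u (l, j)) * f i' j')"
        by (intro sum.cong refl sum.swap)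
      also have "\<dots> = (\<Sum>i'\<in>I. \<Sum>k\<in>I. \<Sum>j'\<in>I. \<Sum>l\<in>I. u (k, i') * u (k, i) * (u (l, j') * u (l, j)) * f i' j')"
        by (subst sum.swap) (intro sum.cong refl sum.swap)
      also have "\<dots> = (\<Sum>i'\<in>I. \<Sum>j'\<in>I. \<Sum>k\<in>I. \<Sum>l\<in>I. u (k, i') * u (k, i) * (u (l, j') * u (l, j)) * f i' j')"
        by (intro sum.cong refl sum.swap)
      finally show ?thesis by (simp only: sum_product) (simp only: sum_distrib_right)
    qed
    also have "\<dots> = (\<Sum>i'\<in>I. (if i' = i then 1 else 0) * (\<Sum>j'\<in>I. (if j' = j then 1 else 0) * f i' j'))"
      using ij by (simp add: cols sum_distrib_left mult_ac cong: sum.cong)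
    also have "\<dots> = f i j" using ij by (simp add: delta)
    finally show "f i j = (\<Sum>k\<in>I. q u k k * u (k, i) * u (k, j))" ..
  qed
qed

subsection \<open>Gaussian vectors\<close>

text \<open>The shifted weight \<open>2 + w\<close> is positive, so it defines a probability measure to which the
  one-dimensional uniqueness theorem for characteristic functions applies.\<close>

lemma (in prob_space) weight_independent_of_char:
  fixes Z w :: "'a \<Rightarrow> real" and c :: real
  assumes [measurable]: "Z \<in> borel_measurable M" "w \<in> borel_measurable M"
    and w: "\<And>x. \<bar>w x\<bar> \<le> 1"
    and char: "\<And>t. (CLINT x|M. iexp (t * Z x) * w x) = (CLINT x|M. iexp (t * Z x)) * c"
    and B: "B \<in> sets borel"
  shows "(\<integral>x. indicator B (Z x) * w x \<partial>M) = measure M {x\<in>space M. Z x \<in> B} * c"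
proof -
  have iw: "integrable M w" using w by (intro integrable_const_bound[of _ 1]) auto
  \<comment> \<open>At \<open>t = 0\<close> the hypothesis says that c is the mean of w. Hence
    \<open>c \<ge> -1\<close>, and the total mass \<open>2 + c\<close> of the weight
    \<open>2 + w\<close> is at least 1.\<close>
  have "complex_of_real (\<integral>x. w x \<partial>M) = of_real c"
    using char[of 0] by (simp add: prob_space)
  then have c: "(\<integral>x. w x \<partial>M) = c" by (simp only: of_real_eq_iff)
  have c1: "-1 \<le> c"
    using integral_mono[OF _ iw, of "\<lambda>_. -1"] w by (simp add: c prob_space abs_le_iff minus_le_iff)
  define v where "v x = (2 + w x) / (2 + c)" for x
  have v0: "0 \<le> v x" for x using c1 w[of x] by (simp add: v_def)
  have [measurable]: "v \<in> borel_measurable M" unfolding v_def by measurable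
  have iv: "integrable M v" unfolding v_def using iw by simp
  have v1: "(\<integral>x. v x \<partial>M) = 1" unfolding v_def using iw c1 by (simp add: c prob_space)
  define Q where "Q = density M (\<lambda>x. ennreal (v x))"
  interpret Q: prob_space Q
    unfolding Q_def by standard (simp add: emeasure_density nn_integral_eq_integral iv v0 v1)
  have [measurable_cong]: "sets Q = sets M" by (simp add: Q_def)
  have spQ: "space Q = space M" by (simp add: Q_def)
  have ii: "integrable M (\<lambda>x. iexp (t * Z x))" for t by (rule integrable_const_bound[of _ 1]) auto
  have ii2: "integrable M (\<lambda>x. iexp (t * Z x) * w x)" for t
    using w by (intro integrable_const_bound[of _ 1]) (auto simp: norm_mult)
  have "char (distr Q borel Z) = char (distr M borel Z)"
  proof
    fix t
    have "char (distr Q borel Z) t = (CLINT x|M. v x *\<^sub>R iexp (t * Z x))"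
      unfolding char_def Q_def using v0 by (simp add: integral_distr integral_density)
    also have "\<dots> = (CLINT x|M. (2 * iexp (t * Z x) + iexp (t * Z x) * w x) / (2 + c))"
      by (intro Bochner_Integration.integral_cong refl) (simp add: v_def scaleR_conv_of_real field_simps)
    also have "\<dots> = (2 * (CLINT x|M. iexp (t * Z x)) + (CLINT x|M. iexp (t * Z x) * w x)) / (2 + c)"
      using ii[of t] ii2[of t] by simp
    also have "\<dots> = (CLINT x|M. iexp (t * Z x)) * ((2 + complex_of_real c) / (2 + complex_of_real c))"
      unfolding char by (simp add: field_simps)
    also have "(2 + complex_of_real c) / (2 + complex_of_real c) = 1"
      using c1 by (auto simp: complex_eq_iff)
    finally show "char (distr Q borel Z) t = char (distr M borel Z) t"
      unfolding char_def by (simp add: integral_distr)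
  qed
  then have "distr Q borel Z = distr M borel Z"
    by (intro Levy_uniqueness Q.real_distribution_distr real_distribution_distr) auto
  then have "measure (distr Q borel Z) B = measure (distr M borel Z) B" by simp
  then have eq: "measure Q {x\<in>space M. Z x \<in> B} = measure M {x\<in>space M. Z x \<in> B}"
    using B by (simp add: measure_distr spQ vimage_def Int_def conj_commute)
  have "measure Q {x\<in>space M. Z x \<in> B} = (\<integral>x. indicator {x\<in>space M. Z x \<in> B} x \<partial>Q)"
    by (simp add: spQ Int_absorb2 subset_eq)
  also have "\<dots> = (\<integral>x. v x * indicator {x\<in>space M. Z x \<in> B} x \<partial>M)"
    unfolding Q_def using v0 B by (subst integral_density) auto
  also have "\<dots> = (\<integral>x. (2 * indicator {x\<in>space M. Z x \<in> B} x + indicator B (Z x) * w x) / (2 + c) \<partial>M)"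
    by (intro Bochner_Integration.integral_cong refl) (auto simp: v_def indicator_def)
  also have "\<dots> = (2 * measure M {x\<in>space M. Z x \<in> B} + (\<integral>x. indicator B (Z x) * w x \<partial>M)) / (2 + c)"
  proof -
    have "integrable M (\<lambda>x. indicator B (Z x) * w x)"
      using w B by (intro integrable_const_bound[of _ 1]) (auto simp: indicator_def)
    moreover have "{x\<in>space M. Z x \<in> B} \<in> events" using B by measurable
    ultimately show ?thesis by (simp add: less_top[symmetric])
  qed
  \<comment> \<open>The constant part 2 of the weight contributes equally to both sides and drops
    out, leaving the claim for w itself.\<close>
  finally show ?thesis unfolding eq using c1 by (simp add: field_simps)
qed

text \<open>Only the one-dimensional uniqueness theorem is available. One coordinate is split off at a
  time: conditioning on \<open>Z z \<in> B z\<close> does not change the characteristic functions of the linear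
  combinations of the remaining coordinates.\<close>

lemma gaussian_tuple_prob:
  fixes Z :: "'i \<Rightarrow> 'a \<Rightarrow> real" and P :: "'a measure"
  assumes "finite K" "prob_space P"
    and "\<And>k. k \<in> K \<Longrightarrow> Z k \<in> borel_measurable P"
    and "\<And>c. (CLINT \<omega>|P. iexp (\<Sum>k\<in>K. c k * Z k \<omega>)) = of_real (exp (- (\<Sum>k\<in>K. (c k)\<^sup>2) / 2))"
    and "\<And>k. k \<in> K \<Longrightarrow> B k \<in> sets borel"
  shows "measure P {\<omega>\<in>space P. \<forall>k\<in>K. Z k \<omega> \<in> B k} = (\<Prod>k\<in>K. measure std_normal_distribution (B k))"
  using assms
\<comment> \<open>P must vary, since the step applies the induction hypothesis to P conditioned on
  an event about \<open>Z z\<close>.\<close>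
proof (induction K arbitrary: P rule: finite_induct)
  case empty
  then show ?case by (simp add: prob_space.prob_space)
next
  case (insert z K)
  interpret P: prob_space P by fact
  have [measurable]: "Z z \<in> borel_measurable P" "\<And>k. k \<in> K \<Longrightarrow> Z k \<in> borel_measurable P"
    using insert.prems by auto
  have Bz[measurable]: "B z \<in> sets borel" and [measurable]: "\<And>k. k \<in> K \<Longrightarrow> B k \<in> sets borel"
    using insert.prems by auto
  have joint: "(CLINT \<omega>|P. iexp (t * Z z \<omega> + (\<Sum>k\<in>K. c k * Z k \<omega>)))
     = of_real (exp (- t\<^sup>2 / 2)) * of_real (exp (- (\<Sum>k\<in>K. (c k)\<^sup>2) / 2))" for t c
  proof -
    have "(\<Sum>k\<in>insert z K. (if k = z then t else c k) * Z k \<omega>) = t * Z z \<omega> + (\<Sum>k\<in>K. c k * Z k \<omega>)" for \<omega>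
      using insert.hyps by (simp, intro sum.cong) auto
    moreover have "(\<Sum>k\<in>insert z K. (if k = z then t else c k)\<^sup>2) = t\<^sup>2 + (\<Sum>k\<in>K. (c k)\<^sup>2)"
      using insert.hyps by (simp, intro sum.cong) auto
    ultimately show ?thesis
      using insert.prems(3)[of "\<lambda>k. if k = z then t else c k"]
      by (simp add: mult_exp_exp add_divide_distrib flip: of_real_mult)
  qed
  have charz: "(CLINT \<omega>|P. iexp (t * Z z \<omega>)) = of_real (exp (- t\<^sup>2 / 2))" for t
    using joint[of t "\<lambda>_. 0"] by simp
  have "char (distr P borel (Z z)) = char std_normal_distribution"
    unfolding char_std_normal_distribution fun_eq_iff using charz by (simp add: char_def integral_distr)
  then have "distr P borel (Z z) = std_normal_distribution"
    by (intro Levy_uniqueness P.real_distribution_distr real_dist_normal_dist) auto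
  then have "measure std_normal_distribution (B z) = measure (distr P borel (Z z)) (B z)" by simp
  then have pz: "measure P {\<omega>\<in>space P. Z z \<omega> \<in> B z} = measure std_normal_distribution (B z)" (is "measure P ?A = _")
    by (simp add: measure_distr vimage_def Int_def conj_commute)
  have [measurable]: "?A \<in> sets P" by measurable
  show ?case
  proof (cases "measure P ?A = 0")
    \<comment> \<open>A null event cannot be conditioned on, but here both sides are 0.\<close>
    case True
    have "measure P {\<omega>\<in>space P. \<forall>k\<in>insert z K. Z k \<omega> \<in> B k} \<le> measure P ?A"
      by (intro P.finite_measure_mono) auto
    then show ?thesis using True pz insert.hyps by (simp add: measure_le_0_iff)
  next
    case False
    define v where "v \<omega> = indicator ?A \<omega> / measure P ?A" for \<omega>
    define Q where "Q = density P (\<lambda>x. ennreal (v x))"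
    have v0: "0 \<le> v x" for x by (simp add: v_def)
    have [measurable]: "v \<in> borel_measurable P" unfolding v_def by measurable
    have iv: "integrable P v" unfolding v_def by (auto simp: less_top[symmetric])
    have v1: "(\<integral>x. v x \<partial>P) = 1" unfolding v_def using False by simp
    interpret Q: prob_space Q
      unfolding Q_def by standard (simp add: emeasure_density nn_integral_eq_integral iv v0 v1)
    have [measurable_cong]: "sets Q = sets P" by (simp add: Q_def)
    have spQ: "space Q = space P" by (simp add: Q_def)
    have "measure Q {\<omega>\<in>space Q. \<forall>k\<in>K. Z k \<omega> \<in> B k} = (\<Prod>k\<in>K. measure std_normal_distribution (B k))"
    proof (rule insert.IH)
      show "prob_space Q" by (rule Q.prob_space_axioms)
      show "Z k \<in> borel_measurable Q" if "k \<in> K" for k using that by measurable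
      show "B k \<in> sets borel" if "k \<in> K" for k using that insert.prems by auto
      fix c :: "'i \<Rightarrow> real"
      define S where "S \<omega> = (\<Sum>k\<in>K. c k * Z k \<omega>)" for \<omega>
      define r where "r = exp (- (\<Sum>k\<in>K. (c k)\<^sup>2) / 2)"
      have [measurable]: "S \<in> borel_measurable P" unfolding S_def by measurable
      have jp: "(CLINT \<omega>|P. iexp (t * Z z \<omega> + S \<omega>)) = (CLINT \<omega>|P. iexp (t * Z z \<omega>)) * r" for t
        unfolding S_def r_def charz by (rule joint)
      have jm: "(CLINT \<omega>|P. iexp (t * Z z \<omega> - S \<omega>)) = (CLINT \<omega>|P. iexp (t * Z z \<omega>)) * r" for t
        using joint[of t "\<lambda>k. - c k"] unfolding S_def r_def charz by (simp add: sum_negf)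
      have ii: "integrable P (\<lambda>\<omega>. iexp (g \<omega>))" if "g \<in> borel_measurable P" for g
        using that by (intro P.integrable_const_bound[of _ 1]) auto
      \<comment> \<open>Weights must be real and bounded by 1, so \<open>iexp (S \<omega>)\<close>
        is split into cosine and sine. The joint characteristic function is the same with S and with
        -S: half the sum gives the constant r for the cosine, the difference gives 0 for the
        sine.\<close>
      have "(CLINT \<omega>|P. iexp (t * Z z \<omega>) * cos (S \<omega>)) = (CLINT \<omega>|P. iexp (t * Z z \<omega>)) * r" for t
      proof -
        have "(CLINT \<omega>|P. iexp (t * Z z \<omega>) * cos (S \<omega>))
           = (CLINT \<omega>|P. (iexp (t * Z z \<omega> + S \<omega>) + iexp (t * Z z \<omega> - S \<omega>)) / 2)"
          by (intro Bochner_Integration.integral_cong refl)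
             (simp add: cos_of_real[symmetric] cos_exp_eq exp_add exp_diff exp_minus field_simps)
        also have "\<dots> = ((CLINT \<omega>|P. iexp (t * Z z \<omega> + S \<omega>)) + (CLINT \<omega>|P. iexp (t * Z z \<omega> - S \<omega>))) / 2"
          using Bochner_Integration.integral_add[OF ii ii, of "\<lambda>\<omega>. t * Z z \<omega> + S \<omega>" "\<lambda>\<omega>. t * Z z \<omega> - S \<omega>"]
          by (simp only: integral_divide_zero) simp
        finally show ?thesis unfolding jp jm by simp
      qed
      then have C: "(\<integral>x. indicator (B z) (Z z x) * cos (S x) \<partial>P) = measure P ?A * r"
        by (intro P.weight_independent_of_char) auto
      have "(CLINT \<omega>|P. iexp (t * Z z \<omega>) * sin (S \<omega>)) = (CLINT \<omega>|P. iexp (t * Z z \<omega>)) * (0::real)" for t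
      proof -
        have "(CLINT \<omega>|P. iexp (t * Z z \<omega>) * sin (S \<omega>))
           = (CLINT \<omega>|P. (iexp (t * Z z \<omega> + S \<omega>) - iexp (t * Z z \<omega> - S \<omega>)) / (2 * \<i>))"
          by (intro Bochner_Integration.integral_cong refl)
             (simp add: sin_of_real[symmetric] sin_exp_eq exp_add exp_diff exp_minus field_simps)
        also have "\<dots> = ((CLINT \<omega>|P. iexp (t * Z z \<omega> + S \<omega>)) - (CLINT \<omega>|P. iexp (t * Z z \<omega> - S \<omega>))) / (2 * \<i>)"
          using Bochner_Integration.integral_diff[OF ii ii, of "\<lambda>\<omega>. t * Z z \<omega> + S \<omega>" "\<lambda>\<omega>. t * Z z \<omega> - S \<omega>"]
          by (simp only: integral_divide_zero) simp
        finally show ?thesis unfolding jp jm by simp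
      qed
      then have D: "(\<integral>x. indicator (B z) (Z z x) * sin (S x) \<partial>P) = measure P ?A * 0"
        by (intro P.weight_independent_of_char) auto
      have intC: "integrable P (\<lambda>x. indicator (B z) (Z z x) * cos (S x))"
        and intD: "integrable P (\<lambda>x. indicator (B z) (Z z x) * sin (S x))"
        by (intro P.integrable_const_bound[of _ 1]; auto simp: indicator_def)+
      have "(CLINT \<omega>|Q. iexp (S \<omega>)) = (CLINT \<omega>|P. v \<omega> *\<^sub>R iexp (S \<omega>))"
        unfolding Q_def using v0 by (simp add: integral_density)
      also have "\<dots> = (CLINT x|P. (complex_of_real (indicator (B z) (Z z x) * cos (S x))
            + \<i> * complex_of_real (indicator (B z) (Z z x) * sin (S x))) / measure P ?A)"
        by (intro Bochner_Integration.integral_cong refl)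
           (auto simp: v_def indicator_def exp_Euler scaleR_conv_of_real cos_of_real[symmetric] sin_of_real[symmetric])
      also have "\<dots> = (complex_of_real (\<integral>x. indicator (B z) (Z z x) * cos (S x) \<partial>P)
            + \<i> * complex_of_real (\<integral>x. indicator (B z) (Z z x) * sin (S x) \<partial>P)) / measure P ?A"
        using integrable_of_real[OF intC, where 'a=complex] integrable_of_real[OF intD, where 'a=complex]
        by (simp del: of_real_mult)
      also have "\<dots> = of_real r" unfolding C D using False by simp
      finally show "(CLINT \<omega>|Q. iexp (\<Sum>k\<in>K. c k * Z k \<omega>)) = of_real (exp (- (\<Sum>k\<in>K. (c k)\<^sup>2) / 2))"
        by (simp only: S_def r_def)
    qed
    moreover have "measure Q {\<omega>\<in>space Q. \<forall>k\<in>K. Z k \<omega> \<in> B k}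
       = measure P {\<omega>\<in>space P. \<forall>k\<in>insert z K. Z k \<omega> \<in> B k} / measure P ?A"
    proof -
      have m[measurable]: "{\<omega>\<in>space P. \<forall>k\<in>K. Z k \<omega> \<in> B k} \<in> sets P"
        using insert.hyps(1) by measurable
      have "measure Q {\<omega>\<in>space Q. \<forall>k\<in>K. Z k \<omega> \<in> B k} = (\<integral>x. indicator {\<omega>\<in>space P. \<forall>k\<in>K. Z k \<omega> \<in> B k} x \<partial>Q)"
        unfolding spQ by (simp add: spQ Int_absorb2 subset_eq)
      also have "\<dots> = (\<integral>x. v x * indicator {\<omega>\<in>space P. \<forall>k\<in>K. Z k \<omega> \<in> B k} x \<partial>P)"
        unfolding Q_def using v0 by (subst integral_density) auto
      also have "\<dots> = (\<integral>x. indicator {\<omega>\<in>space P. \<forall>k\<in>insert z K. Z k \<omega> \<in> B k} x / measure P ?A \<partial>P)"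
        by (intro Bochner_Integration.integral_cong refl) (auto simp: v_def indicator_def)
      also have "\<dots> = measure P {\<omega>\<in>space P. \<forall>k\<in>insert z K. Z k \<omega> \<in> B k} / measure P ?A"
      proof -
        have "{\<omega>\<in>space P. \<forall>k\<in>insert z K. Z k \<omega> \<in> B k} = ?A \<inter> {\<omega>\<in>space P. \<forall>k\<in>K. Z k \<omega> \<in> B k}" by auto
        then have "{\<omega>\<in>space P. \<forall>k\<in>insert z K. Z k \<omega> \<in> B k} \<in> sets P" by simp
        then show ?thesis by simp
      qed
      finally show ?thesis .
    qed
    ultimately show ?thesis using False insert.hyps by (simp add: pz field_simps)
  qed
qed

lemma gaussian_tuple_distr:
  fixes Z :: "'i \<Rightarrow> 'a \<Rightarrow> real" and P :: "'a measure"
  assumes K: "finite K" and P: "prob_space P"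
    and Z[measurable]: "\<And>k. k \<in> K \<Longrightarrow> Z k \<in> borel_measurable P"
    and char: "\<And>c. (CLINT \<omega>|P. iexp (\<Sum>k\<in>K. c k * Z k \<omega>)) = of_real (exp (- (\<Sum>k\<in>K. (c k)\<^sup>2) / 2))"
  shows "distr P (\<Pi>\<^sub>M k\<in>K. borel) (\<lambda>\<omega>. \<lambda>k\<in>K. Z k \<omega>) = (\<Pi>\<^sub>M k\<in>K. std_normal_distribution)"
proof -
  interpret P: prob_space P by fact
  interpret N: real_distribution std_normal_distribution by (rule real_dist_normal_dist)
  interpret product_sigma_finite "\<lambda>_::'i. std_normal_distribution"
    by (simp add: product_sigma_finite_def N.sigma_finite_measure)
  have [measurable]: "(\<lambda>\<omega>. \<lambda>k\<in>K. Z k \<omega>) \<in> measurable P (\<Pi>\<^sub>M k\<in>K. borel)"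
    using Z by (intro measurable_restrict) auto
  show ?thesis
  proof (rule PiM_eqI[OF K])
    show "sets (distr P (\<Pi>\<^sub>M k\<in>K. borel) (\<lambda>\<omega>. \<lambda>k\<in>K. Z k \<omega>)) = sets (\<Pi>\<^sub>M k\<in>K. std_normal_distribution)"
      by (simp cong: sets_PiM_cong)
    fix A assume A: "\<And>k. k \<in> K \<Longrightarrow> A k \<in> sets std_normal_distribution"
    have "Pi\<^sub>E K A \<in> sets (\<Pi>\<^sub>M k\<in>K. borel)" using A K by (intro sets_PiM_I_finite) auto
    then have "emeasure (distr P (\<Pi>\<^sub>M k\<in>K. borel) (\<lambda>\<omega>. \<lambda>k\<in>K. Z k \<omega>)) (Pi\<^sub>E K A)
      = emeasure P {\<omega>\<in>space P. \<forall>k\<in>K. Z k \<omega> \<in> A k}"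
      by (simp add: emeasure_distr) (intro arg_cong2[where f=emeasure] refl; auto simp: PiE_iff)
    also have "\<dots> = (\<Prod>k\<in>K. emeasure std_normal_distribution (A k))"
      unfolding P.emeasure_eq_measure N.emeasure_eq_measure
      using gaussian_tuple_prob[OF K P Z char, of A] A by (simp add: prod_ennreal)
    finally show "emeasure (distr P (\<Pi>\<^sub>M k\<in>K. borel) (\<lambda>\<omega>. \<lambda>k\<in>K. Z k \<omega>)) (Pi\<^sub>E K A)
      = (\<Prod>k\<in>K. emeasure std_normal_distribution (A k))" .
  qed
qed

subsection \<open>Characteristic functions of gamma laws\<close>

text \<open>The second-order remainder of \<open>iexp\<close> is at most
  \<open>(s - t)^2 / 2\<close> times \<open>(q x)^2\<close>, so a finite second moment makes the
  error of differentiating under the integral quadratic in \<open>s - t\<close>.\<close>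

lemma (in prob_space) has_vector_derivative_char:
  fixes q :: "'a \<Rightarrow> real"
  assumes [measurable]: "q \<in> borel_measurable M" and q: "integrable M q" and q2: "integrable M (\<lambda>x. (q x)\<^sup>2)"
  shows "((\<lambda>t. CLINT x|M. iexp (t * q x)) has_vector_derivative (CLINT x|M. \<i> * (q x * iexp (t * q x)))) (at t)"
proof -
  define V where "V = (\<integral>x. (q x)\<^sup>2 \<partial>M)"
  have V0: "0 \<le> V" unfolding V_def by simp
  have ii: "integrable M (\<lambda>x. iexp (s * q x))" for s by (rule integrable_const_bound[of _ 1]) auto
  have iq: "integrable M (\<lambda>x. \<i> * (q x * iexp (t * q x)))"
    using q by (rule Bochner_Integration.integrable_bound) (auto simp: norm_mult)
  have pt: "cmod (iexp (s * y) - iexp (t * y) - (s - t) *\<^sub>R (\<i> * (y * iexp (t * y)))) \<le> (s - t)\<^sup>2 / 2 * y\<^sup>2" for s y :: real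
  proof -
    have "iexp (s * y) - iexp (t * y) - (s - t) *\<^sub>R (\<i> * (y * iexp (t * y)))
       = iexp (t * y) * (iexp ((s - t) * y) - (\<Sum>k \<le> 1. (\<i> * ((s - t) * y))^k / fact k))"
      by (simp add: ring_distribs exp_add exp_diff exp_minus scaleR_conv_of_real field_simps)
    moreover have "cmod (iexp ((s - t) * y) - (\<Sum>k \<le> 1. (\<i> * ((s - t) * y))^k / fact k)) \<le> ((s - t) * y)\<^sup>2 / fact 2"
      using iexp_approx1[of "(s - t) * y" 1] unfolding Suc_1 power2_abs .
    ultimately show ?thesis by (simp add: norm_mult power_mult_distrib)
  qed
  have bd: "cmod ((CLINT x|M. iexp (s * q x)) - (CLINT x|M. iexp (t * q x))
      - (s - t) *\<^sub>R (CLINT x|M. \<i> * (q x * iexp (t * q x)))) \<le> (s - t)\<^sup>2 / 2 * V" for s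
  proof -
    have "(CLINT x|M. iexp (s * q x)) - (CLINT x|M. iexp (t * q x))
      - (s - t) *\<^sub>R (CLINT x|M. \<i> * (q x * iexp (t * q x)))
     = (CLINT x|M. iexp (s * q x) - iexp (t * q x) - (s - t) *\<^sub>R (\<i> * (q x * iexp (t * q x))))"
      using ii iq by (simp only: Bochner_Integration.integral_diff Bochner_Integration.integrable_diff
          integral_scaleR_right integrable_scaleR_right simp_thms)
    also have "cmod \<dots> \<le> (\<integral>x. (s - t)\<^sup>2 / 2 * (q x)\<^sup>2 \<partial>M)"
      by (rule order_trans[OF integral_norm_bound integral_mono])
         (use ii iq q2 pt in \<open>auto simp del: scaleR_conv_of_real of_real_mult\<close>)
    finally show ?thesis by (simp add: V_def)
  qed
  show ?thesis
    unfolding has_vector_derivative_def has_derivative_at_alt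
  proof (intro conjI allI impI)
    show "bounded_linear (\<lambda>h. h *\<^sub>R (CLINT x|M. \<i> * (q x * iexp (t * q x))))"
      by (rule bounded_linear_scaleR_left)
    fix e :: real assume e: "e > 0"
    have "cmod ((CLINT x|M. iexp (s * q x)) - (CLINT x|M. iexp (t * q x))
      - (s - t) *\<^sub>R (CLINT x|M. \<i> * (q x * iexp (t * q x)))) \<le> e * norm (s - t)"
      if "norm (s - t) < e / (V + 1)" for s
    proof -
      have "\<bar>s - t\<bar> * (V + 1) \<le> e" using that V0 by (simp add: field_simps)
      then have "\<bar>s - t\<bar> * V \<le> e * 2" using V0 e by (simp add: algebra_simps)
      then have "\<bar>s - t\<bar> * (\<bar>s - t\<bar> * V) \<le> \<bar>s - t\<bar> * (e * 2)" by (intro mult_left_mono) auto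
      then have "(s - t)\<^sup>2 / 2 * V \<le> e * \<bar>s - t\<bar>" by (simp add: power2_eq_square field_simps flip: abs_mult)
      then show ?thesis using bd[of s] by simp
    qed
    then show "\<exists>d>0. \<forall>s. norm (s - t) < d \<longrightarrow> cmod ((CLINT x|M. iexp (s * q x)) - (CLINT x|M. iexp (t * q x))
      - (s - t) *\<^sub>R (CLINT x|M. \<i> * (q x * iexp (t * q x)))) \<le> e * norm (s - t)"
      using e V0 by (intro exI[of _ "e / (V + 1)"]) auto
  qed
qed

text \<open>Real part 1 keeps clear of the branch cut of \<open>Ln\<close>, which is therefore
  differentiable at all the arguments that occur below.\<close>

lemma one_minus_imag_notin_nonpos_Reals: "1 - \<i> * complex_of_real y \<notin> \<real>\<^sub>\<le>\<^sub>0"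
  by (auto simp: complex_nonpos_Reals_iff)

text \<open>The hypothesis says that the characteristic function \<open>F\<close> of \<open>q\<close> solves
  \<open>F' = \<i> p F / (a - \<i> t)\<close>.\<close>

lemma (in prob_space) char_gamma_type:
  fixes q :: "'a \<Rightarrow> real" and a p t :: real
  assumes [measurable]: "q \<in> borel_measurable M" and q: "integrable M q" and q2: "integrable M (\<lambda>x. (q x)\<^sup>2)"
    and a: "0 < a"
    and ode: "\<And>t. (a - \<i> * t) * (CLINT x|M. q x * iexp (t * q x)) = p * (CLINT x|M. iexp (t * q x))"
  shows "(CLINT x|M. iexp (t * q x)) = exp (- complex_of_real p * Ln (1 - \<i> * (t / a)))"
proof -
  let ?F = "\<lambda>t. CLINT x|M. iexp (t * q x)"
  let ?E = "\<lambda>t::real. exp (complex_of_real p * Ln (1 - \<i> * (t / a)))"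
  have iq: "integrable M (\<lambda>x. q x * iexp (t * q x))" for t
    using q by (rule Bochner_Integration.integrable_bound) (auto simp: norm_mult)
  \<comment> \<open>Integrating factor: \<open>?E t\<close> is the p-th power of
    \<open>1 - \<i> t / a\<close>, the reciprocal of the claimed solution, so the product has zero
    derivative; its value at 0 is 1.\<close>
  have "((\<lambda>t. ?F t * ?E t) has_vector_derivative 0) (at t)" for t :: real
  proof -
    have nz: "complex_of_real a - \<i> * t \<noteq> 0" using a by (auto simp: complex_eq_iff)
    have Q: "(CLINT x|M. q x * iexp (t * q x)) = p * ?F t / (a - \<i> * t)"
      using ode[of t] nz by (simp add: field_simps)
    have F: "(?F has_vector_derivative \<i> * (p * ?F t / (a - \<i> * t))) (at t)"
      using has_vector_derivative_char[OF assms(1) q q2, of t] unfolding integral_mult_right_zero Q .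
    have E: "(?E has_vector_derivative (?E t * (p * ((- \<i> / a) * inverse (1 - \<i> * (t / a)))))) (at t)"
    proof -
      have "((\<lambda>z. exp (complex_of_real p * Ln (1 - \<i> * (z / a)))) has_field_derivative
         (?E t * (p * ((- \<i> / a) * inverse (1 - \<i> * (t / a)))))) (at (of_real t))"
        using one_minus_imag_notin_nonpos_Reals[of "t / a"] a
        by (auto intro!: derivative_eq_intros simp: field_simps)
      from has_vector_derivative_real_field[OF this] show ?thesis by simp
    qed
    have D: "(- \<i> / a) * inverse (1 - \<i> * (t / a)) = - (\<i> / (a - \<i> * t))"
      using a nz by (auto simp: field_simps)
    have "?F t * (?E t * (p * - (\<i> / (a - \<i> * t)))) + \<i> * (p * ?F t / (a - \<i> * t)) * ?E t = 0"
      by simp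
    with has_vector_derivative_mult[OF F E[unfolded D]] show ?thesis by (simp only:)
  qed
  then obtain c where c: "\<And>t. ?F t * ?E t = c"
    using has_vector_derivative_zero_constant[OF convex_UNIV, of "\<lambda>t. ?F t * ?E t"] by auto
  have "c = 1" using c[of 0] by (simp add: prob_space)
  with c[of t] have "?F t * ?E t = 1" by simp
  then have "?F t = inverse (?E t)" by (metis inverse_unique mult.commute)
  then show ?thesis by (simp add: exp_minus)
qed


lemma has_bochner_integral_gamma:
  fixes a r :: real
  assumes a: "0 < a" and r: "0 < r"
  shows "has_bochner_integral lborel (\<lambda>x. if 0 < x then x powr (r - 1) * exp (- a * x) else 0) (Gamma r / a powr r)"
proof (rule has_bochner_integral_nn_integral)
  let ?g = "\<lambda>x. if 0 < x then x powr (r - 1) * exp (- a * x) else 0"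
  have "ennreal (Gamma r) = (\<integral>\<^sup>+t. ennreal (indicator {0..} t * t powr (r - 1) / exp t) \<partial>lborel)"
    using Gamma_conv_nn_integral_real[OF r] .
  also have "\<dots> = ennreal \<bar>a\<bar> * (\<integral>\<^sup>+x. ennreal (indicator {0..} (0 + a * x) * (0 + a * x) powr (r - 1) / exp (0 + a * x)) \<partial>lborel)"
    using a by (intro nn_integral_real_affine) auto
  also have "(\<integral>\<^sup>+x. ennreal (indicator {0..} (0 + a * x) * (0 + a * x) powr (r - 1) / exp (0 + a * x)) \<partial>lborel)
     = (\<integral>\<^sup>+x. ennreal (a powr (r - 1)) * ennreal (?g x) \<partial>lborel)"
    using a by (intro nn_integral_cong)
      (auto simp: indicator_def zero_le_mult_iff powr_mult exp_minus ennreal_mult'[symmetric] field_simps)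
  also have "\<dots> = ennreal (a powr (r - 1)) * (\<integral>\<^sup>+x. ennreal (?g x) \<partial>lborel)"
    by (rule nn_integral_cmult) measurable
  finally have "ennreal (Gamma r) = ennreal (a powr r) * (\<integral>\<^sup>+x. ennreal (?g x) \<partial>lborel)"
    using a by (simp add: mult.assoc[symmetric] ennreal_mult'[symmetric] powr_mult_base)
  then have "ennreal (1 / a powr r) * ennreal (Gamma r) = ennreal (1 / a powr r) * ennreal (a powr r) * (\<integral>\<^sup>+x. ennreal (?g x) \<partial>lborel)"
    by (simp add: mult.assoc)
  then show "(\<integral>\<^sup>+x. ennreal (?g x) \<partial>lborel) = ennreal (Gamma r / a powr r)"
    using a by (simp add: ennreal_mult'[symmetric])
qed (use a r in \<open>auto intro!: less_imp_le[OF Gamma_real_pos]\<close>)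

text \<open>The differential equation comes from integrating the derivative of
  \<open>x powr p * exp (- (\<alpha> - \<i> t) x)\<close> over the half-line.\<close>

lemma char_gamma_law:
  fixes \<alpha> p :: real
  assumes \<alpha>: "0 < \<alpha>" and p: "0 < p"
  shows "real_distribution (gamma_law \<alpha> p)"
    and "char (gamma_law \<alpha> p) t = exp (- complex_of_real p * Ln (1 - \<i> * (t / \<alpha>)))"
proof -
  define c where "c = \<alpha> powr p / Gamma p"
  have Gp: "Gamma p \<noteq> 0" using Gamma_real_pos[OF p] by linarith
  have c: "c > 0" using \<alpha> p by (simp add: c_def Gamma_real_pos)
  \<comment> \<open>The unnormalized density with shape r. Multiplication by x raises r by 1, so the
    moments and the differential equation reduce to integrals of \<open>g\<close>.\<close>
  define g where "g r x = (if 0 < x then x powr (r - 1) * exp (- \<alpha> * x) else 0)" for r x :: real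
  have [measurable]: "g r \<in> borel_measurable borel" for r unfolding g_def by measurable
  have g0: "0 \<le> g r x" for r x by (simp add: g_def)
  have hbg: "has_bochner_integral lborel (g r) (Gamma r / \<alpha> powr r)" if "r > 0" for r
    unfolding g_def using has_bochner_integral_gamma[OF \<alpha> that] .
  have law: "gamma_law \<alpha> p = density lborel (\<lambda>x. ennreal (c * g p x))"
    unfolding gamma_law_def by (intro density_cong) (auto simp: c_def g_def mult_ac)
  have ps: "prob_space (gamma_law \<alpha> p)"
  proof
    have "(\<integral>\<^sup>+x. ennreal (c * g p x) \<partial>lborel) = ennreal (\<integral>x. c * g p x \<partial>lborel)"
      using hbg[OF p] c g0 by (intro nn_integral_eq_integral) (auto simp: has_bochner_integral_iff)
    also have "(\<integral>x. c * g p x \<partial>lborel) = 1"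
      using hbg[OF p] \<alpha> Gp by (simp add: has_bochner_integral_iff c_def)
    finally show "emeasure (gamma_law \<alpha> p) (space (gamma_law \<alpha> p)) = 1"
      by (simp add: law emeasure_density)
  qed
  then show "real_distribution (gamma_law \<alpha> p)"
    by (simp add: real_distribution_def real_distribution_axioms_def law)
  interpret prob_space "gamma_law \<alpha> p" by fact
  have step: "x * g r x = g (r + 1) x" for x r
    by (auto simp: g_def powr_mult_base)
  have i1: "integrable (gamma_law \<alpha> p) (\<lambda>x. x)"
  proof -
    have "integrable lborel (\<lambda>x. c * g (p + 1) x)" using hbg[of "p + 1"] p by (simp add: has_bochner_integral_iff)
    moreover have "c * g (p + 1) x = (c * g p x) *\<^sub>R x" for x
      by (simp only: step[symmetric]) simp
    ultimately show ?thesis unfolding law using c g0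
      by (subst integrable_density) auto
  qed
  have i2: "integrable (gamma_law \<alpha> p) (\<lambda>x. x\<^sup>2)"
  proof -
    have "integrable lborel (\<lambda>x. c * g (p + 1 + 1) x)" using hbg[of "p + 1 + 1"] p by (simp add: has_bochner_integral_iff)
    moreover have "(\<lambda>x. c * g (p + 1 + 1) x) = (\<lambda>x. (c * g p x) *\<^sub>R x\<^sup>2)"
      by (simp only: step[symmetric]) (simp add: power2_eq_square mult_ac)
    ultimately have H: "integrable lborel (\<lambda>x. (c * g p x) *\<^sub>R x\<^sup>2)" by (simp only:)
    show ?thesis unfolding law using c g0
      by (subst integrable_density) (use H in simp_all)
  qed
  have "char (gamma_law \<alpha> p) t = (CLINT x|gamma_law \<alpha> p. iexp (t * x))" by (simp add: char_def)
  also have "\<dots> = exp (- complex_of_real p * Ln (1 - \<i> * (t / \<alpha>)))"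
  proof (rule char_gamma_type[OF _ i1 i2 \<alpha>])
    show "random_variable borel (\<lambda>x. x)" by (simp add: law)
    fix t :: real
    let ?F = "\<lambda>x. complex_of_real (x powr p * exp (- \<alpha> * x)) * iexp (t * x)"
    let ?f = "\<lambda>x. complex_of_real (p * g p x - \<alpha> * g (p + 1) x) * iexp (t * x) + \<i> * t * (g (p + 1) x * iexp (t * x))"
    have ig: "integrable lborel (\<lambda>x. g r x * iexp (t * x))" if "r > 0" for r
    proof (rule Bochner_Integration.integrable_bound[of lborel "g r"])
      show "integrable lborel (g r)" using hbg[OF that] by (simp add: has_bochner_integral_iff)
      show "AE x in lborel. norm (complex_of_real (g r x) * iexp (t * x)) \<le> norm (g r x)"
        by (rule AE_I2) (simp only: norm_mult norm_exp_i_times norm_of_real mult_1_right real_norm_def order_refl)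
    qed measurable
    have if_: "integrable lborel ?f"
      using ig[of p] ig[of "p + 1"] p by (simp add: left_diff_distrib mult.assoc)
    \<comment> \<open>Integrated over the open half-line because the derivative is unbounded at 0
      when \<open>p < 1\<close>. Only one-sided limits of \<open>?F\<close> are needed; they vanish
      at 0 since \<open>p > 0\<close> and at infinity since \<open>\<alpha> > 0\<close>.\<close>
    have "(LBINT x=0..\<infinity>. ?f x) = 0 - 0"
    proof (rule interval_integral_FTC_integrable)
      fix x :: real assume "0 < ereal x"
      then have x: "0 < x" by simp
      have "((\<lambda>x. x powr p * exp (- \<alpha> * x)) has_real_derivative (p * g p x - \<alpha> * g (p + 1) x)) (at x)"
        using x by (auto intro!: derivative_eq_intros simp: g_def field_simps powr_diff)
      then have "((\<lambda>x. complex_of_real (x powr p * exp (- \<alpha> * x))) has_vector_derivative complex_of_real (p * g p x - \<alpha> * g (p + 1) x)) (at x)"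
        by (intro has_vector_derivative_of_real) (simp add: has_real_derivative_iff_has_vector_derivative)
      moreover have "((\<lambda>x. iexp (t * x)) has_vector_derivative (\<i> * t * iexp (t * x))) (at x)"
      proof -
        have "((\<lambda>z. exp (\<i> * (t * z))) has_field_derivative (\<i> * t * iexp (t * x))) (at (of_real x))"
          by (auto intro!: derivative_eq_intros)
        from has_vector_derivative_real_field[OF this] show ?thesis by simp
      qed
      ultimately have "(?F has_vector_derivative (complex_of_real (x powr p * exp (- \<alpha> * x)) * (\<i> * t * iexp (t * x))
          + complex_of_real (p * g p x - \<alpha> * g (p + 1) x) * iexp (t * x))) (at x)"
        by (rule has_vector_derivative_mult)
      also have "complex_of_real (x powr p * exp (- \<alpha> * x)) * (\<i> * t * iexp (t * x))
          + complex_of_real (p * g p x - \<alpha> * g (p + 1) x) * iexp (t * x) = ?f x"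
        using x by (simp add: g_def mult_ac)
      finally show "(?F has_vector_derivative ?f x) (at x)" .
      show "isCont ?f x"
      proof (rule continuous_on_interior[of "{0<..}"])
        show "continuous_on {0<..} ?f"
          unfolding g_def by (rule continuous_on_eq[of _ "\<lambda>x. complex_of_real (p * (x powr (p - 1) * exp (- \<alpha> * x)) - \<alpha> * (x powr p * exp (- \<alpha> * x))) * iexp (t * x) + \<i> * t * (of_real (x powr p * exp (- \<alpha> * x)) * iexp (t * x))"])
             (auto intro!: continuous_intros)
      qed (use x in \<open>simp add: interior_open\<close>)
    next
      show "set_integrable lborel (einterval 0 \<infinity>) ?f"
        unfolding set_integrable_def by (intro integrable_mult_indicator if_) auto
      have n: "norm (?F x) = x powr p * exp (- \<alpha> * x)" for x by (simp add: norm_mult)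
      have "((\<lambda>x. x powr p * exp (- \<alpha> * x)) \<longlongrightarrow> 0) (at_right 0)" using p \<alpha> by real_asymp
      then have "(?F \<longlongrightarrow> 0) (at_right 0)" by (subst tendsto_norm_zero_iff[symmetric]) (simp only: n)
      then show "((?F \<circ> real_of_ereal) \<longlongrightarrow> 0) (at_right 0)"
        by (simp add: zero_ereal_def ereal_tendsto_simps)
      have "((\<lambda>x. x powr p * exp (- \<alpha> * x)) \<longlongrightarrow> 0) at_top" using p \<alpha> by real_asymp
      then have "(?F \<longlongrightarrow> 0) at_top" by (subst tendsto_norm_zero_iff[symmetric]) (simp only: n)
      then show "((?F \<circ> real_of_ereal) \<longlongrightarrow> 0) (at_left \<infinity>)"
        by (simp add: ereal_tendsto_simps)
    qed simp
    also have "(LBINT x=0..\<infinity>. ?f x) = (\<integral>x. ?f x \<partial>lborel)"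
      by (simp add: interval_lebesgue_integral_def set_lebesgue_integral_def zero_ereal_def)
         (intro Bochner_Integration.integral_cong refl, auto simp: g_def indicator_def)
    finally have z: "(\<integral>x. ?f x \<partial>lborel) = 0" by simp
    have d: "(CLINT x|gamma_law \<alpha> p. h x) = (\<integral>x. (c * g p x) *\<^sub>R h x \<partial>lborel)"
      if [measurable]: "h \<in> borel_measurable borel" for h :: "real \<Rightarrow> complex"
      unfolding law using c g0 by (subst integral_density) auto
    have "(CLINT x|gamma_law \<alpha> p. x * iexp (t * x)) = c * (\<integral>x. g (p + 1) x * iexp (t * x) \<partial>lborel)"
      unfolding integral_mult_right_zero[symmetric] step[symmetric]
      by (subst d) (simp_all add: scaleR_conv_of_real mult_ac)
    moreover have "(CLINT x|gamma_law \<alpha> p. iexp (t * x)) = c * (\<integral>x. g p x * iexp (t * x) \<partial>lborel)"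
      unfolding integral_mult_right_zero[symmetric] by (subst d) (simp_all add: scaleR_conv_of_real mult_ac)
    moreover have "p * (\<integral>x. g p x * iexp (t * x) \<partial>lborel) - \<alpha> * (\<integral>x. g (p + 1) x * iexp (t * x) \<partial>lborel)
        + \<i> * t * (\<integral>x. g (p + 1) x * iexp (t * x) \<partial>lborel) = 0"
      using z ig[of p] ig[of "p + 1"] p by (simp add: left_diff_distrib mult.assoc)
    ultimately show "(\<alpha> - \<i> * t) * (CLINT x|gamma_law \<alpha> p. x * iexp (t * x)) = p * (CLINT x|gamma_law \<alpha> p. iexp (t * x))"
      by algebra
  qed
  finally show "char (gamma_law \<alpha> p) t = exp (- complex_of_real p * Ln (1 - \<i> * (t / \<alpha>)))" .
qed


text \<open>The square of a standard normal variable is gamma with shape and rate 1/2. Integrating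
  the derivative of \<open>x * std_normal_density x * iexp (t * x^2)\<close> over the line gives the
  equation of \<open>char_gamma_type\<close> for \<open>a = p = 1/2\<close> directly, with no change
  of variables in the density.\<close>

lemma char_std_normal_square:
  "(CLINT x|std_normal_distribution. iexp (t * x\<^sup>2)) = exp (- complex_of_real (1 / 2) * Ln (1 - \<i> * (t / (1 / 2))))"
proof -
  interpret real_distribution std_normal_distribution by (rule real_dist_normal_dist)
  show ?thesis
  proof (rule char_gamma_type)
    show "integrable std_normal_distribution (\<lambda>x. x\<^sup>2)" "integrable std_normal_distribution (\<lambda>x. (x\<^sup>2)\<^sup>2)"
      using integrable_std_normal_distribution_moment[of 2] integrable_std_normal_distribution_moment[of 4]
      by (simp_all flip: power_mult)
    fix t :: real
    let ?\<phi> = std_normal_density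
    let ?F = "\<lambda>x. complex_of_real (x * ?\<phi> x) * iexp (t * x\<^sup>2)"
    let ?f = "\<lambda>x. complex_of_real (?\<phi> x - ?\<phi> x * x\<^sup>2) * iexp (t * x\<^sup>2) + \<i> * (2 * t) * (complex_of_real (?\<phi> x * x\<^sup>2) * iexp (t * x\<^sup>2))"
    have i0: "integrable lborel (\<lambda>x. ?\<phi> x * iexp (t * x\<^sup>2))"
      by (rule Bochner_Integration.integrable_bound[of lborel ?\<phi>]) (auto simp: norm_mult)
    have i1: "integrable lborel (\<lambda>x. complex_of_real (?\<phi> x * x\<^sup>2) * iexp (t * x\<^sup>2))"
      by (rule Bochner_Integration.integrable_bound[OF integrable_std_normal_moment[of 2]]) (auto simp: norm_mult norm_power)
    have if_: "integrable lborel ?f"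
      using i0 i1 by (simp add: left_diff_distrib)
    have "(LBINT x=-\<infinity>..\<infinity>. ?f x) = 0 - 0"
    proof (rule interval_integral_FTC_integrable)
      fix x :: real
      have "((\<lambda>x. x * ?\<phi> x) has_real_derivative (?\<phi> x - ?\<phi> x * x\<^sup>2)) (at x)"
      proof -
        have "((\<lambda>x. x * (c * exp (- x\<^sup>2 / 2))) has_real_derivative (c * exp (- x\<^sup>2 / 2) - c * exp (- x\<^sup>2 / 2) * x\<^sup>2)) (at x)" for c
          by (auto intro!: derivative_eq_intros simp: algebra_simps power2_eq_square)
        then show ?thesis unfolding std_normal_density_def .
      qed
      then have "((\<lambda>x. complex_of_real (x * ?\<phi> x)) has_vector_derivative complex_of_real (?\<phi> x - ?\<phi> x * x\<^sup>2)) (at x)"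
        by (intro has_vector_derivative_of_real) (simp add: has_real_derivative_iff_has_vector_derivative)
      moreover have "((\<lambda>x. iexp (t * x\<^sup>2)) has_vector_derivative (\<i> * (2 * t) * x * iexp (t * x\<^sup>2))) (at x)"
      proof -
        have "((\<lambda>z. exp (\<i> * (t * z\<^sup>2))) has_field_derivative (\<i> * (2 * t) * x * iexp (t * x\<^sup>2))) (at (of_real x))"
          by (auto intro!: derivative_eq_intros)
        from has_vector_derivative_real_field[OF this] show ?thesis by simp
      qed
      ultimately have "(?F has_vector_derivative (complex_of_real (x * ?\<phi> x) * (\<i> * (2 * t) * x * iexp (t * x\<^sup>2))
            + complex_of_real (?\<phi> x - ?\<phi> x * x\<^sup>2) * iexp (t * x\<^sup>2))) (at x)"
        by (rule has_vector_derivative_mult)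
      also have "complex_of_real (x * ?\<phi> x) * (\<i> * (2 * t) * x * iexp (t * x\<^sup>2))
            + complex_of_real (?\<phi> x - ?\<phi> x * x\<^sup>2) * iexp (t * x\<^sup>2) = ?f x"
        by (simp add: power2_eq_square mult_ac)
      finally show "(?F has_vector_derivative ?f x) (at x)" .
      show "isCont ?f x" unfolding std_normal_density_def by (intro continuous_intros) auto
    next
      show "set_integrable lborel (einterval (-\<infinity>) \<infinity>) ?f"
        unfolding set_integrable_def by (intro integrable_mult_indicator if_) auto
      have n: "norm (?F x) = \<bar>x\<bar> * ?\<phi> x" for x by (simp add: norm_mult abs_mult)
      have "((\<lambda>x. \<bar>x\<bar> * ?\<phi> x) \<longlongrightarrow> 0) at_bot" unfolding std_normal_density_def by real_asymp
      then have "(?F \<longlongrightarrow> 0) at_bot" by (subst tendsto_norm_zero_iff[symmetric]) (simp only: n)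
      then show "((?F \<circ> real_of_ereal) \<longlongrightarrow> 0) (at_right (-\<infinity>))"
        by (simp add: ereal_tendsto_simps)
      have "((\<lambda>x. \<bar>x\<bar> * ?\<phi> x) \<longlongrightarrow> 0) at_top" unfolding std_normal_density_def by real_asymp
      then have "(?F \<longlongrightarrow> 0) at_top" by (subst tendsto_norm_zero_iff[symmetric]) (simp only: n)
      then show "((?F \<circ> real_of_ereal) \<longlongrightarrow> 0) (at_left \<infinity>)"
        by (simp add: ereal_tendsto_simps)
    qed simp
    also have "(LBINT x=-\<infinity>..\<infinity>. ?f x) = (\<integral>x. ?f x \<partial>lborel)"
      by (simp add: interval_lebesgue_integral_def set_lebesgue_integral_def)
    finally have z: "(\<integral>x. ?f x \<partial>lborel) = 0" by simp
    have d: "(CLINT x|std_normal_distribution. h x) = (\<integral>x. ?\<phi> x *\<^sub>R h x \<partial>lborel)"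
      if [measurable]: "h \<in> borel_measurable borel" for h :: "real \<Rightarrow> complex"
      by (subst integral_density) auto
    have "(CLINT x|std_normal_distribution. complex_of_real (x\<^sup>2) * iexp (t * x\<^sup>2))
        = (\<integral>x. complex_of_real (?\<phi> x * x\<^sup>2) * iexp (t * x\<^sup>2) \<partial>lborel)"
      by (subst d) (simp_all add: scaleR_conv_of_real mult_ac)
    moreover have "(CLINT x|std_normal_distribution. iexp (t * x\<^sup>2)) = (\<integral>x. ?\<phi> x * iexp (t * x\<^sup>2) \<partial>lborel)"
      by (subst d) (simp_all add: scaleR_conv_of_real)
    moreover have "(\<integral>x. ?\<phi> x * iexp (t * x\<^sup>2) \<partial>lborel) - (\<integral>x. complex_of_real (?\<phi> x * x\<^sup>2) * iexp (t * x\<^sup>2) \<partial>lborel)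
        + \<i> * (2 * t) * (\<integral>x. complex_of_real (?\<phi> x * x\<^sup>2) * iexp (t * x\<^sup>2) \<partial>lborel) = 0"
      using z i0 i1 by (simp add: left_diff_distrib)
    ultimately show "(complex_of_real (1 / 2) - \<i> * t) * (CLINT x|std_normal_distribution. complex_of_real (x\<^sup>2) * iexp (t * x\<^sup>2))
       = complex_of_real (1 / 2) * (CLINT x|std_normal_distribution. iexp (t * x\<^sup>2))"
      by (simp add: algebra_simps)
  qed auto
qed

text \<open>The logarithm of the characteristic function of a centered gamma variable with shape 1. The
  laws compared here all have characteristic functions of the form
  \<open>exp (\<Sum>k. w k * gamma_exponent (m k * t))\<close>.\<close>

definition gamma_exponent :: "real \<Rightarrow> complex" where
  "gamma_exponent y = - Ln (1 - \<i> * y) - \<i> * y"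

lemma continuous_on_gamma_exponent: "continuous_on S gamma_exponent"
  unfolding gamma_exponent_def
  by (intro continuous_intros) (use one_minus_imag_notin_nonpos_Reals in auto)

text \<open>The derivative simplifies to \<open>- x / (1 - \<i> x)\<close>, of modulus at most
  \<open>\<bar>x\<bar>\<close>; the mean value inequality does the rest. The quadratic order at 0 is
  what allows division by \<open>x^2\<close> when many small eigenvalues are summed.\<close>

lemma norm_gamma_exponent_le: "cmod (gamma_exponent y) \<le> y\<^sup>2"
proof -
  have nz: "1 - \<i> * complex_of_real x \<noteq> 0" for x by (auto simp: complex_eq_iff)
  have d: "(gamma_exponent has_vector_derivative (\<i> * inverse (1 - \<i> * x) - \<i>)) (at x within S)" for x :: real and S
  proof -
    have "((\<lambda>z. - Ln (1 - \<i> * z) - \<i> * z) has_field_derivative (\<i> * inverse (1 - \<i> * x) - \<i>)) (at (of_real x))"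
      using one_minus_imag_notin_nonpos_Reals[of x] by (auto intro!: derivative_eq_intros)
    from has_vector_derivative_real_field[OF this] show ?thesis unfolding gamma_exponent_def .
  qed
  have b: "cmod (\<i> * inverse (1 - \<i> * x) - \<i>) \<le> \<bar>y\<bar>" if "x \<in> closed_segment 0 y" for x :: real
  proof -
    have "\<i> * inverse (1 - \<i> * x) - \<i> = - (x * inverse (1 - \<i> * x))"
      using nz[of x] by (simp add: field_simps)
    moreover have "cmod (inverse (1 - \<i> * x)) \<le> 1"
    proof -
      have "1 \<le> cmod (1 - \<i> * x)" using complex_Re_le_cmod[of "1 - \<i> * x"] by simp
      then show ?thesis by (simp add: norm_inverse inverse_le_1_iff)
    qed
    moreover have "\<bar>x\<bar> \<le> \<bar>y\<bar>" using that by (auto simp: closed_segment_eq_real_ivl split: if_splits)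
    ultimately show ?thesis
      using mult_mono[of "\<bar>x\<bar>" "\<bar>y\<bar>" "cmod (inverse (1 - \<i> * x))" 1] by (simp add: norm_mult)
  qed
  have "cmod (gamma_exponent y - gamma_exponent 0) \<le> \<bar>y\<bar> * norm (y - 0)"
  proof (rule differentiable_bound[OF convex_closed_segment])
    show "(gamma_exponent has_derivative (\<lambda>h. h *\<^sub>R (\<i> * inverse (1 - \<i> * x) - \<i>))) (at x within closed_segment 0 y)" for x
      using d unfolding has_vector_derivative_def .
    show "onorm (\<lambda>h. h *\<^sub>R (\<i> * inverse (1 - \<i> * x) - \<i>)) \<le> \<bar>y\<bar>" if "x \<in> closed_segment 0 y" for x :: real
    proof (rule onorm_le)
      fix h :: real
      have "\<bar>h\<bar> * cmod (\<i> * inverse (1 - \<i> * x) - \<i>) \<le> \<bar>h\<bar> * \<bar>y\<bar>"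
        by (rule mult_left_mono[OF b[OF that]]) simp
      then show "norm (h *\<^sub>R (\<i> * inverse (1 - \<i> * x) - \<i>)) \<le> \<bar>y\<bar> * norm h"
        by (simp only: norm_scaleR real_norm_def mult.commute[of "\<bar>y\<bar>"])
    qed
  qed auto
  then show ?thesis by (simp add: gamma_exponent_def power2_eq_square flip: abs_mult)
qed

subsection \<open>Cumulants\<close>

text \<open>For \<open>n \<ge> 1\<close> the n-th derivative of \<open>- Ln (1 - \<i> m t)\<close>
  is \<open>(n - 1)! (\<i> m)^n / (1 - \<i> m t)^n\<close>, and the linear correction in
  \<open>gamma_exponent\<close> only affects order 1. At \<open>t = 0\<close> the powers of
  \<open>\<i>\<close> cancel against those of \<open>- \<i>\<close>.\<close>

lemma cumulant_eq_power_sum: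
  fixes w m :: "'k \<Rightarrow> real"
  assumes char': "\<And>t. char (distr M borel G) t = exp (\<Sum>k\<in>K. w k * gamma_exponent (m k * t))"
    and j: "2 \<le> j"
  shows "cumulant j M G = of_real (fact (j - 1) * (\<Sum>k\<in>K. w k * m k ^ j))"
proof -
  have char: "char (distr M borel G) t = exp (\<Sum>k\<in>K. w k * (- Ln (1 - \<i> * (m k * t)) - \<i> * (m k * t)))" for t
    using char' by (simp add: gamma_exponent_def)
  define L where "L t = (\<Sum>k\<in>K. w k * (- Ln (1 - \<i> * (m k * t)) - \<i> * (m k * t)))" for t :: real
  define A where "A n t = (\<Sum>k\<in>K. w k * ((\<i> * m k) ^ n * fact (n - 1)) * inverse (1 - \<i> * (m k * t)) ^ n)" for n and t :: real
  define b where "b = (\<Sum>k\<in>K. w k * (\<i> * m k))"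
  define f where "f t = Ln (char (distr M borel G) t)" for t
  have nz: "1 - \<i> * complex_of_real y \<noteq> 0" for y by (auto simp: complex_eq_iff)
  have nR: "1 - \<i> * (m k * complex_of_real t) \<notin> \<real>\<^sub>\<le>\<^sub>0" for k t
    using one_minus_imag_notin_nonpos_Reals[of "m k * t"] by simp
  have nz': "1 - \<i> * (m k * complex_of_real t) \<noteq> 0" for k t
    using nz[of "m k * t"] by simp
  have dL: "(L has_vector_derivative A 1 t - b) (at t)" for t
  proof -
    have "((\<lambda>z. \<Sum>k\<in>K. w k * (- Ln (1 - \<i> * (m k * z)) - \<i> * (m k * z))) has_field_derivative (A 1 t - b)) (at (of_real t))"
      unfolding A_def b_def sum_subtractf[symmetric]
      by (rule DERIV_sum) (use nR in \<open>auto intro!: derivative_eq_intros simp: algebra_simps\<close>)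
    from has_vector_derivative_real_field[OF this] show ?thesis unfolding L_def by simp
  qed
  have dA: "(A n has_vector_derivative A (Suc n) t) (at t)" if n: "n \<ge> 1" for n t
  proof -
    have "((\<lambda>z. \<Sum>k\<in>K. w k * ((\<i> * m k) ^ n * fact (n - 1)) * inverse (1 - \<i> * (m k * z)) ^ n) has_field_derivative A (Suc n) t) (at (of_real t))"
      unfolding A_def
    proof (rule DERIV_sum)
      fix k assume "k \<in> K"
      obtain n' where n': "n = Suc n'" using n by (cases n) auto
      show "((\<lambda>z. w k * ((\<i> * m k) ^ n * fact (n - 1)) * inverse (1 - \<i> * (m k * z)) ^ n) has_field_derivative
         w k * ((\<i> * m k) ^ Suc n * fact (Suc n - 1)) * inverse (1 - \<i> * complex_of_real (m k * t)) ^ Suc n) (at (of_real t))"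
      proof -
        have "((\<lambda>z. inverse (1 - \<i> * (m k * z))) has_field_derivative
            \<i> * m k * inverse (1 - \<i> * complex_of_real (m k * t)) ^ 2) (at (of_real t))"
          using nz'[of k t] by (auto intro!: derivative_eq_intros simp: power2_eq_square)
        from DERIV_cmult[OF DERIV_power_Suc[OF this, of n'], of "w k * ((\<i> * m k) ^ n * fact (n - 1))"]
        show ?thesis unfolding n' by (simp add: power2_eq_square mult_ac)
      qed
    qed
    from has_vector_derivative_real_field[OF this] show ?thesis unfolding A_def by simp
  qed
  \<comment> \<open>\<open>Ln\<close> undoes \<open>exp\<close> only where the imaginary part stays
    strictly between -pi and pi; continuity at \<open>L 0 = 0\<close> provides a ball where it
    does.\<close>
  have "isCont L 0" using dL[of 0] by (rule has_vector_derivative_continuous)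
  then have "((\<lambda>t. Im (L t)) \<longlongrightarrow> Im (L 0)) (at 0)" unfolding isCont_def by (rule tendsto_Im)
  moreover have "L 0 = 0" by (simp add: L_def)
  ultimately have "((\<lambda>t. Im (L t)) \<longlongrightarrow> 0) (at 0)" by simp
  then have "\<forall>\<^sub>F t in at 0. dist (Im (L t)) 0 < pi" by (rule tendstoD) simp
  then obtain d where d: "d > 0" "\<And>t. t \<noteq> 0 \<Longrightarrow> dist t 0 < d \<Longrightarrow> \<bar>Im (L t)\<bar> < pi"
    by (auto simp: eventually_at)
  have fL: "f t = L t" if "t \<in> ball 0 d" for t
  proof -
    have "\<bar>Im (L t)\<bar> < pi" using d(2)[of t] that \<open>L 0 = 0\<close> by (cases "t = 0") (auto simp: dist_commute)
    then show ?thesis unfolding f_def char L_def[symmetric] by (intro Ln_exp) (auto simp: abs_less_iff)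
  qed
  let ?D = "\<lambda>\<phi> t. vector_derivative \<phi> (at t)"
  \<comment> \<open>Stated on a whole ball: each further \<open>vector_derivative\<close> needs the
    previous one on a neighbourhood, not just at 0.\<close>
  have iter: "\<forall>t\<in>ball 0 d. (?D ^^ Suc n) f t = A (Suc n) t - (if n = 0 then b else 0)" for n
  proof (induction n)
    case 0
    show ?case
    proof
      fix t :: real assume t: "t \<in> ball 0 d"
      have "(f has_vector_derivative A 1 t - b) (at t)"
        by (rule has_vector_derivative_transform_within_open[OF dL open_ball t]) (simp add: fL)
      then show "(?D ^^ Suc 0) f t = A (Suc 0) t - (if (0::nat) = 0 then b else 0)"
        by (simp add: vector_derivative_at)
    qed
  next
    case (Suc n)
    show ?case
    proof
      fix t :: real assume t: "t \<in> ball 0 d"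
      have "((\<lambda>t. A (Suc n) t - (if n = 0 then b else 0)) has_vector_derivative A (Suc (Suc n)) t - 0) (at t)"
        by (intro has_vector_derivative_diff dA has_vector_derivative_const) auto
      then have "(((?D ^^ Suc n) f) has_vector_derivative A (Suc (Suc n)) t - 0) (at t)"
        by (rule has_vector_derivative_transform_within_open[OF _ open_ball t]) (simp only: Suc.IH)
      then show "(?D ^^ Suc (Suc n)) f t = A (Suc (Suc n)) t - (if Suc n = 0 then b else 0)"
        by (simp add: vector_derivative_at)
    qed
  qed
  obtain n where n: "j = Suc (Suc n)" using j by (metis add_2_eq_Suc le_Suc_ex)
  have "cumulant j M G = (- \<i>) ^ j * A j 0"
    unfolding cumulant_def f_def[symmetric] n using iter[of "Suc n"] d(1) by simp
  also have "\<dots> = of_real (fact (j - 1) * (\<Sum>k\<in>K. w k * m k ^ j))"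
    unfolding A_def by (simp add: sum_distrib_left power_mult_distrib mult_ac)
       (intro sum.cong refl, simp add: mult.assoc[symmetric] power_mult_distrib[symmetric])
  finally show ?thesis .
qed

text \<open>Dividing by \<open>x\<^sup>2\<close>, the hypotheses say that \<open>c0 + c1 x\<close> interpolates at \<open>a\<close> and \<open>b\<close>. The error
  vanishes there, hence on bounded sets it is at most \<open>\<epsilon>\<close> plus a multiple of
  \<open>(x - a)\<^sup>2 (x - b)\<^sup>2\<close>.\<close>

lemma gamma_exponent_interpolation:
  fixes a b t R \<epsilon> :: real and c0 c1 :: complex
  assumes a: "a \<noteq> 0" and b: "b \<noteq> 0" and \<epsilon>: "\<epsilon> > 0"
    and la: "gamma_exponent (t * a) = a\<^sup>2 * (c0 + c1 * a)"
    and lb: "gamma_exponent (t * b) = b\<^sup>2 * (c0 + c1 * b)"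
  shows "\<exists>C. \<forall>x. \<bar>x\<bar> \<le> R \<longrightarrow>
     cmod (gamma_exponent (t * x) - x\<^sup>2 * (c0 + c1 * x)) \<le> x\<^sup>2 * (\<epsilon> + C * ((x - a)\<^sup>2 * (x - b)\<^sup>2))"
proof (rule ccontr)
  define D where "D x = gamma_exponent (t * x) - (complex_of_real x)\<^sup>2 * (c0 + c1 * x)" for x :: real
  define w where "w x = (x - a)\<^sup>2 * (x - b)\<^sup>2" for x
  define B where "B = t\<^sup>2 + cmod c0 + cmod c1 * \<bar>R\<bar>"
  have w0: "w x \<ge> 0" for x by (simp add: w_def)
  have DB: "cmod (D x) \<le> x\<^sup>2 * B" if "\<bar>x\<bar> \<le> R" for x
  proof -
    have "cmod (D x) \<le> cmod (gamma_exponent (t * x)) + x\<^sup>2 * (cmod c0 + cmod c1 * \<bar>x\<bar>)"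
      unfolding D_def
      by (rule order_trans[OF norm_triangle_ineq4 add_left_mono])
         (use norm_triangle_ineq[of c0 "c1 * x"] in \<open>simp add: norm_mult norm_power mult_left_mono\<close>)
    also have "\<dots> \<le> t\<^sup>2 * x\<^sup>2 + x\<^sup>2 * (cmod c0 + cmod c1 * \<bar>R\<bar>)"
      using norm_gamma_exponent_le[of "t * x"] that
      by (intro add_mono mult_left_mono) (auto simp: power_mult_distrib)
    finally show ?thesis by (simp add: B_def algebra_simps)
  qed
  \<comment> \<open>If no C works, there is a violating point for each \<open>C = Suc n\<close>.
    Since the error is at most \<open>x^2 * B\<close>, the weight \<open>w\<close> at these points
    tends to 0, so a limit point is a or b. There the error is 0, yet it would have to be at least
    \<open>x^2 * \<epsilon> > 0\<close>.\<close>
  assume neg: "\<not> ?thesis"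
  have "\<exists>x. \<bar>x\<bar> \<le> R \<and> cmod (D x) > x\<^sup>2 * (\<epsilon> + C * w x)" for C
    using neg unfolding D_def[symmetric] w_def[symmetric] by (force simp: not_le)
  then have "\<forall>n. \<exists>x. \<bar>x\<bar> \<le> R \<and> x\<^sup>2 * (\<epsilon> + real (Suc n) * w x) < cmod (D x)" by blast
  from choice[OF this] obtain X where X: "\<And>n. \<bar>X n\<bar> \<le> R" "\<And>n. cmod (D (X n)) > (X n)\<^sup>2 * (\<epsilon> + real (Suc n) * w (X n))"
    by blast
  have Xn0: "(X n)\<^sup>2 > 0" for n
    using DB[OF X(1), of n] X(2)[of n] by (cases "X n = 0") auto
  have "(X n)\<^sup>2 * (\<epsilon> + real (Suc n) * w (X n)) < (X n)\<^sup>2 * B" for n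
    using DB[OF X(1), of n] X(2)[of n] by linarith
  then have lt: "\<epsilon> + real (Suc n) * w (X n) < B" for n by (rule mult_left_less_imp_less) simp
  have wb: "w (X n) \<le> B * inverse (real (Suc n))" for n
  proof -
    have "real (Suc n) * w (X n) \<le> B" using lt[of n] \<epsilon> by linarith
    then show ?thesis by (simp add: field_simps)
  qed
  have "bounded (range X)" using X(1) by (auto simp: bounded_iff)
  then obtain x r where r: "strict_mono r" "(X \<circ> r) \<longlonglongrightarrow> x"
    using bounded_imp_convergent_subsequence by metis
  have wlim: "(\<lambda>n. w (X n)) \<longlonglongrightarrow> 0"
    by (rule tendsto_sandwich[OF _ _ tendsto_const])
       (use wb w0 tendsto_mult_right_zero[OF LIMSEQ_inverse_real_of_nat, of B] in auto)
  have "(\<lambda>n. w ((X \<circ> r) n)) \<longlonglongrightarrow> w x" unfolding w_def by (intro tendsto_intros r)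
  moreover have "(\<lambda>n. w ((X \<circ> r) n)) \<longlonglongrightarrow> 0" using LIMSEQ_subseq_LIMSEQ[OF wlim r(1)] by (simp add: o_def)
  ultimately have "w x = 0" by (rule LIMSEQ_unique)
  then have xab: "x = a \<or> x = b" by (auto simp: w_def)
  then have Dx: "D x = 0" using la lb by (auto simp: D_def)
  have "continuous_on UNIV D" unfolding D_def
    by (intro continuous_intros continuous_on_compose2[OF continuous_on_gamma_exponent[of UNIV]]) auto
  then have "isCont D x" by (simp add: continuous_on_eq_continuous_at)
  then have "(\<lambda>n. cmod (D ((X \<circ> r) n))) \<longlonglongrightarrow> cmod (D x)"
    by (intro tendsto_norm isCont_tendsto_compose[OF _ r(2)])
  moreover have "(\<lambda>n. ((X \<circ> r) n)\<^sup>2 * \<epsilon>) \<longlonglongrightarrow> x\<^sup>2 * \<epsilon>" by (intro tendsto_intros r)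
  moreover have "((X \<circ> r) n)\<^sup>2 * \<epsilon> \<le> cmod (D ((X \<circ> r) n))" for n
  proof -
    have "(X (r n))\<^sup>2 * \<epsilon> \<le> (X (r n))\<^sup>2 * (\<epsilon> + real (Suc (r n)) * w (X (r n)))"
      using w0 by (intro mult_left_mono) auto
    with X(2)[of "r n"] show ?thesis by simp
  qed
  ultimately have "x\<^sup>2 * \<epsilon> \<le> cmod (D x)" by (intro LIMSEQ_le[of _ "x\<^sup>2 * \<epsilon>"]) auto
  then show False using Dx xab a b \<epsilon> by (auto simp: mult_le_0_iff)
qed

text \<open>The exponent is traded for \<open>x^2 (c0 + c1 x)\<close>, a combination of the powers 2
  and 3, whose sums converge by hypothesis. The error summed over k is at most
  \<open>\<epsilon>\<close> times a bounded sum of squares plus a constant times a quantity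
  \<open>Q\<close> that tends to 0.\<close>

lemma gamma_exponent_sum_tendsto:
  fixes m :: "nat \<Rightarrow> 'k \<Rightarrow> real" and K :: "nat \<Rightarrow> 'k set" and a b pa pb t :: real
  assumes fin: "\<And>n. finite (K n)" and a: "a \<noteq> 0" and b: "b \<noteq> 0" and ab: "a \<noteq> b"
    and lim: "\<And>j. j \<in> {2..6} \<Longrightarrow> (\<lambda>n. \<Sum>k\<in>K n. m n k ^ j / 2) \<longlonglongrightarrow> pa * a ^ j + pb * b ^ j"
  shows "(\<lambda>n. \<Sum>k\<in>K n. gamma_exponent (t * m n k) / 2) \<longlonglongrightarrow> pa * gamma_exponent (t * a) + pb * gamma_exponent (t * b)"
proof -
  define s where "s j n = (\<Sum>k\<in>K n. m n k ^ j / 2)" for j n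
  define S where "S j = pa * a ^ j + pb * b ^ j" for j
  have lim: "s j \<longlonglongrightarrow> S j" if "j \<in> {2..6}" for j
    using lim[OF that] unfolding s_def S_def .
  \<comment> \<open>Linear interpolation of \<open>gamma_exponent (t * x) / x^2\<close> through a
    and b; the division needs both nonzero, and the slope needs them distinct.\<close>
  define ga where "ga = gamma_exponent (t * a) / a\<^sup>2"
  define gb where "gb = gamma_exponent (t * b) / b\<^sup>2"
  define c1 where "c1 = (ga - gb) / (a - b)"
  define c0 where "c0 = ga - c1 * a"
  have nab: "complex_of_real a - complex_of_real b \<noteq> 0" using ab by simp
  have "c0 + c1 * a = ga" by (simp add: c0_def)
  then have la: "gamma_exponent (t * a) = a\<^sup>2 * (c0 + c1 * a)" using a by (simp add: ga_def)
  have "c1 * (complex_of_real a - complex_of_real b) = ga - gb" using nab by (simp add: c1_def)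
  then have "c0 + c1 * b = gb" unfolding c0_def by (simp add: algebra_simps)
  then have lb: "gamma_exponent (t * b) = b\<^sup>2 * (c0 + c1 * b)" using b by (simp add: gb_def)
  have "\<exists>B. \<forall>n. s 2 n \<le> B"
  proof -
    have "Bseq (s 2)" using lim[of 2] by (intro convergent_imp_Bseq convergentI) auto
    then show ?thesis unfolding Bseq_def by (metis abs_le_iff real_norm_def)
  qed
  then obtain B where B: "\<And>n. s 2 n \<le> B" by blast
  \<comment> \<open>A bounded sum of squares confines all the \<open>m n k\<close>, for all n, to
    one interval, on which the interpolation estimate holds with a single C.\<close>
  have mR: "\<bar>m n k\<bar> \<le> sqrt (2 * B)" if "k \<in> K n" for n k
  proof -
    have "(m n k)\<^sup>2 / 2 \<le> s 2 n" unfolding s_def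
      using fin that by (intro member_le_sum) auto
    then have "(m n k)\<^sup>2 \<le> 2 * B" using B[of n] by simp
    then show ?thesis using real_sqrt_le_iff[of "(m n k)\<^sup>2" "2 * B"] by (simp del: real_sqrt_le_iff)
  qed
  \<comment> \<open>This is where power sums of all orders from 2 to 6 enter.\<close>
  define Q where "Q n = (\<Sum>k\<in>K n. (m n k)\<^sup>2 / 2 * ((m n k - a)\<^sup>2 * (m n k - b)\<^sup>2))" for n
  have poly: "x\<^sup>2 / 2 * ((x - a)\<^sup>2 * (x - b)\<^sup>2) =
      x ^ 6 / 2 - 2 * (a + b) * (x ^ 5 / 2) + (a\<^sup>2 + b\<^sup>2 + 4 * a * b) * (x ^ 4 / 2)
      - 2 * a * b * (a + b) * (x ^ 3 / 2) + a\<^sup>2 * b\<^sup>2 * (x\<^sup>2 / 2)" for x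
    by (simp add: power_numeral_reduce algebra_simps)
  have "Q = (\<lambda>n. s 6 n - 2 * (a + b) * s 5 n + (a\<^sup>2 + b\<^sup>2 + 4 * a * b) * s 4 n
      - 2 * a * b * (a + b) * s 3 n + a\<^sup>2 * b\<^sup>2 * s 2 n)"
    unfolding Q_def poly s_def by (simp only: sum.distrib sum_subtractf sum_distrib_left)
  moreover have "\<dots> \<longlonglongrightarrow> S 6 - 2 * (a + b) * S 5 + (a\<^sup>2 + b\<^sup>2 + 4 * a * b) * S 4
      - 2 * a * b * (a + b) * S 3 + a\<^sup>2 * b\<^sup>2 * S 2"
    by (intro tendsto_intros lim) auto
  \<comment> \<open>The same combination of the limits is a combination of the values of the
    polynomial at a and b, both of them roots.\<close>
  moreover have "S 6 - 2 * (a + b) * S 5 + (a\<^sup>2 + b\<^sup>2 + 4 * a * b) * S 4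
      - 2 * a * b * (a + b) * S 3 + a\<^sup>2 * b\<^sup>2 * S 2 = 0"
    unfolding S_def by (simp add: power_numeral_reduce algebra_simps)
  ultimately have Q: "Q \<longlonglongrightarrow> 0" by simp
  define E where "E n = (\<Sum>k\<in>K n. gamma_exponent (t * m n k) / 2)
      - (c0 * s 2 n + c1 * s 3 n)" for n
  have Ebound: "\<exists>C. \<forall>n. cmod (E n) \<le> \<epsilon> * s 2 n + C * Q n" if \<epsilon>: "\<epsilon> > 0" for \<epsilon>
  proof -
    obtain C where C: "\<And>x. \<bar>x\<bar> \<le> sqrt (2 * B) \<Longrightarrow>
       cmod (gamma_exponent (t * x) - x\<^sup>2 * (c0 + c1 * x)) \<le> x\<^sup>2 * (\<epsilon> + C * ((x - a)\<^sup>2 * (x - b)\<^sup>2))"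
      using gamma_exponent_interpolation[OF a b \<epsilon> la lb] by blast
    have "cmod (E n) \<le> \<epsilon> * s 2 n + C * Q n" for n
    proof -
      have "E n = (\<Sum>k\<in>K n. (gamma_exponent (t * m n k) - (m n k)\<^sup>2 * (c0 + c1 * m n k)) / 2)"
        unfolding E_def s_def
        by (simp add: sum_distrib_left sum_subtractf[symmetric] sum.distrib[symmetric])
           (intro sum.cong refl, simp add: field_simps power2_eq_square power3_eq_cube)
      also have "cmod \<dots> \<le> (\<Sum>k\<in>K n. \<epsilon> * ((m n k)\<^sup>2 / 2) + C * ((m n k)\<^sup>2 / 2 * ((m n k - a)\<^sup>2 * (m n k - b)\<^sup>2)))"
      proof (rule sum_norm_le)
        fix k assume "k \<in> K n"
        from C[OF mR[OF this]]
        show "cmod ((gamma_exponent (t * m n k) - (m n k)\<^sup>2 * (c0 + c1 * m n k)) / 2)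
          \<le> \<epsilon> * ((m n k)\<^sup>2 / 2) + C * ((m n k)\<^sup>2 / 2 * ((m n k - a)\<^sup>2 * (m n k - b)\<^sup>2))"
          by (simp add: norm_divide field_simps)
      qed
      also have "\<dots> = \<epsilon> * s 2 n + C * Q n" unfolding s_def Q_def by (simp only: sum.distrib sum_distrib_left)
      finally show ?thesis .
    qed
    then show ?thesis by blast
  qed
  have "E \<longlonglongrightarrow> 0"
  proof (rule LIMSEQ_I)
    fix r :: real assume r: "r > 0"
    define \<epsilon> where "\<epsilon> = r / (2 * (\<bar>B\<bar> + 1))"
    have \<epsilon>: "\<epsilon> > 0" using r by (simp add: \<epsilon>_def)
    have "\<epsilon> * s 2 n \<le> r / 2" for n
    proof -
      have "\<epsilon> * s 2 n \<le> \<epsilon> * (\<bar>B\<bar> + 1)" using B[of n] \<epsilon> by (intro mult_left_mono) auto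
      also have "\<dots> = r / 2" unfolding \<epsilon>_def by (simp add: divide_simps)
      finally show ?thesis .
    qed
    moreover obtain C where C: "\<And>n. cmod (E n) \<le> \<epsilon> * s 2 n + C * Q n" using Ebound[OF \<epsilon>] by blast
    moreover have "\<forall>\<^sub>F n in sequentially. C * Q n < r / 2"
      using order_tendstoD(2)[OF tendsto_mult_right_zero[OF Q, of C], of "r / 2"] r by simp
    ultimately have "\<forall>\<^sub>F n in sequentially. cmod (E n) < r"
      by (auto elim!: eventually_mono) (smt (verit, best) field_sum_of_halves)
    then show "\<exists>no. \<forall>n\<ge>no. cmod (E n - 0) < r" by (simp add: eventually_sequentially)
  qed
  moreover have "(\<lambda>n. c0 * s 2 n + c1 * s 3 n) \<longlonglongrightarrow> c0 * S 2 + c1 * S 3"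
    by (intro tendsto_intros lim) auto
  ultimately have "(\<lambda>n. E n + (c0 * s 2 n + c1 * s 3 n)) \<longlonglongrightarrow> 0 + (c0 * S 2 + c1 * S 3)"
    by (rule tendsto_add)
  moreover have "c0 * S 2 + c1 * S 3 = pa * gamma_exponent (t * a) + pb * gamma_exponent (t * b)"
    unfolding la lb S_def by (simp add: algebra_simps power2_eq_square power3_eq_cube)
  ultimately show ?thesis by (simp add: E_def)
qed

subsection \<open>The Lindeberg replacement\<close>

text \<open>One bound \<open>\<rho>\<close> is shared by all laws, so products that mix the law of
  the \<open>Y i\<close> with the normal one satisfy the same hypotheses as pure products.\<close>

definition standardized_law :: "real \<Rightarrow> real measure \<Rightarrow> bool" where
  "standardized_law \<rho> \<nu> \<longleftrightarrow> real_distribution \<nu> \<and> integrable \<nu> (\<lambda>x. \<bar>x\<bar> ^ 3) \<and>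
     (\<integral>x. x \<partial>\<nu>) = 0 \<and> (\<integral>x. x\<^sup>2 \<partial>\<nu>) = 1 \<and> (\<integral>x. \<bar>x\<bar> ^ 3 \<partial>\<nu>) \<le> \<rho>"

lemma abs_power2_le_one_plus_cube: "\<bar>x\<bar> \<le> 1 + \<bar>x\<bar> ^ 3" "x\<^sup>2 \<le> 1 + \<bar>x\<bar> ^ 3" for x :: real
proof -
  have "\<bar>x\<bar> ^ 1 \<le> \<bar>x\<bar> ^ 3 \<and> \<bar>x\<bar> ^ 2 \<le> \<bar>x\<bar> ^ 3" if "\<bar>x\<bar> \<ge> 1"
    using that by (intro conjI power_increasing) auto
  moreover have "\<bar>x\<bar> ^ 2 \<le> 1" if "\<bar>x\<bar> < 1" using that by (intro power_le_one) auto
  ultimately show "\<bar>x\<bar> \<le> 1 + \<bar>x\<bar> ^ 3" "x\<^sup>2 \<le> 1 + \<bar>x\<bar> ^ 3"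
    by (cases "\<bar>x\<bar> \<ge> 1"; force intro: add_increasing2)+
qed

lemma standardized_lawD:
  assumes "standardized_law \<rho> \<nu>"
  shows "prob_space \<nu>" "sets \<nu> = sets borel" "space \<nu> = UNIV"
    "integrable \<nu> (\<lambda>x. x)" "integrable \<nu> (\<lambda>x. x\<^sup>2)" "integrable \<nu> (\<lambda>x. \<bar>x\<bar> ^ 3)"
    "(\<integral>x. x \<partial>\<nu>) = 0" "(\<integral>x. x\<^sup>2 \<partial>\<nu>) = 1" "(\<integral>x. \<bar>x\<bar> ^ 3 \<partial>\<nu>) \<le> \<rho>"
proof -
  interpret real_distribution \<nu> using assms by (simp add: standardized_law_def)
  show "prob_space \<nu>" by unfold_locales
  show "sets \<nu> = sets borel" "space \<nu> = UNIV" by auto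
  show i: "integrable \<nu> (\<lambda>x. \<bar>x\<bar> ^ 3)" and "(\<integral>x. x \<partial>\<nu>) = 0" "(\<integral>x. x\<^sup>2 \<partial>\<nu>) = 1" "(\<integral>x. \<bar>x\<bar> ^ 3 \<partial>\<nu>) \<le> \<rho>"
    using assms by (auto simp: standardized_law_def)
  have i1: "integrable \<nu> (\<lambda>x. 1 + \<bar>x\<bar> ^ 3)" using i by simp
  show "integrable \<nu> (\<lambda>x. x)" "integrable \<nu> (\<lambda>x. x\<^sup>2)"
    using abs_power2_le_one_plus_cube by (auto intro!: Bochner_Integration.integrable_bound[OF i1])
qed

text \<open>Second-order Taylor polynomial of \<open>\<bar>s\<bar>^3\<close> with remainder at most
  \<open>\<bar>x\<bar>^3\<close>, the third derivative being at most 6 in modulus. The first-order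
  term is kept exactly because it integrates to 0 against a centered law; the plain triangle
  inequality would leave a sum of the \<open>\<bar>a j\<bar>\<close>, which their squares do not
  control.\<close>

lemma abs_cube_add_le:
  fixes s x :: real
  shows "\<bar>s + x\<bar> ^ 3 \<le> \<bar>s\<bar> ^ 3 + 3 * (s * \<bar>s\<bar>) * x + 3 * \<bar>s\<bar> * x\<^sup>2 + \<bar>x\<bar> ^ 3"
proof -
  have key: "\<bar>s + x\<bar> ^ 3 \<le> \<bar>s\<bar> ^ 3 + 3 * (s * \<bar>s\<bar>) * x + 3 * \<bar>s\<bar> * x\<^sup>2 + \<bar>x\<bar> ^ 3" if s: "s \<ge> 0" for s x :: real
  proof (cases "s + x \<ge> 0")
    case True
    have "x ^ 3 \<le> \<bar>x\<bar> ^ 3" by (metis abs_ge_self power_abs)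
    then show ?thesis using True s by (simp add: power3_eq_cube power2_eq_square algebra_simps)
  next
    case False
    then have x: "x < 0" using s by simp
    \<comment> \<open>The difference of the two sides when \<open>s + x\<close> and x are both
      negative, written in a manifestly nonnegative form.\<close>
    have "0 \<le> 2 * s * ((s + 3 / 2 * x)\<^sup>2 + 3 / 4 * x\<^sup>2)" using s by simp
    also have "\<dots> = 2 * s ^ 3 + 6 * (s * s) * x + 6 * s * x\<^sup>2"
      by (simp add: power3_eq_cube power2_eq_square algebra_simps)
    finally have "- ((s + x) ^ 3) \<le> s ^ 3 + 3 * (s * s) * x + 3 * s * x\<^sup>2 - x ^ 3"
      by (simp add: power3_eq_cube power2_eq_square algebra_simps)
    moreover have "\<bar>y\<bar> ^ 3 = - (y ^ 3)" if "y < 0" for y :: real using that by (simp add: power3_eq_cube)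
    from this[of "s + x"] this[of x] have "\<bar>s + x\<bar> ^ 3 = - ((s + x) ^ 3)" "\<bar>x\<bar> ^ 3 = - (x ^ 3)"
      using False x by simp_all
    ultimately show ?thesis using s by simp
  qed
  show ?thesis
  proof (cases "s \<ge> 0")
    case False
    have "\<bar>- s + - x\<bar> = \<bar>s + x\<bar>" by simp
    with key[of "- s" "- x"] False show ?thesis by simp
  qed (rule key)
qed

lemma abs_cube_add_le_8: "\<bar>a + b\<bar> ^ 3 \<le> 8 * (\<bar>a\<bar> ^ 3 + \<bar>b\<bar> ^ 3)" for a b :: real
proof -
  have "\<bar>a + b\<bar> ^ 3 \<le> (2 * max \<bar>a\<bar> \<bar>b\<bar>) ^ 3" by (intro power_mono) auto
  also have "\<dots> = 8 * max \<bar>a\<bar> \<bar>b\<bar> ^ 3" by (simp add: power_mult_distrib)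
  also have "\<dots> \<le> 8 * (\<bar>a\<bar> ^ 3 + \<bar>b\<bar> ^ 3)" by (auto simp: max_def)
  finally show ?thesis .
qed

lemma smooth_test_functions3D:
  assumes "h \<in> smooth_test_functions3"
  shows "\<bar>h x\<bar> \<le> 1" "isCont h x"
    "\<bar>h (u + x) - h u - deriv h u * x - (deriv ^^ 2) h u / 2 * x\<^sup>2\<bar> \<le> \<bar>x\<bar> ^ 3 / 6"
proof -
  have d: "((deriv ^^ m) h has_real_derivative (deriv ^^ Suc m) h t) (at t)" if "m < 3" for m t
    using assms that by (auto simp: smooth_test_functions3_def DERIV_deriv_iff_real_differentiable)
  have b: "\<bar>(deriv ^^ k) h t\<bar> \<le> 1" if "k \<le> 3" for k t
    using assms that unfolding smooth_test_functions3_def by blast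
  show "\<bar>h x\<bar> \<le> 1" using b[of 0 x] by simp
  show "isCont h x" using d[of 0 x] DERIV_isCont by simp
  show "\<bar>h (u + x) - h u - deriv h u * x - (deriv ^^ 2) h u / 2 * x\<^sup>2\<bar> \<le> \<bar>x\<bar> ^ 3 / 6"
  proof (cases "x = 0")
    case False
    \<comment> \<open>The interval runs from \<open>min\<close> to \<open>max\<close>, so that one
      application of Taylor's theorem covers both signs of x.\<close>
    have "\<exists>t. (if u + x < u then u + x < t \<and> t < u else u < t \<and> t < u + x) \<and>
       h (u + x) = (\<Sum>m<3. (deriv ^^ m) h u / fact m * (u + x - u) ^ m) + (deriv ^^ 3) h t / fact 3 * (u + x - u) ^ 3"
      by (rule Taylor[of 3 "\<lambda>m. (deriv ^^ m) h" h "min u (u + x)" "max u (u + x)"]) (use d False in auto)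
    then obtain t where "h (u + x) = (\<Sum>m<3. (deriv ^^ m) h u / fact m * x ^ m) + (deriv ^^ 3) h t / 6 * x ^ 3"
      by (auto simp: fact_numeral)
    then have "h (u + x) - h u - deriv h u * x - (deriv ^^ 2) h u / 2 * x\<^sup>2 = (deriv ^^ 3) h t / 6 * x ^ 3"
      by (simp add: lessThan_nat_numeral fact_numeral numeral_2_eq_2)
    moreover have "\<bar>(deriv ^^ 3) h t / 6 * x ^ 3\<bar> \<le> \<bar>x\<bar> ^ 3 / 6"
      using mult_right_mono[OF b[of 3 t], of "\<bar>x\<bar> ^ 3"] by (simp add: abs_mult power_abs)
    ultimately show ?thesis by (simp only:)
  qed simp
qed

text \<open>Both laws give the same integral to the quadratic Taylor polynomial at u, since mean and
  variance agree. Each Taylor remainder contributes at most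
  \<open>\<rho> / 6 * \<bar>v\<bar>^3\<close>.\<close>

lemma integral_swap_standardized_law:
  assumes h: "h \<in> smooth_test_functions3" and \<mu>: "standardized_law \<rho> \<mu>" and \<nu>: "standardized_law \<rho> \<nu>"
  shows "\<bar>(\<integral>y. h (u + y * v) \<partial>\<mu>) - (\<integral>y. h (u + y * v) \<partial>\<nu>)\<bar> \<le> \<rho> / 3 * \<bar>v\<bar> ^ 3"
proof -
  note hD = smooth_test_functions3D[OF h]
  have [measurable]: "h \<in> borel_measurable borel"
    using hD(2) by (intro borel_measurable_continuous_onI continuous_at_imp_continuous_on) auto
  define q where "q y = h u + deriv h u * (y * v) + (deriv ^^ 2) h u / 2 * (y * v)\<^sup>2" for y
  have one: "\<bar>(\<integral>y. h (u + y * v) \<partial>\<mu>) - (h u + (deriv ^^ 2) h u / 2 * v\<^sup>2)\<bar> \<le> \<rho> / 6 * \<bar>v\<bar> ^ 3"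
    if \<mu>: "standardized_law \<rho> \<mu>" for \<mu>
  proof -
    note D = standardized_lawD[OF \<mu>]
    interpret prob_space \<mu> by fact
    have [measurable_cong]: "sets \<mu> = sets borel" by fact
    have ih: "integrable \<mu> (\<lambda>y. h (u + y * v))" by (rule integrable_const_bound[of _ 1]) (auto simp: hD)
    have iq: "integrable \<mu> q" unfolding q_def power_mult_distrib using D(4,5) by simp
    have "(\<integral>y. q y \<partial>\<mu>) = h u + (deriv ^^ 2) h u / 2 * v\<^sup>2"
      unfolding q_def power_mult_distrib using D(4,5,7,8) by (simp add: prob_space)
    then have "\<bar>(\<integral>y. h (u + y * v) \<partial>\<mu>) - (h u + (deriv ^^ 2) h u / 2 * v\<^sup>2)\<bar> = \<bar>\<integral>y. h (u + y * v) - q y \<partial>\<mu>\<bar>"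
      using ih iq by simp
    also have "\<dots> \<le> (\<integral>y. \<bar>h (u + y * v) - q y\<bar> \<partial>\<mu>)" by (rule integral_abs_bound)
    also have "\<dots> \<le> (\<integral>y. \<bar>v\<bar> ^ 3 / 6 * \<bar>y\<bar> ^ 3 \<partial>\<mu>)"
    proof (rule integral_mono)
      show "\<bar>h (u + y * v) - q y\<bar> \<le> \<bar>v\<bar> ^ 3 / 6 * \<bar>y\<bar> ^ 3" for y
        using hD(3)[of u "y * v"] by (simp add: q_def abs_mult power_mult_distrib algebra_simps)
    qed (use ih iq D(6) in auto)
    also have "\<dots> \<le> \<bar>v\<bar> ^ 3 / 6 * \<rho>" using D(9) by (simp add: mult_left_mono)
    finally show ?thesis by (simp add: mult_ac)
  qed
  have "\<rho> / 3 * \<bar>v\<bar> ^ 3 = \<rho> / 6 * \<bar>v\<bar> ^ 3 + \<rho> / 6 * \<bar>v\<bar> ^ 3" by simp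
  with one[OF \<mu>] one[OF \<nu>] show ?thesis by linarith
qed

text \<open>In the induction \<open>\<sigma>\<close> is kept fixed at its value for the full index set, since the step needs
  a bound on the first absolute moment of every partial sum.\<close>

lemma third_moment_sum_le:
  fixes \<nu> :: "'i \<Rightarrow> real measure" and a :: "'i \<Rightarrow> real"
  assumes \<nu>: "\<And>i. standardized_law \<rho> (\<nu> i)" and fin: "finite I"
  shows "integrable (PiM I \<nu>) (\<lambda>x. \<bar>\<Sum>i\<in>I. a i * x i\<bar> ^ 3)" (is ?int)
    and "(\<integral>x. \<bar>\<Sum>i\<in>I. a i * x i\<bar> ^ 3 \<partial>PiM I \<nu>) \<le> (3 + \<rho>) * sqrt (\<Sum>i\<in>I. (a i)\<^sup>2) ^ 3" (is ?bound)
proof -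
  note D = standardized_lawD[OF \<nu>]
  interpret product_sigma_finite \<nu>
    unfolding product_sigma_finite_def by (intro allI prob_space_imp_sigma_finite D(1))
  have [measurable_cong]: "sets (\<nu> i) = sets borel" for i by (rule D)
  have comp: "integrable (PiM J \<nu>) (\<lambda>x. g (x i))" if "i \<in> J" "integrable (\<nu> i) g" for J i and g :: "real \<Rightarrow> real"
    using that integrable_distr[of "\<lambda>x. x i" "PiM J \<nu>" "\<nu> i" g] distr_PiM_component[of J \<nu> i] D(1) by simp
  have ic: "integrable (PiM J \<nu>) (\<lambda>x. \<bar>\<Sum>i\<in>J'. a i * x i\<bar> ^ 3)" if "finite J'" "J' \<subseteq> J" for J J'
    using that
  proof (induction J' rule: finite_induct)
    case (insert i J')
    have [measurable]: "(\<lambda>x. x j) \<in> borel_measurable (PiM J \<nu>)" if "j \<in> insert i J'" for j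
      using that insert.prems by (intro measurable_PiM_component_rev) (auto simp: D)
    have m: "(\<lambda>x. \<bar>\<Sum>i\<in>insert i J'. a i * x i\<bar> ^ 3) \<in> borel_measurable (PiM J \<nu>)"
      by (intro borel_measurable_power borel_measurable_abs borel_measurable_sum borel_measurable_times) auto
    have "integrable (PiM J \<nu>) (\<lambda>x. 8 * (\<bar>a i\<bar> ^ 3 * \<bar>x i\<bar> ^ 3 + \<bar>\<Sum>i\<in>J'. a i * x i\<bar> ^ 3))"
      using insert comp[of i J "\<lambda>x. \<bar>x\<bar> ^ 3"] D(6) by simp
    then show ?case
    proof (rule Bochner_Integration.integrable_bound[OF _ m])
      show "AE x in PiM J \<nu>. norm (\<bar>\<Sum>i\<in>insert i J'. a i * x i\<bar> ^ 3) \<le> norm (8 * (\<bar>a i\<bar> ^ 3 * \<bar>x i\<bar> ^ 3 + \<bar>\<Sum>i\<in>J'. a i * x i\<bar> ^ 3))"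
        using insert.hyps abs_cube_add_le_8[of "a i * _" "\<Sum>i\<in>J'. a i * _ i"]
        by (intro AE_I2) (simp add: abs_mult power_mult_distrib)
    qed
  qed simp
  then show ?int using fin by blast
  \<comment> \<open>The laws are standardized at every index of the type, so an arbitrary index
    gives nonnegativity even when I is empty.\<close>
  have \<rho>: "0 \<le> \<rho>" using order_trans[OF _ D(9)[of undefined], of 0] by simp
  define \<sigma> where "\<sigma> = sqrt (\<Sum>i\<in>I. (a i)\<^sup>2)"
  have "(\<integral>x. (\<Sum>i\<in>J. a i * x i)\<^sup>2 \<partial>PiM J \<nu>) = (\<Sum>i\<in>J. (a i)\<^sup>2) \<and>
     (\<integral>x. \<bar>\<Sum>i\<in>J. a i * x i\<bar> ^ 3 \<partial>PiM J \<nu>) \<le> 3 * \<sigma> * (\<Sum>i\<in>J. (a i)\<^sup>2) + \<rho> * (\<Sum>i\<in>J. \<bar>a i\<bar> ^ 3)" if "finite J" "J \<subseteq> I" for J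
    using that
  proof (induction J rule: finite_induct)
    case empty
    show ?case by simp
  next
    case (insert j J)
    define S where "S x = (\<Sum>i\<in>J. a i * x i)" for x
    interpret J: prob_space "PiM J \<nu>" by (rule prob_space_PiM) (rule D)
    interpret jJ: prob_space "PiM (insert j J) \<nu>" by (rule prob_space_PiM) (rule D)
    have iS3: "integrable (PiM J \<nu>) (\<lambda>x. \<bar>S x\<bar> ^ 3)" unfolding S_def using ic[of J J] insert.hyps by simp
    have mS[measurable]: "S \<in> borel_measurable (PiM J \<nu>)" unfolding S_def
      by (intro borel_measurable_sum borel_measurable_times borel_measurable_const measurable_PiM_component_rev) (auto simp: D)
    have sub: "integrable N (\<lambda>x. X x) \<and> integrable N (\<lambda>x. (X x)\<^sup>2)"
      if "prob_space N" and [measurable]: "X \<in> borel_measurable N" and "integrable N (\<lambda>x. \<bar>X x\<bar> ^ 3)" for N and X :: "('i \<Rightarrow> real) \<Rightarrow> real"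
    proof -
      interpret prob_space N by fact
      have i1: "integrable N (\<lambda>x. 1 + \<bar>X x\<bar> ^ 3)" using that by simp
      then show ?thesis using abs_power2_le_one_plus_cube by (auto intro!: Bochner_Integration.integrable_bound[OF i1])
    qed
    have iS: "integrable (PiM J \<nu>) S" "integrable (PiM J \<nu>) (\<lambda>x. (S x)\<^sup>2)"
      using sub[OF J.prob_space_axioms mS iS3] by auto
    have SjJ: "(\<Sum>i\<in>insert j J. a i * (x(j := y)) i) = S x + a j * y" for x y
      unfolding S_def using insert.hyps by (simp add: add.commute) (intro sum.cong, auto)
    have i3: "integrable (PiM (insert j J) \<nu>) (\<lambda>x. \<bar>\<Sum>i\<in>insert j J. a i * x i\<bar> ^ 3)"
      using ic[of "insert j J" "insert j J"] insert.hyps by simp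
    have mjJ: "(\<lambda>x. \<Sum>i\<in>insert j J. a i * x i) \<in> borel_measurable (PiM (insert j J) \<nu>)"
      by (intro borel_measurable_sum borel_measurable_times borel_measurable_const measurable_PiM_component_rev) (auto simp: D)
    have i2: "integrable (PiM (insert j J) \<nu>) (\<lambda>x. (\<Sum>i\<in>insert j J. a i * x i)\<^sup>2)"
      using sub[OF jJ.prob_space_axioms mjJ i3] by simp
    interpret nj: prob_space "\<nu> j" by (rule D)
    have njU: "measure (\<nu> j) UNIV = 1" using nj.prob_space by (simp only: D)
    have "(\<integral>x. (\<Sum>i\<in>insert j J. a i * x i)\<^sup>2 \<partial>PiM (insert j J) \<nu>) = (\<integral>x. (\<integral>y. (S x + a j * y)\<^sup>2 \<partial>\<nu> j) \<partial>PiM J \<nu>)"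
      using product_integral_insert[OF insert.hyps i2] by (simp only: SjJ)
    also have "\<dots> = (\<integral>x. (S x)\<^sup>2 + (a j)\<^sup>2 \<partial>PiM J \<nu>)"
      by (intro Bochner_Integration.integral_cong refl)
         (simp add: power2_sum power_mult_distrib D njU)
    also have "\<dots> = (\<Sum>i\<in>insert j J. (a i)\<^sup>2)"
      using insert iS by (simp add: J.prob_space S_def)
    finally have two: "(\<integral>x. (\<Sum>i\<in>insert j J. a i * x i)\<^sup>2 \<partial>PiM (insert j J) \<nu>) = (\<Sum>i\<in>insert j J. (a i)\<^sup>2)" .
    \<comment> \<open>Nonnegative variance of \<open>\<bar>S x\<bar>\<close> bounds its mean by the
      root of the second moment; this is why second moments are carried through the same
      induction.\<close>
    have "(\<integral>x. \<bar>S x\<bar> \<partial>PiM J \<nu>)\<^sup>2 \<le> (\<integral>x. (S x)\<^sup>2 \<partial>PiM J \<nu>)"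
      using J.variance_positive[of "\<lambda>x. \<bar>S x\<bar>"] J.variance_eq[of "\<lambda>x. \<bar>S x\<bar>"] iS by simp
    also have "\<dots> \<le> (\<Sum>i\<in>I. (a i)\<^sup>2)"
      using insert fin by (simp add: S_def sum_mono2)
    finally have ES: "(\<integral>x. \<bar>S x\<bar> \<partial>PiM J \<nu>) \<le> \<sigma>" unfolding \<sigma>_def by (rule real_le_rsqrt)
    have "(\<integral>x. \<bar>\<Sum>i\<in>insert j J. a i * x i\<bar> ^ 3 \<partial>PiM (insert j J) \<nu>) = (\<integral>x. (\<integral>y. \<bar>S x + a j * y\<bar> ^ 3 \<partial>\<nu> j) \<partial>PiM J \<nu>)"
      using product_integral_insert[OF insert.hyps i3] by (simp only: SjJ)
    also have "\<dots> \<le> (\<integral>x. \<bar>S x\<bar> ^ 3 + 3 * (a j)\<^sup>2 * \<bar>S x\<bar> + \<rho> * \<bar>a j\<bar> ^ 3 \<partial>PiM J \<nu>)"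
    proof (rule integral_mono')
      show "integrable (PiM J \<nu>) (\<lambda>x. \<bar>S x\<bar> ^ 3 + 3 * (a j)\<^sup>2 * \<bar>S x\<bar> + \<rho> * \<bar>a j\<bar> ^ 3)" using iS3 iS by simp
      fix x
      have "(\<integral>y. \<bar>S x + a j * y\<bar> ^ 3 \<partial>\<nu> j) \<le> (\<integral>y. \<bar>S x\<bar> ^ 3 + 3 * (S x * \<bar>S x\<bar>) * (a j * y) + 3 * \<bar>S x\<bar> * (a j * y)\<^sup>2 + \<bar>a j * y\<bar> ^ 3 \<partial>\<nu> j)"
      proof (rule integral_mono')
        show "integrable (\<nu> j) (\<lambda>y. \<bar>S x\<bar> ^ 3 + 3 * (S x * \<bar>S x\<bar>) * (a j * y) + 3 * \<bar>S x\<bar> * (a j * y)\<^sup>2 + \<bar>a j * y\<bar> ^ 3)"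
          unfolding power_mult_distrib abs_mult using D(4,5,6)[of j] by simp
      qed (auto intro: abs_cube_add_le order_trans[OF _ abs_cube_add_le])
      also have "\<dots> = \<bar>S x\<bar> ^ 3 + 3 * (a j)\<^sup>2 * \<bar>S x\<bar> + \<bar>a j\<bar> ^ 3 * (\<integral>y. \<bar>y\<bar> ^ 3 \<partial>\<nu> j)"
        unfolding power_mult_distrib abs_mult using D(4-8)[of j] by (simp add: D(3) njU)
      also have "\<dots> \<le> \<bar>S x\<bar> ^ 3 + 3 * (a j)\<^sup>2 * \<bar>S x\<bar> + \<rho> * \<bar>a j\<bar> ^ 3"
        using D(9)[of j] by (simp add: mult.commute[of \<rho>] mult_left_mono)
      finally show "(\<integral>y. \<bar>S x + a j * y\<bar> ^ 3 \<partial>\<nu> j) \<le> \<bar>S x\<bar> ^ 3 + 3 * (a j)\<^sup>2 * \<bar>S x\<bar> + \<rho> * \<bar>a j\<bar> ^ 3" .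
      show "0 \<le> \<bar>S x\<bar> ^ 3 + 3 * (a j)\<^sup>2 * \<bar>S x\<bar> + \<rho> * \<bar>a j\<bar> ^ 3"
        using order_trans[OF _ D(9)[of j], of 0] by simp
    qed
    also have "\<dots> = (\<integral>x. \<bar>S x\<bar> ^ 3 \<partial>PiM J \<nu>) + 3 * (a j)\<^sup>2 * (\<integral>x. \<bar>S x\<bar> \<partial>PiM J \<nu>) + \<rho> * \<bar>a j\<bar> ^ 3"
      using iS3 iS by (simp add: J.prob_space)
    also have "\<dots> \<le> (3 * \<sigma> * (\<Sum>i\<in>J. (a i)\<^sup>2) + \<rho> * (\<Sum>i\<in>J. \<bar>a i\<bar> ^ 3)) + 3 * (a j)\<^sup>2 * \<sigma> + \<rho> * \<bar>a j\<bar> ^ 3"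
      using insert ES \<rho> unfolding S_def by (intro add_mono mult_left_mono) auto
    also have "\<dots> = 3 * \<sigma> * (\<Sum>i\<in>insert j J. (a i)\<^sup>2) + \<rho> * (\<Sum>i\<in>insert j J. \<bar>a i\<bar> ^ 3)"
      using insert.hyps by (simp add: algebra_simps)
    finally show ?case using two by simp
  qed
  from this[OF fin subset_refl] have "(\<integral>x. \<bar>\<Sum>i\<in>I. a i * x i\<bar> ^ 3 \<partial>PiM I \<nu>) \<le> 3 * \<sigma> * (\<Sum>i\<in>I. (a i)\<^sup>2) + \<rho> * (\<Sum>i\<in>I. \<bar>a i\<bar> ^ 3)" by simp
  \<comment> \<open>Each \<open>\<bar>a i\<bar>\<close> is at most \<open>\<sigma>\<close>, so the
    sum of cubes is at most \<open>\<sigma>^3\<close> and the two terms combine to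
    \<open>(3 + \<rho>) * \<sigma>^3\<close>.\<close>
  also have "\<dots> \<le> 3 * \<sigma> * (\<Sum>i\<in>I. (a i)\<^sup>2) + \<rho> * (\<Sum>i\<in>I. \<sigma> * (a i)\<^sup>2)"
  proof (intro add_mono[OF order_refl] mult_left_mono sum_mono)
    show "0 \<le> \<rho>" by (rule \<rho>)
    fix i assume i: "i \<in> I"
    have "sqrt ((a i)\<^sup>2) \<le> \<sigma>" unfolding \<sigma>_def using i fin by (intro real_sqrt_le_mono member_le_sum) auto
    then have "\<bar>a i\<bar> * \<bar>a i\<bar>\<^sup>2 \<le> \<sigma> * \<bar>a i\<bar>\<^sup>2" by (intro mult_right_mono) auto
    then show "\<bar>a i\<bar> ^ 3 \<le> \<sigma> * (a i)\<^sup>2" by (simp add: power3_eq_cube power2_eq_square mult.assoc)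
  qed
  also have "\<dots> = (3 + \<rho>) * (\<sigma> * (\<Sum>i\<in>I. (a i)\<^sup>2))" by (simp add: sum_distrib_left sum.distrib algebra_simps)
  also have "(\<Sum>i\<in>I. (a i)\<^sup>2) = \<sigma>\<^sup>2" unfolding \<sigma>_def by (simp add: sum_nonneg)
  also have "\<sigma> * \<sigma>\<^sup>2 = \<sigma> ^ 3" by (simp add: power2_eq_square power3_eq_cube)
  finally show ?bound unfolding \<sigma>_def .
qed


text \<open>With zero diagonal and symmetric f the form is affine in the i-th variable, with slope
  \<open>2 * S x\<close> for a linear form S in the others. Swapping that variable with the others
  fixed costs \<open>\<rho> / 3 * \<bar>2 * S x\<bar>^3\<close>, whence the factor 8/3, and
  \<open>third_moment_sum_le\<close> bounds the mean of \<open>\<bar>S x\<bar>^3\<close>.\<close>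

lemma swap_one_coordinate:
  fixes \<mu> \<nu> :: "'i \<Rightarrow> real measure" and f :: "'i \<Rightarrow> 'i \<Rightarrow> real"
  assumes h: "h \<in> smooth_test_functions3"
    and \<mu>: "\<And>i. standardized_law \<rho> (\<mu> i)" and \<nu>: "\<And>i. standardized_law \<rho> (\<nu> i)"
    and I: "finite I" "i \<notin> I" and eq: "\<And>j. j \<in> I \<Longrightarrow> \<mu> j = \<nu> j"
    and sym: "\<And>j. j \<in> I \<Longrightarrow> f j i = f i j" and diag: "f i i = 0"
  defines "H \<equiv> \<lambda>x. \<Sum>k\<in>insert i I. \<Sum>j\<in>insert i I. f k j * x k * x j"
  shows "\<bar>(\<integral>x. h (H x) \<partial>PiM (insert i I) \<mu>) - (\<integral>x. h (H x) \<partial>PiM (insert i I) \<nu>)\<bar>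
     \<le> 8 / 3 * \<rho> * (3 + \<rho>) * sqrt (\<Sum>j\<in>I. (f i j)\<^sup>2) ^ 3"
proof -
  note hD = smooth_test_functions3D[OF h]
  have [measurable]: "h \<in> borel_measurable borel"
    using hD(2) by (intro borel_measurable_continuous_onI continuous_at_imp_continuous_on) auto
  define U where "U x = (\<Sum>k\<in>I. \<Sum>j\<in>I. f k j * x k * x j)" for x :: "'i \<Rightarrow> real"
  define S where "S x = (\<Sum>j\<in>I. f i j * x j)" for x :: "'i \<Rightarrow> real"
  have Hupd: "H (x(i := y)) = U x + y * (2 * S x)" for x y
  proof -
    have ne: "k \<noteq> i" if "k \<in> I" for k using that I by auto
    have "H (x(i := y)) = (\<Sum>j\<in>I. f i j * y * x j) + (\<Sum>k\<in>I. f k i * x k * y + (\<Sum>j\<in>I. f k j * x k * x j))"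
      unfolding H_def using I diag ne by simp
    also have "(\<Sum>k\<in>I. f k i * x k * y + (\<Sum>j\<in>I. f k j * x k * x j)) = (\<Sum>k\<in>I. f i k * y * x k) + U x"
      unfolding U_def sum.distrib using sym by (simp add: mult_ac)
    also have "(\<Sum>j\<in>I. f i j * y * x j) = y * S x"
      unfolding S_def sum_distrib_left by (simp add: mult_ac)
    finally have H0: "H (x(i := y)) = y * S x + (y * S x + U x)" .
    show ?thesis unfolding H0 by simp
  qed
  have meq: "PiM I \<mu> = PiM I \<nu>" by (rule PiM_cong) (auto simp: eq)
  \<comment> \<open>The integrability claim has two families because the outer product is the same
    on both sides of the comparison, while the inner integral is taken under either law.\<close>
  have fubini: "(\<integral>x. h (H x) \<partial>PiM (insert i I) \<theta>) = (\<integral>x. (\<integral>y. h (U x + y * (2 * S x)) \<partial>\<theta> i) \<partial>PiM I \<theta>)"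
    and intg: "integrable (PiM I \<theta>) (\<lambda>x. \<integral>y. h (U x + y * (2 * S x)) \<partial>\<theta>' i)"
    if \<theta>: "\<And>i. standardized_law \<rho> (\<theta> i)" "\<And>i. standardized_law \<rho> (\<theta>' i)" for \<theta> \<theta>' :: "'i \<Rightarrow> real measure"
  proof -
    note D = standardized_lawD[OF \<theta>(1)]
    note D' = standardized_lawD[OF \<theta>(2)]
    interpret product_sigma_finite \<theta>
      unfolding product_sigma_finite_def by (intro allI prob_space_imp_sigma_finite D(1))
    interpret P: prob_space "PiM (insert i I) \<theta>" by (rule prob_space_PiM) (rule D)
    interpret PI: prob_space "PiM I \<theta>" by (rule prob_space_PiM) (rule D)
    have mc: "(\<lambda>x. x j) \<in> borel_measurable (PiM J \<theta>)" if "j \<in> J" for j J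
      using that by (intro measurable_PiM_component_rev measurable_ident_sets D)
    have mH[measurable]: "H \<in> borel_measurable (PiM (insert i I) \<theta>)"
      unfolding H_def by (intro borel_measurable_sum borel_measurable_times borel_measurable_const mc)
    have "integrable (PiM (insert i I) \<theta>) (\<lambda>x. h (H x))"
      by (rule P.integrable_const_bound[of _ 1]) (auto simp: hD)
    from product_integral_insert[OF I this]
    show "(\<integral>x. h (H x) \<partial>PiM (insert i I) \<theta>) = (\<integral>x. (\<integral>y. h (U x + y * (2 * S x)) \<partial>\<theta> i) \<partial>PiM I \<theta>)"
      by (simp only: Hupd)
    have [measurable]: "U \<in> borel_measurable (PiM I \<theta>)" "S \<in> borel_measurable (PiM I \<theta>)"
      unfolding U_def S_def by (intro borel_measurable_sum borel_measurable_times borel_measurable_const mc; assumption)+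
    interpret q: prob_space "\<theta>' i" by (rule D')
    have [measurable_cong]: "sets (\<theta>' i) = sets borel" by (rule D')
    show "integrable (PiM I \<theta>) (\<lambda>x. \<integral>y. h (U x + y * (2 * S x)) \<partial>\<theta>' i)"
    proof (rule PI.integrable_const_bound[of _ 1])
      have "\<bar>\<integral>y. h (U x + y * (2 * S x)) \<partial>\<theta>' i\<bar> \<le> 1" for x
      proof -
        have "\<bar>\<integral>y. h (U x + y * (2 * S x)) \<partial>\<theta>' i\<bar> \<le> (\<integral>y. \<bar>h (U x + y * (2 * S x))\<bar> \<partial>\<theta>' i)" by (rule integral_abs_bound)
        also have "\<dots> \<le> (\<integral>y. 1 \<partial>\<theta>' i)" by (rule integral_mono') (auto simp: hD)
        finally show ?thesis by (simp add: q.prob_space)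
      qed
      then show "AE x in PiM I \<theta>. norm (\<integral>y. h (U x + y * (2 * S x)) \<partial>\<theta>' i) \<le> 1" by simp
    qed measurable
  qed
  have im: "integrable (PiM I \<nu>) (\<lambda>x. \<integral>y. h (U x + y * (2 * S x)) \<partial>\<mu> i)"
    and inu: "integrable (PiM I \<nu>) (\<lambda>x. \<integral>y. h (U x + y * (2 * S x)) \<partial>\<nu> i)"
    by (rule intg; rule \<mu> \<nu>)+
  have "\<bar>(\<integral>x. h (H x) \<partial>PiM (insert i I) \<mu>) - (\<integral>x. h (H x) \<partial>PiM (insert i I) \<nu>)\<bar>
     = \<bar>\<integral>x. (\<integral>y. h (U x + y * (2 * S x)) \<partial>\<mu> i) - (\<integral>y. h (U x + y * (2 * S x)) \<partial>\<nu> i) \<partial>PiM I \<nu>\<bar>"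
    unfolding fubini[OF \<mu> \<mu>] fubini[OF \<nu> \<nu>] meq using im inu by simp
  also have "\<dots> \<le> (\<integral>x. \<bar>(\<integral>y. h (U x + y * (2 * S x)) \<partial>\<mu> i) - (\<integral>y. h (U x + y * (2 * S x)) \<partial>\<nu> i)\<bar> \<partial>PiM I \<nu>)"
    by (rule integral_abs_bound)
  also have "\<dots> \<le> (\<integral>x. 8 / 3 * \<rho> * \<bar>S x\<bar> ^ 3 \<partial>PiM I \<nu>)"
  proof (rule integral_mono)
    show "\<bar>(\<integral>y. h (U x + y * (2 * S x)) \<partial>\<mu> i) - (\<integral>y. h (U x + y * (2 * S x)) \<partial>\<nu> i)\<bar> \<le> 8 / 3 * \<rho> * \<bar>S x\<bar> ^ 3" for x
      using integral_swap_standardized_law[OF h \<mu>[of i] \<nu>[of i], of "U x" "2 * S x"] by (simp add: abs_mult power_mult_distrib)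
    show "integrable (PiM I \<nu>) (\<lambda>x. 8 / 3 * \<rho> * \<bar>S x\<bar> ^ 3)"
      unfolding S_def using third_moment_sum_le(1)[OF \<nu> I(1)] by simp
  qed (use im inu in simp)
  also have "\<dots> = 8 / 3 * \<rho> * (\<integral>x. \<bar>S x\<bar> ^ 3 \<partial>PiM I \<nu>)" by simp
  also have "\<dots> \<le> 8 / 3 * \<rho> * ((3 + \<rho>) * sqrt (\<Sum>j\<in>I. (f i j)\<^sup>2) ^ 3)"
  proof (rule mult_left_mono)
    show "0 \<le> 8 / 3 * \<rho>" using order_trans[OF _ standardized_lawD(9)[OF \<mu>[of i]], of 0] by simp
  qed (use third_moment_sum_le(2)[OF \<nu> I(1)] in \<open>simp add: S_def\<close>)
  finally show ?thesis by (simp add: mult.assoc)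
qed

text \<open>The two products are linked by hybrids in which the coordinates in a set J already carry
  the new law; enlarging J by one index is a single swap. Each swap costs the third power of the
  root of an influence, which is what gains over the mere sum of the influences.\<close>

lemma lindeberg_quadratic_form:
  fixes \<mu> \<nu> :: "'i \<Rightarrow> real measure" and f :: "'i \<Rightarrow> 'i \<Rightarrow> real"
  assumes h: "h \<in> smooth_test_functions3"
    and \<mu>: "\<And>i. standardized_law \<rho> (\<mu> i)" and \<nu>: "\<And>i. standardized_law \<rho> (\<nu> i)"
    and I: "finite I"
    and sym: "\<And>i j. i \<in> I \<Longrightarrow> j \<in> I \<Longrightarrow> f i j = f j i" and diag: "\<And>i. i \<in> I \<Longrightarrow> f i i = 0"
  defines "H \<equiv> \<lambda>x. \<Sum>k\<in>I. \<Sum>j\<in>I. f k j * x k * x j"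
  shows "\<bar>(\<integral>x. h (H x) \<partial>PiM I \<mu>) - (\<integral>x. h (H x) \<partial>PiM I \<nu>)\<bar>
     \<le> 8 / 3 * \<rho> * (3 + \<rho>) * (\<Sum>i\<in>I. sqrt (\<Sum>j\<in>I. (f i j)\<^sup>2) ^ 3)"
proof -
  define hyb where "hyb J i = (if i \<in> J then \<nu> i else \<mu> i)" for J i
  define E where "E J = (\<integral>x. h (H x) \<partial>PiM I (hyb J))" for J
  define b where "b i = 8 / 3 * \<rho> * (3 + \<rho>) * sqrt (\<Sum>j\<in>I. (f i j)\<^sup>2) ^ 3" for i
  have \<rho>: "0 \<le> \<rho>" using order_trans[OF _ standardized_lawD(9)[OF \<mu>], of 0] by simp
  have hyb: "standardized_law \<rho> (hyb J i)" for J i using \<mu> \<nu> by (simp add: hyb_def)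
  have "\<bar>E {} - E J\<bar> \<le> sum b J" if "finite J" "J \<subseteq> I" for J
    using that
  proof (induction J rule: finite_induct)
    case (insert i J)
    have i: "insert i (I - {i}) = I" using insert.prems by auto
    have "\<bar>E J - E (insert i J)\<bar> \<le> 8 / 3 * \<rho> * (3 + \<rho>) * sqrt (\<Sum>j\<in>I - {i}. (f i j)\<^sup>2) ^ 3"
    proof -
      have "finite (I - {i})" "i \<notin> I - {i}" using I by auto
      moreover have "hyb J j = hyb (insert i J) j" if "j \<in> I - {i}" for j using that by (simp add: hyb_def)
      moreover have "f j i = f i j" if "j \<in> I - {i}" for j using that insert.prems sym by auto
      moreover have "f i i = 0" using insert.prems diag by auto
      ultimately show ?thesis
        using swap_one_coordinate[OF h, where \<mu> = "hyb J" and \<nu> = "hyb (insert i J)" and I = "I - {i}"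
            and i = i and f = f and \<rho> = \<rho>, OF hyb hyb] unfolding i E_def H_def by blast
    qed
    also have "\<dots> \<le> b i" unfolding b_def
      using I \<rho> by (intro mult_left_mono power_mono real_sqrt_le_mono sum_mono2) (auto simp: sum_nonneg)
    finally show ?case using insert by simp
  qed simp
  from this[OF I subset_refl] have "\<bar>E {} - E I\<bar> \<le> sum b I" .
  moreover have "PiM I (hyb {}) = PiM I \<mu>" "PiM I (hyb I) = PiM I \<nu>"
    by (auto intro!: PiM_cong simp: hyb_def)
  ultimately show ?thesis by (simp add: E_def b_def sum_distrib_left)
qed

subsection \<open>Double integrals\<close>

text \<open>A point mass is the case of variance 0, so both forms allowed by
  \<open>gaussian_law\<close> share one formula in terms of the second moment, and degenerate linear
  combinations need no separate treatment later.\<close>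

lemma gaussian_law_centered_char:
  assumes g: "gaussian_law \<nu>" and m: "(\<integral>x. x \<partial>\<nu>) = 0"
  shows "integrable \<nu> (\<lambda>x. x\<^sup>2)"
    and "char \<nu> t = of_real (exp (- (\<integral>x. x\<^sup>2 \<partial>\<nu>) * t\<^sup>2 / 2))"
proof -
  consider (pt) m where "\<nu> = return borel m" | (nd) m \<sigma> where "\<sigma> > 0" "\<nu> = density lborel (\<lambda>x. ennreal (normal_density m \<sigma> x))"
    using g by (auto simp: gaussian_law_def)
  then have "integrable \<nu> (\<lambda>x. x\<^sup>2) \<and> char \<nu> t = of_real (exp (- (\<integral>x. x\<^sup>2 \<partial>\<nu>) * t\<^sup>2 / 2))"
  proof cases
    case pt
    interpret prob_space \<nu> unfolding pt by (rule prob_space_return) simp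
    have "m = 0" using assms(2) unfolding pt by (simp add: integral_return)
    moreover have "integrable \<nu> (\<lambda>x. x\<^sup>2)"
      unfolding pt by (intro integrableI_bounded) (auto simp: nn_integral_return)
    ultimately show ?thesis unfolding pt char_def by (simp add: integral_return)
  next
    case nd
    have [simp]: "0 < \<sigma>" "\<sigma> \<noteq> 0" "\<bar>\<sigma>\<bar> = \<sigma>" using nd(1) by auto
    have d: "(\<integral>x. h x \<partial>\<nu>) = (\<integral>x. normal_density m \<sigma> x *\<^sub>R h x \<partial>lborel)"
      if [measurable]: "h \<in> borel_measurable borel" for h :: "real \<Rightarrow> 'c :: {banach, second_countable_topology}"
      unfolding nd(2) by (subst integral_density) auto
    have m0: "m = 0"
      using m has_bochner_integral_integral_eq[OF normal_moment_nz_1[of \<sigma> m]] by (simp add: d)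
    have sec: "has_bochner_integral lborel (\<lambda>x. normal_density m \<sigma> x * x\<^sup>2) (\<sigma>\<^sup>2)"
      using normal_moment_even[of \<sigma> m 1] by (simp add: m0)
    have i2: "integrable \<nu> (\<lambda>x. x\<^sup>2)" unfolding nd(2)
      using sec by (subst integrable_density) (auto simp: has_bochner_integral_iff)
    have v: "(\<integral>x. x\<^sup>2 \<partial>\<nu>) = \<sigma>\<^sup>2" using sec by (simp add: d has_bochner_integral_iff)
    have "char \<nu> t = (\<integral>x. normal_density 0 \<sigma> x *\<^sub>R iexp (t * x) \<partial>lborel)"
      unfolding char_def by (subst d) (auto simp: m0)
    also have "\<dots> = \<bar>\<sigma>\<bar> *\<^sub>R (\<integral>x. normal_density 0 \<sigma> (0 + \<sigma> * x) *\<^sub>R iexp (t * (0 + \<sigma> * x)) \<partial>lborel)"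
      by (rule lborel_integral_real_affine) (rule less_imp_neq[OF nd(1), symmetric])
    also have "\<dots> = (\<integral>x. std_normal_density x *\<^sub>R iexp ((t * \<sigma>) * x) \<partial>lborel)"
    proof -
      have "\<sigma> * normal_density 0 \<sigma> (0 + \<sigma> * x) = std_normal_density x" for x
        by (simp add: normal_density_def real_sqrt_mult power_mult_distrib field_simps)
      then have "\<bar>\<sigma>\<bar> *\<^sub>R (normal_density 0 \<sigma> (0 + \<sigma> * x) *\<^sub>R iexp (t * (0 + \<sigma> * x)))
          = std_normal_density x *\<^sub>R iexp ((t * \<sigma>) * x)" for x
        by (simp add: mult.assoc)
      then show ?thesis by (simp only: integral_scaleR_right[symmetric])
    qed
    also have "\<dots> = char std_normal_distribution (t * \<sigma>)"
      unfolding char_def by (subst integral_density) auto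
    finally show ?thesis using i2 by (simp add: char_std_normal_distribution v power_mult_distrib mult.commute)
  qed
  then show "integrable \<nu> (\<lambda>x. x\<^sup>2)" "char \<nu> t = of_real (exp (- (\<integral>x. x\<^sup>2 \<partial>\<nu>) * t\<^sup>2 / 2))" by auto
qed

locale isonormal = prob_space \<Omega> for \<Omega> :: "'w measure" +
  fixes W :: "'h::real_inner \<Rightarrow> 'w \<Rightarrow> real"
  assumes isonormal: "isonormal_process \<Omega> W"
begin

lemma measurable_W[measurable]: "W h \<in> borel_measurable \<Omega>"
  using isonormal by (simp add: isonormal_process_def)

lemma gaussian_law_sum:
  assumes "finite S"
  shows "gaussian_law (distr \<Omega> borel (\<lambda>\<omega>. \<Sum>h\<in>S. c h * W h \<omega>))"
proof -
  have "\<forall>S c. finite S \<longrightarrow> gaussian_law (distr \<Omega> borel (\<lambda>\<omega>. \<Sum>h\<in>S. c h * W h \<omega>))"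
    using isonormal unfolding isonormal_process_def by (elim conjE)
  then show ?thesis using assms by (elim allE impE)
qed

text \<open>A covariance of 0 carries no information on integrability, as the Bochner integral of a
  nonintegrable function is 0 by default. Integrability comes from the Gaussian law of a single
  \<open>W h\<close>.\<close>

lemma integrable_W_square: "integrable \<Omega> (\<lambda>\<omega>. (W h \<omega>)\<^sup>2)"
proof -
  have "gaussian_law (distr \<Omega> borel (W h))"
    using gaussian_law_sum[of "{h}" "\<lambda>_. 1"] by simp
  moreover have "(\<integral>x. x \<partial>distr \<Omega> borel (W h)) = 0"
    using isonormal by (simp add: isonormal_process_def integral_distr)
  ultimately have "integrable (distr \<Omega> borel (W h)) (\<lambda>x. x\<^sup>2)" by (rule gaussian_law_centered_char)
  then show ?thesis by (simp add: integrable_distr_eq)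
qed

lemma integrable_W: "integrable \<Omega> (W h)"
  using integrable_W_square by (rule square_integrable_imp_integrable[OF measurable_W])

lemma integrable_W_mult: "integrable \<Omega> (\<lambda>\<omega>. W h \<omega> * W g \<omega>)"
proof -
  have "integrable \<Omega> (\<lambda>\<omega>. (W h \<omega>)\<^sup>2 + (W g \<omega>)\<^sup>2)" using integrable_W_square by simp
  then show ?thesis
  proof (rule Bochner_Integration.integrable_bound)
    have "\<bar>a * b\<bar> \<le> a\<^sup>2 + b\<^sup>2" for a b :: real
    proof -
      have "2 * (\<bar>a\<bar> * \<bar>b\<bar>) \<le> \<bar>a\<bar>\<^sup>2 + \<bar>b\<bar>\<^sup>2" using sum_squares_bound[of "\<bar>a\<bar>" "\<bar>b\<bar>"] by (simp add: mult.assoc)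
      moreover have "0 \<le> \<bar>a\<bar> * \<bar>b\<bar>" by simp
      ultimately have "\<bar>a\<bar> * \<bar>b\<bar> \<le> \<bar>a\<bar>\<^sup>2 + \<bar>b\<bar>\<^sup>2" by linarith
      then show ?thesis by (simp add: abs_mult)
    qed
    then show "AE \<omega> in \<Omega>. norm (W h \<omega> * W g \<omega>) \<le> norm ((W h \<omega>)\<^sup>2 + (W g \<omega>)\<^sup>2)" by simp
  qed measurable
qed

lemma covariance_sum:
  shows "integrable \<Omega> (\<lambda>\<omega>. (\<Sum>k\<in>K. c k * W (h k) \<omega>) * (\<Sum>l\<in>L. d l * W (g l) \<omega>))"
    and "(\<integral>\<omega>. (\<Sum>k\<in>K. c k * W (h k) \<omega>) * (\<Sum>l\<in>L. d l * W (g l) \<omega>) \<partial>\<Omega>)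
      = inner (\<Sum>k\<in>K. c k *\<^sub>R h k) (\<Sum>l\<in>L. d l *\<^sub>R g l)"
proof -
  have e: "(\<Sum>k\<in>K. c k * W (h k) \<omega>) * (\<Sum>l\<in>L. d l * W (g l) \<omega>)
     = (\<Sum>k\<in>K. \<Sum>l\<in>L. (c k * d l) * (W (h k) \<omega> * W (g l) \<omega>))" for \<omega>
    by (simp add: sum_product mult_ac)
  show "integrable \<Omega> (\<lambda>\<omega>. (\<Sum>k\<in>K. c k * W (h k) \<omega>) * (\<Sum>l\<in>L. d l * W (g l) \<omega>))"
    unfolding e by (intro Bochner_Integration.integrable_sum integrable_mult_right integrable_W_mult)
  have cov: "(\<integral>\<omega>. W a \<omega> * W b \<omega> \<partial>\<Omega>) = inner a b" for a b
    using isonormal by (simp add: isonormal_process_def)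
  show "(\<integral>\<omega>. (\<Sum>k\<in>K. c k * W (h k) \<omega>) * (\<Sum>l\<in>L. d l * W (g l) \<omega>) \<partial>\<Omega>)
      = inner (\<Sum>k\<in>K. c k *\<^sub>R h k) (\<Sum>l\<in>L. d l *\<^sub>R g l)"
    unfolding e
    by (simp add: Bochner_Integration.integral_sum integrable_mult_right integrable_W_mult cov
        inner_sum_left inner_sum_right mult.assoc)
       (subst sum.swap, simp add: sum_distrib_left mult_ac)
qed

text \<open>Linearity of W is a consequence of the covariance: in the expansion of the mean squared
  difference all three integrals equal the same inner product, and they cancel.\<close>

lemma W_sum_AE: "AE \<omega> in \<Omega>. W (\<Sum>k\<in>K. c k *\<^sub>R h k) \<omega> = (\<Sum>k\<in>K. c k * W (h k) \<omega>)"
proof -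
  let ?x = "\<Sum>k\<in>K. c k *\<^sub>R h k" and ?S = "\<lambda>\<omega>. \<Sum>k\<in>K. c k * W (h k) \<omega>"
  have i: "integrable \<Omega> (\<lambda>\<omega>. W ?x \<omega> * W ?x \<omega>)" "integrable \<Omega> (\<lambda>\<omega>. W ?x \<omega> * ?S \<omega>)" "integrable \<Omega> (\<lambda>\<omega>. ?S \<omega> * ?S \<omega>)"
    and v: "(\<integral>\<omega>. W ?x \<omega> * W ?x \<omega> \<partial>\<Omega>) = inner ?x ?x" "(\<integral>\<omega>. W ?x \<omega> * ?S \<omega> \<partial>\<Omega>) = inner ?x ?x"
      "(\<integral>\<omega>. ?S \<omega> * ?S \<omega> \<partial>\<Omega>) = inner ?x ?x"
    using covariance_sum[of "\<lambda>_. 1" id "{?x}" "\<lambda>_. 1" id "{?x}"] covariance_sum[of "\<lambda>_. 1" id "{?x}" c h K]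
      covariance_sum[of c h K c h K] by simp_all
  have e: "(W ?x \<omega> - ?S \<omega>)\<^sup>2 = W ?x \<omega> * W ?x \<omega> - 2 * (W ?x \<omega> * ?S \<omega>) + ?S \<omega> * ?S \<omega>" for \<omega>
    by (simp only: power2_eq_square left_diff_distrib right_diff_distrib) simp
  have "integrable \<Omega> (\<lambda>\<omega>. (W ?x \<omega> - ?S \<omega>)\<^sup>2)" "(\<integral>\<omega>. (W ?x \<omega> - ?S \<omega>)\<^sup>2 \<partial>\<Omega>) = 0"
    unfolding e using i v by (simp_all del: power2_eq_square)
  then have "AE \<omega> in \<Omega>. (W ?x \<omega> - ?S \<omega>)\<^sup>2 = 0"
    by (subst (asm) integral_nonneg_eq_0_iff_AE) auto
  then show ?thesis by simp
qed

text \<open>Joint normality and orthonormality give every linear combination the sum of the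
  \<open>(c k)^2\<close> as variance, hence the characteristic function that
  \<open>gaussian_tuple_distr\<close> asks for.\<close>

lemma orthonormal_distr:
  assumes K: "finite K" and on: "\<And>k l. k \<in> K \<Longrightarrow> l \<in> K \<Longrightarrow> inner (h k) (h l) = (if k = l then 1 else 0)"
  shows "distr \<Omega> (\<Pi>\<^sub>M k\<in>K. borel) (\<lambda>\<omega>. \<lambda>k\<in>K. W (h k) \<omega>) = (\<Pi>\<^sub>M k\<in>K. std_normal_distribution)"
proof (rule gaussian_tuple_distr[OF K prob_space_axioms])
  fix c :: "'a \<Rightarrow> real"
  let ?S = "\<lambda>\<omega>. \<Sum>k\<in>K. c k * W (h k) \<omega>"
  \<comment> \<open>\<open>isonormal_process\<close> sums over a set of vectors; h must be injective
    on K to turn such a sum into one over indices.\<close>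
  have inj: "inj_on h K"
  proof (rule inj_onI)
    fix k l assume "k \<in> K" "l \<in> K" "h k = h l"
    then show "k = l" using on[of k l] on[of k k] by (auto split: if_splits)
  qed
  have "gaussian_law (distr \<Omega> borel (\<lambda>\<omega>. \<Sum>g\<in>h ` K. c (the_inv_into K h g) * W g \<omega>))"
    using K by (intro gaussian_law_sum finite_imageI)
  also have "(\<lambda>\<omega>. \<Sum>g\<in>h ` K. c (the_inv_into K h g) * W g \<omega>) = ?S"
    using inj by (auto simp: sum.reindex the_inv_into_f_f intro!: sum.cong)
  finally have g: "gaussian_law (distr \<Omega> borel ?S)" .
  have [measurable]: "?S \<in> borel_measurable \<Omega>" by measurable
  have "(\<integral>\<omega>. ?S \<omega> \<partial>\<Omega>) = 0"
    using isonormal integrable_W by (simp add: isonormal_process_def)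
  then have m: "(\<integral>x. x \<partial>distr \<Omega> borel ?S) = 0" by (simp add: integral_distr)
  have "(\<integral>x. x\<^sup>2 \<partial>distr \<Omega> borel ?S) = (\<integral>\<omega>. ?S \<omega> * ?S \<omega> \<partial>\<Omega>)"
    by (simp add: integral_distr power2_eq_square)
  also have "\<dots> = (\<Sum>k\<in>K. \<Sum>l\<in>K. c k * c l * (if k = l then 1 else 0))"
    unfolding covariance_sum inner_sum_left inner_sum_right
    by (subst sum.swap) (intro sum.cong refl, simp add: on mult_ac)
  also have "\<dots> = (\<Sum>k\<in>K. (c k)\<^sup>2)"
    using K by (simp add: power2_eq_square if_distrib[of "\<lambda>x. _ * x"] cong: if_cong)
  finally have v: "(\<integral>x. x\<^sup>2 \<partial>distr \<Omega> borel ?S) = (\<Sum>k\<in>K. (c k)\<^sup>2)" .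
  show "(CLINT \<omega>|\<Omega>. iexp (\<Sum>k\<in>K. c k * W (h k) \<omega>)) = of_real (exp (- (\<Sum>k\<in>K. (c k)\<^sup>2) / 2))"
    using gaussian_law_centered_char(2)[OF g m, of 1] v by (simp add: char_def integral_distr del: of_real_sum)
qed measurable

text \<open>By independence the characteristic function factors. Each square contributes
  \<open>exp (- 1/2 * Ln (1 - 2 \<i> \<lambda> t))\<close>, and the centering by -1 supplies
  \<open>exp (- \<i> \<lambda> t)\<close>, which is the linear term of \<open>gamma_exponent\<close>
  at \<open>2 \<lambda> t\<close> with weight 1/2.\<close>

lemma char_diagonal_form:
  assumes K: "finite K" and on: "\<And>k l. k \<in> K \<Longrightarrow> l \<in> K \<Longrightarrow> inner (h k) (h l) = (if k = l then 1 else 0)"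
    and [measurable]: "F \<in> borel_measurable \<Omega>"
    and F: "AE \<omega> in \<Omega>. F \<omega> = (\<Sum>k\<in>K. lam k * ((W (h k) \<omega>)\<^sup>2 - 1))"
  shows "char (distr \<Omega> borel F) t = exp (\<Sum>k\<in>K. gamma_exponent (t * (2 * lam k)) / 2)"
proof -
  interpret N: real_distribution std_normal_distribution by (rule real_dist_normal_dist)
  interpret product_sigma_finite "\<lambda>_::'a. std_normal_distribution"
    by (simp add: product_sigma_finite_def N.sigma_finite_measure)
  have distr: "distr \<Omega> (\<Pi>\<^sub>M k\<in>K. borel) (\<lambda>\<omega>. \<lambda>k\<in>K. W (h k) \<omega>) = (\<Pi>\<^sub>M k\<in>K. std_normal_distribution)"
    using K on by (rule orthonormal_distr)
  have mt: "(\<lambda>\<omega>. \<lambda>k\<in>K. W (h k) \<omega>) \<in> measurable \<Omega> (\<Pi>\<^sub>M k\<in>K. borel)"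
    by (intro measurable_restrict) measurable
  have mp: "(\<lambda>x. \<Prod>k\<in>K. iexp (t * (lam k * ((x k)\<^sup>2 - 1)))) \<in> borel_measurable (\<Pi>\<^sub>M k\<in>K. borel)"
    by measurable
  have "char (distr \<Omega> borel F) t = (CLINT \<omega>|\<Omega>. iexp (t * F \<omega>))" by (simp add: char_def integral_distr)
  also have "\<dots> = (CLINT \<omega>|\<Omega>. (\<Prod>k\<in>K. iexp (t * (lam k * (((\<lambda>k\<in>K. W (h k) \<omega>) k)\<^sup>2 - 1)))))"
  proof (rule integral_cong_AE)
    show "AE \<omega> in \<Omega>. iexp (t * F \<omega>) = (\<Prod>k\<in>K. iexp (t * (lam k * (((\<lambda>k\<in>K. W (h k) \<omega>) k)\<^sup>2 - 1))))"
      using F by eventually_elim (simp add: exp_sum[OF K] sum_distrib_left del: of_real_mult of_real_diff of_real_power)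
    show "(\<lambda>\<omega>. \<Prod>k\<in>K. iexp (t * (lam k * (((\<lambda>k\<in>K. W (h k) \<omega>) k)\<^sup>2 - 1)))) \<in> borel_measurable \<Omega>"
      using measurable_compose[OF mt mp] .
  qed measurable
  also have "\<dots> = (CLINT x|(\<Pi>\<^sub>M k\<in>K. std_normal_distribution). (\<Prod>k\<in>K. iexp (t * (lam k * ((x k)\<^sup>2 - 1)))))"
    unfolding distr[symmetric] by (rule integral_distr[OF mt mp, symmetric])
  also have "\<dots> = (\<Prod>k\<in>K. CLINT x|std_normal_distribution. iexp (t * (lam k * (x\<^sup>2 - 1))))"
    by (rule product_integral_prod[OF K]) (rule N.integrable_const_bound[of _ 1], auto)
  also have "\<dots> = (\<Prod>k\<in>K. exp (gamma_exponent (t * (2 * lam k)) / 2))"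
  proof (intro prod.cong refl)
    fix k
    have "(CLINT x|std_normal_distribution. iexp (t * (lam k * (x\<^sup>2 - 1))))
        = (CLINT x|std_normal_distribution. iexp (- (t * lam k)) * iexp ((t * lam k) * x\<^sup>2))"
      by (simp add: exp_add[symmetric] algebra_simps)
    also have "\<dots> = iexp (- (t * lam k)) * (CLINT x|std_normal_distribution. iexp ((t * lam k) * x\<^sup>2))"
      by (rule integral_mult_right_zero)
    also have "\<dots> = exp (gamma_exponent (t * (2 * lam k)) / 2)"
      unfolding char_std_normal_square by (simp add: exp_add[symmetric] gamma_exponent_def field_simps) (simp add: minus_diff_commute)
    finally show "(CLINT x|std_normal_distribution. iexp (t * (lam k * (x\<^sup>2 - 1)))) = exp (gamma_exponent (t * (2 * lam k)) / 2)" .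
  qed
  finally show ?thesis by (simp add: exp_sum[OF K])
qed

text \<open>Linearity of I is available only on symmetric tensors and only almost surely, so every
  partial sum is placed in the span before use, and finitely many exceptional sets are
  collected.\<close>

lemma double_integral_diagonal_AE:
  assumes T: "hilbert_tensor_square T" and I: "double_wiener_ito_integral \<Omega> W T I"
    and K: "finite K" and n1: "\<And>k. k \<in> K \<Longrightarrow> norm (h k) = 1"
  shows "(\<Sum>k\<in>K. lam k *\<^sub>R T (h k) (h k)) \<in> symmetric_tensor_square T"
    and "AE \<omega> in \<Omega>. I (\<Sum>k\<in>K. lam k *\<^sub>R T (h k) (h k)) \<omega> = (\<Sum>k\<in>K. lam k * ((W (h k) \<omega>)\<^sup>2 - 1))"
proof -
  let ?S = "span {T a b + T b a | a b. True}"
  have sub: "?S \<subseteq> symmetric_tensor_square T" unfolding symmetric_tensor_square_def by (rule closure_subset)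
  have TS: "T a a \<in> ?S" for a
  proof -
    have "(1 / 2) *\<^sub>R (T a a + T a a) \<in> ?S" by (intro span_scale span_base) blast
    then show ?thesis by (simp add: scaleR_2[symmetric])
  qed
  have sums: "(\<Sum>k\<in>J. lam k *\<^sub>R T (h k) (h k)) \<in> ?S" for J by (intro span_sum span_scale TS)
  then show "(\<Sum>k\<in>K. lam k *\<^sub>R T (h k) (h k)) \<in> symmetric_tensor_square T" using sub by blast
  have lin: "AE \<omega> in \<Omega>. I (a *\<^sub>R s + b *\<^sub>R t) \<omega> = a * I s \<omega> + b * I t \<omega>" if "s \<in> ?S" "t \<in> ?S" for s t a b
    using I that sub unfolding double_wiener_ito_integral_def by blast
  have unit: "AE \<omega> in \<Omega>. I (T a a) \<omega> = (W a \<omega>)\<^sup>2 - 1" if "norm a = 1" for a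
    using I that unfolding double_wiener_ito_integral_def by blast
  show "AE \<omega> in \<Omega>. I (\<Sum>k\<in>K. lam k *\<^sub>R T (h k) (h k)) \<omega> = (\<Sum>k\<in>K. lam k * ((W (h k) \<omega>)\<^sup>2 - 1))"
    using K n1
  proof (induction K rule: finite_induct)
    \<comment> \<open>\<open>I 0\<close> is a chosen representative; linearity with both
      coefficients 0 shows that it vanishes almost surely.\<close>
    case empty
    show ?case using lin[OF span_zero span_zero, of 0 0] by simp
  next
    case (insert j K)
    have "AE \<omega> in \<Omega>. I (lam j *\<^sub>R T (h j) (h j) + 1 *\<^sub>R (\<Sum>k\<in>K. lam k *\<^sub>R T (h k) (h k))) \<omega>
        = lam j * I (T (h j) (h j)) \<omega> + 1 * I (\<Sum>k\<in>K. lam k *\<^sub>R T (h k) (h k)) \<omega>"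
      by (rule lin[OF TS sums])
    moreover have "AE \<omega> in \<Omega>. I (T (h j) (h j)) \<omega> = (W (h j) \<omega>)\<^sup>2 - 1"
      using insert.prems by (intro unit) simp
    moreover have "AE \<omega> in \<Omega>. I (\<Sum>k\<in>K. lam k *\<^sub>R T (h k) (h k)) \<omega> = (\<Sum>k\<in>K. lam k * ((W (h k) \<omega>)\<^sup>2 - 1))"
      using insert by simp
    ultimately show ?case by eventually_elim (use insert.hyps in simp)
  qed
qed

text \<open>In the basis h that diagonalizes f the kernel is diagonal. The eigenvalues govern the
  law; the quadratic form in the \<open>W (e i)\<close> is what gets matched with the homogeneous
  sum; the equality of sums of squares translates eigenvalues into influences.\<close>

lemma double_integral_quadratic_form:
  fixes f :: "'k \<Rightarrow> 'k \<Rightarrow> real"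
  assumes T: "hilbert_tensor_square T" and I: "double_wiener_ito_integral \<Omega> W T I"
    and K: "finite K" and on: "\<And>i j. i \<in> K \<Longrightarrow> j \<in> K \<Longrightarrow> inner (e i) (e j) = (if i = j then 1 else 0)"
    and sym: "\<And>i j. i \<in> K \<Longrightarrow> j \<in> K \<Longrightarrow> f i j = f j i" and diag: "\<And>i. i \<in> K \<Longrightarrow> f i i = 0"
  defines "F \<equiv> I (\<Sum>i\<in>K. \<Sum>j\<in>K. f i j *\<^sub>R T (e i) (e j))"
  shows "\<exists>lam. F \<in> borel_measurable \<Omega> \<and>
    (\<forall>t. char (distr \<Omega> borel F) t = exp (\<Sum>k\<in>K. gamma_exponent (t * (2 * lam k)) / 2)) \<and>
    (\<Sum>k\<in>K. (lam k)\<^sup>2) = (\<Sum>i\<in>K. \<Sum>j\<in>K. (f i j)\<^sup>2) \<and>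
    (AE \<omega> in \<Omega>. F \<omega> = (\<Sum>i\<in>K. \<Sum>j\<in>K. f i j * W (e i) \<omega> * W (e j) \<omega>))"
proof -
  obtain lam u where
    u: "\<And>k l. k \<in> K \<Longrightarrow> l \<in> K \<Longrightarrow> (\<Sum>j\<in>K. u k j * u l j) = (if k = l then 1 else 0)" and
    f: "\<And>i j. i \<in> K \<Longrightarrow> j \<in> K \<Longrightarrow> f i j = (\<Sum>k\<in>K. lam k * u k i * u k j)"
    by (rule real_symmetric_diagonalization[OF K, of f]) (erule (1) sym, blast)
  define h where "h k = (\<Sum>j\<in>K. u k j *\<^sub>R e j)" for k
  have hon: "inner (h k) (h l) = (if k = l then 1 else 0)" if "k \<in> K" "l \<in> K" for k l
  proof -
    have "inner (h k) (h l) = (\<Sum>i\<in>K. \<Sum>j\<in>K. u k i * u l j * (if i = j then 1 else 0))"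
      unfolding h_def inner_sum_left inner_sum_right
      by (subst sum.swap) (intro sum.cong refl, simp add: on mult_ac)
    also have "\<dots> = (\<Sum>i\<in>K. u k i * u l i)"
      using K by (simp add: if_distrib[of "\<lambda>x. _ * x"] cong: if_cong)
    finally show ?thesis using u[OF that] by simp
  qed
  have triple: "(\<Sum>k\<in>K. \<Sum>i\<in>K. \<Sum>j\<in>K. p k i j) = (\<Sum>i\<in>K. \<Sum>j\<in>K. \<Sum>k\<in>K. p k i j)"
    for p :: "'k \<Rightarrow> 'k \<Rightarrow> 'k \<Rightarrow> 'z::comm_monoid_add"
    by (subst sum.swap) (intro sum.cong refl sum.swap)
  have bil: "bilinear T" using T by (simp add: hilbert_tensor_square_def)
  have g: "(\<Sum>i\<in>K. \<Sum>j\<in>K. f i j *\<^sub>R T (e i) (e j)) = (\<Sum>k\<in>K. lam k *\<^sub>R T (h k) (h k))"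
  proof -
    have "(\<Sum>k\<in>K. lam k *\<^sub>R T (h k) (h k)) = (\<Sum>k\<in>K. \<Sum>i\<in>K. \<Sum>j\<in>K. (lam k * u k i * u k j) *\<^sub>R T (e i) (e j))"
      unfolding h_def bilinear_sum[OF bil] sum.cartesian_product[symmetric] bilinear_lmul[OF bil] bilinear_rmul[OF bil]
      by (simp add: scaleR_sum_right mult_ac)
    also have "\<dots> = (\<Sum>i\<in>K. \<Sum>j\<in>K. \<Sum>k\<in>K. (lam k * u k i * u k j) *\<^sub>R T (e i) (e j))" by (rule triple)
    finally show ?thesis by (simp add: f scaleR_sum_left)
  qed
  have n1: "norm (h k) = 1" if "k \<in> K" for k using hon[OF that that] by (simp add: norm_eq_sqrt_inner)
  have mem: "(\<Sum>k\<in>K. lam k *\<^sub>R T (h k) (h k)) \<in> symmetric_tensor_square T"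
    by (rule double_integral_diagonal_AE(1)[OF T I K n1])
  have F: "AE \<omega> in \<Omega>. F \<omega> = (\<Sum>k\<in>K. lam k * ((W (h k) \<omega>)\<^sup>2 - 1))"
    unfolding F_def g by (rule double_integral_diagonal_AE(2)[OF T I K n1])
  have Fm: "F \<in> borel_measurable \<Omega>"
    using I mem unfolding F_def g double_wiener_ito_integral_def second_wiener_chaos_def by blast
  \<comment> \<open>The eigenvalues sum to the trace of f, which is 0. The constants -1 in the
    diagonal form therefore cancel, and F is the quadratic form without correction.\<close>
  have tr: "(\<Sum>k\<in>K. lam k) = 0"
  proof -
    have "(\<Sum>k\<in>K. lam k) = (\<Sum>k\<in>K. \<Sum>i\<in>K. lam k * u k i * u k i)"
      using u by (intro sum.cong refl) (simp add: mult.assoc sum_distrib_left[symmetric])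
    also have "\<dots> = (\<Sum>i\<in>K. f i i)" by (subst sum.swap) (intro sum.cong refl, simp add: f)
    finally show ?thesis using diag by simp
  qed
  \<comment> \<open>Each eigenvalue is the value of f at its own frame vector. Inserted for one
    factor of \<open>(lam k)^2\<close>, it turns the sum of squared eigenvalues into the sum of
    squared entries.\<close>
  have lam: "(\<Sum>i\<in>K. \<Sum>j\<in>K. f i j * u k i * u k j) = lam k" if k: "k \<in> K" for k
  proof -
    have "(\<Sum>i\<in>K. \<Sum>j\<in>K. f i j * u k i * u k j) = (\<Sum>i\<in>K. \<Sum>j\<in>K. \<Sum>l\<in>K. lam l * (u l i * u k i) * (u l j * u k j))"
      by (intro sum.cong refl) (simp add: f sum_distrib_left sum_distrib_right mult_ac)
    also have "\<dots> = (\<Sum>l\<in>K. \<Sum>i\<in>K. \<Sum>j\<in>K. lam l * (u l i * u k i) * (u l j * u k j))" by (rule triple[symmetric])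
    also have "\<dots> = (\<Sum>l\<in>K. lam l * (\<Sum>i\<in>K. u l i * u k i) * (\<Sum>j\<in>K. u l j * u k j))"
      by (simp only: mult.assoc sum_product) (simp only: sum_distrib_left)
    also have "\<dots> = (\<Sum>l\<in>K. if l = k then lam l else 0)" using k by (intro sum.cong refl) (simp add: u)
    also have "\<dots> = lam k" using k K by simp
    finally show ?thesis .
  qed
  have sq: "(\<Sum>k\<in>K. (lam k)\<^sup>2) = (\<Sum>i\<in>K. \<Sum>j\<in>K. (f i j)\<^sup>2)"
  proof -
    have "(\<Sum>k\<in>K. (lam k)\<^sup>2) = (\<Sum>k\<in>K. \<Sum>i\<in>K. \<Sum>j\<in>K. f i j * (lam k * u k i * u k j))"
    proof (intro sum.cong refl)
      fix k assume "k \<in> K"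
      have "(lam k)\<^sup>2 = lam k * (\<Sum>i\<in>K. \<Sum>j\<in>K. f i j * u k i * u k j)"
        using lam[OF \<open>k \<in> K\<close>] by (simp add: power2_eq_square)
      then show "(lam k)\<^sup>2 = (\<Sum>i\<in>K. \<Sum>j\<in>K. f i j * (lam k * u k i * u k j))"
        by (simp add: sum_distrib_left mult_ac)
    qed
    also have "\<dots> = (\<Sum>i\<in>K. \<Sum>j\<in>K. \<Sum>k\<in>K. f i j * (lam k * u k i * u k j))" by (rule triple)
    finally show ?thesis by (simp add: sum_distrib_left[symmetric] f[symmetric] power2_eq_square)
  qed
  have "AE \<omega> in \<Omega>. \<forall>k\<in>K. W (h k) \<omega> = (\<Sum>j\<in>K. u k j * W (e j) \<omega>)"
    unfolding h_def by (intro AE_finite_allI[OF K] W_sum_AE)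
  with F have "AE \<omega> in \<Omega>. F \<omega> = (\<Sum>i\<in>K. \<Sum>j\<in>K. f i j * W (e i) \<omega> * W (e j) \<omega>)"
  proof eventually_elim
    case (elim \<omega>)
    have "F \<omega> = (\<Sum>k\<in>K. lam k * (W (h k) \<omega> * W (h k) \<omega>))"
      using elim(1) tr by (simp add: right_diff_distrib sum_subtractf power2_eq_square)
    also have "\<dots> = (\<Sum>k\<in>K. \<Sum>i\<in>K. \<Sum>j\<in>K. (lam k * u k i * u k j) * (W (e i) \<omega> * W (e j) \<omega>))"
      using elim(2) by (intro sum.cong refl) (simp add: sum_product sum_distrib_left mult_ac)
    also have "\<dots> = (\<Sum>i\<in>K. \<Sum>j\<in>K. \<Sum>k\<in>K. (lam k * u k i * u k j) * (W (e i) \<omega> * W (e j) \<omega>))" by (rule triple)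
    finally show ?case by (simp add: f sum_distrib_right mult.assoc)
  qed
  with Fm char_diagonal_form[OF K hon Fm F] sq show ?thesis by (intro exI[of _ lam] conjI allI)
qed

end

subsection \<open>Smooth test functions and weak convergence\<close>

text \<open>The second variable enters at -t, which turns its rate into the negative scale
  \<open>- 1 / \<alpha>\<^sub>2\<close>. The linear terms of the two exponents cancel because the
  mean \<open>p\<^sub>1 / \<alpha>\<^sub>1 - p\<^sub>2 / \<alpha>\<^sub>2\<close> is 0.\<close>

lemma char_bilateral_gamma_law:
  fixes \<alpha>\<^sub>1 p\<^sub>1 \<alpha>\<^sub>2 p\<^sub>2 t :: real
  assumes pos: "0 < \<alpha>\<^sub>1" "0 < p\<^sub>1" "0 < \<alpha>\<^sub>2" "0 < p\<^sub>2" and centered: "p\<^sub>1 * \<alpha>\<^sub>2 = p\<^sub>2 * \<alpha>\<^sub>1"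
  shows "char (bilateral_gamma_law \<alpha>\<^sub>1 p\<^sub>1 \<alpha>\<^sub>2 p\<^sub>2) t =
    exp (p\<^sub>1 * gamma_exponent (t * (1 / \<alpha>\<^sub>1)) + p\<^sub>2 * gamma_exponent (t * (- 1 / \<alpha>\<^sub>2)))"
proof -
  let ?A = "gamma_law \<alpha>\<^sub>1 p\<^sub>1" and ?B = "gamma_law \<alpha>\<^sub>2 p\<^sub>2"
  interpret A: real_distribution ?A using pos by (intro char_gamma_law)
  interpret B: real_distribution ?B using pos by (intro char_gamma_law)
  interpret AB: pair_prob_space ?A ?B ..
  have [measurable]: "(\<lambda>(x, y). x - y) \<in> borel_measurable (?A \<Otimes>\<^sub>M ?B)"
    by measurable
  have "char (bilateral_gamma_law \<alpha>\<^sub>1 p\<^sub>1 \<alpha>\<^sub>2 p\<^sub>2) t = (CLINT z|(?A \<Otimes>\<^sub>M ?B). iexp (t * (case z of (x, y) \<Rightarrow> x - y)))"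
    unfolding char_def bilateral_gamma_law_def by (subst integral_distr) auto
  also have "\<dots> = (CLINT z|(?A \<Otimes>\<^sub>M ?B). (case z of (x, y) \<Rightarrow> iexp (t * x) * iexp ((- t) * y)))"
    by (intro Bochner_Integration.integral_cong refl) (auto simp: exp_add[symmetric] algebra_simps)
  also have "\<dots> = (CLINT x|?A. CLINT y|?B. iexp (t * x) * iexp ((- t) * y))"
  proof (rule AB.integral_fst'[symmetric, where f = "\<lambda>(x, y). iexp (t * x) * iexp ((- t) * y)", simplified prod.case])
    show "integrable (?A \<Otimes>\<^sub>M ?B) (\<lambda>(x, y). iexp (t * x) * iexp ((- t) * y))"
      by (rule AB.integrable_const_bound[of _ 1]) (auto simp: norm_mult case_prod_beta)
  qed
  also have "\<dots> = char ?A t * char ?B (- t)"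
    by (simp add: char_def)
  also have "\<dots> = exp (- complex_of_real p\<^sub>1 * Ln (1 - \<i> * (t / \<alpha>\<^sub>1)) - complex_of_real p\<^sub>2 * Ln (1 - \<i> * (- t / \<alpha>\<^sub>2)))"
    using char_gamma_law(2)[OF pos(1,2), of t] char_gamma_law(2)[OF pos(3,4), of "- t"]
    by (simp add: exp_add[symmetric])
  also have "- complex_of_real p\<^sub>1 * Ln (1 - \<i> * (t / \<alpha>\<^sub>1)) - complex_of_real p\<^sub>2 * Ln (1 - \<i> * (- t / \<alpha>\<^sub>2))
    = p\<^sub>1 * gamma_exponent (t * (1 / \<alpha>\<^sub>1)) + p\<^sub>2 * gamma_exponent (t * (- 1 / \<alpha>\<^sub>2))"
  proof -
    have "p\<^sub>1 * (1 / \<alpha>\<^sub>1) + p\<^sub>2 * (- 1 / \<alpha>\<^sub>2) = 0" using centered pos by (simp add: field_simps)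
    then have "complex_of_real (p\<^sub>1 * (1 / \<alpha>\<^sub>1) + p\<^sub>2 * (- 1 / \<alpha>\<^sub>2)) * (\<i> * t) = 0" by simp
    then show ?thesis by (simp add: gamma_exponent_def algebra_simps)
  qed
  finally show ?thesis .
qed

lemma smooth_test_functions3_lipschitz:
  assumes "h \<in> smooth_test_functions3"
  shows "\<bar>h x - h y\<bar> \<le> \<bar>x - y\<bar>"
proof -
  have d: "(h has_field_derivative deriv h z) (at z within UNIV)" for z
  proof -
    have "\<forall>k<3. \<forall>x. (deriv ^^ k) h differentiable (at x)" using assms by (simp add: smooth_test_functions3_def)
    from this[rule_format, of 0 z] show ?thesis by (simp add: DERIV_deriv_iff_real_differentiable)
  qed
  have b: "norm (deriv h z) \<le> 1" for z
  proof -
    have "\<forall>k\<le>3. \<forall>x. \<bar>(deriv ^^ k) h x\<bar> \<le> 1" using assms by (simp add: smooth_test_functions3_def)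
    from this[rule_format, of 1 z] show ?thesis by simp
  qed
  have "norm (h x - h y) \<le> 1 * norm (x - y)"
    by (rule field_differentiable_bound[OF convex_UNIV d b]) auto
  then show ?thesis by simp
qed

text \<open>On a Skorohod coupling the test functions, being 1-Lipschitz and bounded by 1, change by
  at most \<open>min 2 \<bar>X n x - Z x\<bar>\<close>. This bound does not depend on h, and its
  mean tends to 0 by dominated convergence.\<close>

lemma weak_conv_imp_uniform_smooth:
  assumes \<mu>: "\<And>n. real_distribution (\<mu> n)" and \<nu>: "real_distribution \<nu>" and w: "weak_conv_m \<mu> \<nu>"
  obtains b where "b \<longlonglongrightarrow> 0"
    "\<And>n h. h \<in> smooth_test_functions3 \<Longrightarrow> \<bar>(\<integral>x. h x \<partial>\<mu> n) - (\<integral>x. h x \<partial>\<nu>)\<bar> \<le> b n"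
proof -
  obtain Q :: "real measure" and X :: "nat \<Rightarrow> real \<Rightarrow> real" and Z :: "real \<Rightarrow> real" where
    Q: "prob_space Q" and X[measurable]: "\<And>n. X n \<in> borel_measurable Q" and dX: "\<And>n. distr Q borel (X n) = \<mu> n"
    and Z: "Z \<in> measurable Q lborel" and dZ: "distr Q borel Z = \<nu>"
    and lim: "\<And>x. x \<in> space Q \<Longrightarrow> (\<lambda>n. X n x) \<longlonglongrightarrow> Z x"
    using Skorohod[OF \<mu> \<nu> w] by blast
  have [measurable]: "Z \<in> borel_measurable Q" using Z by simp
  interpret Q: prob_space Q by fact
  define b where "b n = (\<integral>x. min 2 \<bar>X n x - Z x\<bar> \<partial>Q)" for n
  have "b \<longlonglongrightarrow> (\<integral>x. 0 \<partial>Q)"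
    unfolding b_def
  proof (rule integral_dominated_convergence[where w = "\<lambda>_. 2"])
    show "AE x in Q. (\<lambda>n. min 2 \<bar>X n x - Z x\<bar>) \<longlonglongrightarrow> 0"
    proof (rule AE_I2)
      fix x assume "x \<in> space Q"
      from lim[OF this] have "(\<lambda>n. min 2 \<bar>X n x - Z x\<bar>) \<longlonglongrightarrow> min 2 \<bar>Z x - Z x\<bar>" by (intro tendsto_intros)
      then show "(\<lambda>n. min 2 \<bar>X n x - Z x\<bar>) \<longlonglongrightarrow> 0" by simp
    qed
  qed auto
  moreover have "\<bar>(\<integral>x. h x \<partial>\<mu> n) - (\<integral>x. h x \<partial>\<nu>)\<bar> \<le> b n" if h: "h \<in> smooth_test_functions3" for n h
  proof -
    note hD = smooth_test_functions3D[OF h]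
    have [measurable]: "h \<in> borel_measurable borel"
      using hD(2) by (intro borel_measurable_continuous_onI continuous_at_imp_continuous_on) auto
    have i: "integrable Q (\<lambda>x. h (Y x))" if [measurable]: "Y \<in> borel_measurable Q" for Y
      by (rule Q.integrable_const_bound[of _ 1]) (auto simp: hD)
    have "(\<integral>x. h x \<partial>\<mu> n) - (\<integral>x. h x \<partial>\<nu>) = (\<integral>x. h (X n x) - h (Z x) \<partial>Q)"
      using i[of "X n"] i[of Z] by (simp add: dX[symmetric] dZ[symmetric] integral_distr)
    also have "\<bar>\<dots>\<bar> \<le> (\<integral>x. \<bar>h (X n x) - h (Z x)\<bar> \<partial>Q)" by (rule integral_abs_bound)
    also have "\<dots> \<le> b n" unfolding b_def
    proof (rule integral_mono')
      show "integrable Q (\<lambda>x. min 2 \<bar>X n x - Z x\<bar>)" by (rule Q.integrable_const_bound[of _ 2]) auto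
      show "\<bar>h (X n x) - h (Z x)\<bar> \<le> min 2 \<bar>X n x - Z x\<bar>" for x
        using smooth_test_functions3_lipschitz[OF h, of "X n x" "Z x"] hD(1)[of "X n x"] hD(1)[of "Z x"] by simp
    qed simp
    finally show ?thesis .
  qed
  ultimately show thesis by (intro that[of b]) simp_all
qed

lemma zero_mem_smooth_test_functions3: "(\<lambda>_. 0) \<in> smooth_test_functions3"
proof -
  have "(deriv ^^ k) (\<lambda>_::real. 0::real) = (\<lambda>_. 0)" for k by (induction k) auto
  then show ?thesis by (simp add: smooth_test_functions3_def)
qed

text \<open>A real supremum is meaningful only over a nonempty set that is bounded above: the
  assumed bound provides the latter, the zero function the former and also the lower bound
  0.\<close>

lemma d3_dist_le:
  assumes "\<And>h. h \<in> smooth_test_functions3 \<Longrightarrow> \<bar>(\<integral>\<omega>. h (Y \<omega>) \<partial>M) - (\<integral>\<omega>. h (Z \<omega>) \<partial>M')\<bar> \<le> b"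
  shows "0 \<le> d3_dist M Y M' Z" "d3_dist M Y M' Z \<le> b"
proof -
  have bdd: "bdd_above ((\<lambda>h. \<bar>(\<integral>\<omega>. h (Y \<omega>) \<partial>M) - (\<integral>\<omega>. h (Z \<omega>) \<partial>M')\<bar>) ` smooth_test_functions3)"
    using assms by (intro bdd_aboveI2[of _ _ b])
  show "0 \<le> d3_dist M Y M' Z" unfolding d3_dist_def
    by (rule cSUP_upper2[OF bdd zero_mem_smooth_test_functions3]) simp
  show "d3_dist M Y M' Z \<le> b" unfolding d3_dist_def
    using zero_mem_smooth_test_functions3 assms by (intro cSUP_least) auto
qed

text \<open>Each derivative multiplies by t and advances the phase by \<open>pi / 2\<close>, so the
  divisor \<open>(1 + \<bar>t\<bar>)^3\<close> tames all orders up to 3. The free phase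
  \<open>\<theta>\<close> covers the sine as well.\<close>

lemma cos_mem_smooth_test_functions3:
  "(\<lambda>x. cos (t * x + \<theta>) / (1 + \<bar>t\<bar>) ^ 3) \<in> smooth_test_functions3"
proof -
  let ?c = "1 / (1 + \<bar>t\<bar>) ^ 3"
  have d: "(deriv ^^ k) (\<lambda>x. cos (t * x + \<theta>) / (1 + \<bar>t\<bar>) ^ 3) = (\<lambda>x. ?c * t ^ k * cos (t * x + \<theta> + k * (pi / 2)))" for k
  proof (induction k)
    case (Suc k)
    have "((\<lambda>x. c * t ^ k * cos (t * x + \<theta> + k * (pi / 2))) has_real_derivative
       (c * t ^ Suc k * cos (t * x + \<theta> + Suc k * (pi / 2)))) (at x)" for c x
    proof -
      have "cos (t * x + \<theta> + Suc k * (pi / 2)) = cos ((t * x + \<theta> + k * (pi / 2)) + pi / 2)"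
        by (simp add: algebra_simps add_divide_distrib)
      also have "\<dots> = - sin (t * x + \<theta> + k * (pi / 2))" by (simp add: cos_add)
      finally show ?thesis by (auto intro!: derivative_eq_intros)
    qed
    from DERIV_imp_deriv[OF this] show ?case unfolding funpow.simps o_apply Suc.IH ..
  qed simp
  have b: "\<bar>?c * t ^ k * cos y\<bar> \<le> 1" if "k \<le> 3" for k y
  proof -
    have "\<bar>t\<bar> ^ k \<le> (1 + \<bar>t\<bar>) ^ k" by (intro power_mono) auto
    also have "\<dots> \<le> (1 + \<bar>t\<bar>) ^ 3" using that by (intro power_increasing) auto
    finally have "?c * \<bar>t\<bar> ^ k \<le> 1" by (simp add: field_simps)
    then have "(?c * \<bar>t\<bar> ^ k) * \<bar>cos y\<bar> \<le> 1 * 1" by (intro mult_mono) auto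
    then show ?thesis by (simp add: abs_mult power_abs)
  qed
  show ?thesis unfolding smooth_test_functions3_def mem_Collect_eq d
  proof (intro conjI allI impI)
    fix k :: nat and x
    show "(\<lambda>x. ?c * t ^ k * cos (t * x + \<theta> + k * (pi / 2))) differentiable (at x)"
      by (auto intro!: derivative_intros simp: differentiable_def) (auto intro!: exI derivative_eq_intros)
    assume "k \<le> 3"
    then show "\<bar>?c * t ^ k * cos (t * x + \<theta> + k * (pi / 2))\<bar> \<le> 1" by (rule b)
  qed
qed

text \<open>Rescaled cosines with phases 0 and \<open>- pi / 2\<close> produce the real and
  imaginary parts of the characteristic functions, so Levy's continuity theorem applies.\<close>

lemma uniform_smooth_imp_weak_conv:
  assumes \<mu>: "\<And>n. real_distribution (\<mu> n)" and \<nu>: "real_distribution \<nu>"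
    and b: "b \<longlonglongrightarrow> 0"
    and le: "\<forall>\<^sub>F n in sequentially. \<forall>h\<in>smooth_test_functions3. \<bar>(\<integral>x. h x \<partial>\<mu> n) - (\<integral>x. h x \<partial>\<nu>)\<bar> \<le> b n"
  shows "weak_conv_m \<mu> \<nu>"
proof (rule levy_continuity[OF \<mu> \<nu>])
  fix t :: real
  have smooth: "(\<lambda>n. \<integral>x. h x \<partial>\<mu> n) \<longlonglongrightarrow> (\<integral>x. h x \<partial>\<nu>)" if "h \<in> smooth_test_functions3" for h
  proof (subst tendsto_dist_iff, rule tendsto_sandwich[OF _ _ tendsto_const b])
    show "\<forall>\<^sub>F n in sequentially. dist (\<integral>x. h x \<partial>\<mu> n) (\<integral>x. h x \<partial>\<nu>) \<le> b n"
      using le by eventually_elim (use that in \<open>auto simp: dist_real_def\<close>)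
  qed simp
  have c: "(1 + \<bar>t\<bar>) ^ 3 \<noteq> 0" using zero_less_power[of "1 + \<bar>t\<bar>" 3] by simp
  have cos: "(\<lambda>n. \<integral>x. cos (t * x + \<theta>) \<partial>\<mu> n) \<longlonglongrightarrow> (\<integral>x. cos (t * x + \<theta>) \<partial>\<nu>)" for \<theta>
    using tendsto_mult_left[OF smooth[OF cos_mem_smooth_test_functions3[of t \<theta>]], of "(1 + \<bar>t\<bar>) ^ 3"] c
    by simp
  have ch: "char M t = Complex (\<integral>x. cos (t * x + 0) \<partial>M) (\<integral>x. cos (t * x + (- pi / 2)) \<partial>M)"
    if "real_distribution M" for M
  proof -
    interpret real_distribution M by fact
    have i: "integrable M (\<lambda>x. iexp (t * x))" by (rule integrable_const_bound[of _ 1]) auto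
    have "Re (char M t) = (\<integral>x. Re (iexp (t * x)) \<partial>M)" "Im (char M t) = (\<integral>x. Im (iexp (t * x)) \<partial>M)"
      unfolding char_def using i by (simp_all only: integral_Re integral_Im)
    then show ?thesis by (simp add: complex_eq_iff Re_exp Im_exp cos_diff)
  qed
  show "(\<lambda>n. char (\<mu> n) t) \<longlonglongrightarrow> char \<nu> t"
    unfolding ch[OF \<mu>] ch[OF \<nu>] using cos by (intro tendsto_Complex)
qed

subsection \<open>The limit theorem\<close>

theorem corollary5p6:
  fixes M :: "'a measure" and Y :: "nat \<Rightarrow> 'a \<Rightarrow> real"
    and N :: "nat \<Rightarrow> nat" and f :: "nat \<Rightarrow> nat \<Rightarrow> nat \<Rightarrow> real"
    and \<Omega> :: "'w measure"
    and e :: "nat \<Rightarrow> 'h::{real_inner,complete_space}"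
    and W :: "'h \<Rightarrow> 'w \<Rightarrow> real"
    and T :: "'h \<Rightarrow> 'h \<Rightarrow> 't::{real_inner,complete_space}"
    and I\<^sub>2 :: "'t \<Rightarrow> 'w \<Rightarrow> real"
    and g :: "nat \<Rightarrow> 't" and G :: "nat \<Rightarrow> 'w \<Rightarrow> real"
    and P :: "'x measure" and X :: "'x \<Rightarrow> real"
    and \<alpha>\<^sub>1 p\<^sub>1 \<alpha>\<^sub>2 p\<^sub>2 :: real
  assumes "prob_space M"
    and "prob_space.indep_vars M (\<lambda>_. borel) Y {1..}"
    and "\<And>i. i \<ge> 1 \<Longrightarrow> distr M borel (Y i) = distr M borel (Y 1)"
    and "\<And>i. i \<ge> 1 \<Longrightarrow> prob_space.expectation M (Y i) = 0"
    and "\<And>i. i \<ge> 1 \<Longrightarrow> prob_space.variance M (Y i) = 1"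
    and "(SUP i\<in>{1..}. \<integral>\<^sup>+ \<omega>. ennreal (\<bar>Y i \<omega>\<bar> ^ 3) \<partial>M) < \<infinity>"
    and "filterlim N at_top sequentially"
    and "\<And>n i j. n \<ge> 1 \<Longrightarrow> i \<in> {1..N n} \<Longrightarrow> j \<in> {1..N n} \<Longrightarrow> f n i j = f n j i"
    and "\<And>n i. n \<ge> 1 \<Longrightarrow> i \<in> {1..N n} \<Longrightarrow> f n i i = 0"
    and "orthonormal_basis e"
    and "prob_space \<Omega>"
    and "isonormal_process \<Omega> W"
    and "hilbert_tensor_square T"
    and "double_wiener_ito_integral \<Omega> W T I\<^sub>2"
    and "\<And>n. n \<ge> 1 \<Longrightarrow> g n = (\<Sum>i\<in>{1..N n}. \<Sum>j\<in>{1..N n}. f n i j *\<^sub>R T (e i) (e j))"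
    and "\<And>n. n \<ge> 1 \<Longrightarrow> G n = I\<^sub>2 (g n)"
    and "\<alpha>\<^sub>1 > 0" and "p\<^sub>1 > 0" and "\<alpha>\<^sub>2 > 0" and "p\<^sub>2 > 0"
    and "prob_space P"
    and "X \<in> borel_measurable P"
    and "distr P borel X = bilateral_gamma_law \<alpha>\<^sub>1 p\<^sub>1 \<alpha>\<^sub>2 p\<^sub>2"
    and "\<alpha>\<^sub>1 * \<alpha>\<^sub>2 > 1 + \<bar>\<alpha>\<^sub>1 - \<alpha>\<^sub>2\<bar>"
    and "p\<^sub>1 * \<alpha>\<^sub>2 = p\<^sub>2 * \<alpha>\<^sub>1"
    and "(\<lambda>n. Max ((\<lambda>i. influence (N n) (f n) i) ` {1..N n})) \<longlonglongrightarrow> 0"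
    and "\<And>j. j \<in> {2..6} \<Longrightarrow> (\<lambda>n. cumulant j \<Omega> (G n)) \<longlonglongrightarrow> cumulant j P X"
  shows "(\<lambda>n. d3_dist M (homogeneous_sum2 (N n) (f n) Y) P X) \<longlonglongrightarrow> 0 \<and>
    weak_conv_m (\<lambda>n. distr M borel (homogeneous_sum2 (N n) (f n) Y)) (distr P borel X)"
proof -
  interpret M: prob_space M by fact
  interpret P: prob_space P by fact
  interpret isonormal \<Omega> W
    using \<open>prob_space \<Omega>\<close> \<open>isonormal_process \<Omega> W\<close> by (simp add: isonormal_def isonormal_axioms_def)
  note [measurable] = \<open>X \<in> borel_measurable P\<close>
  have Ym[measurable]: "Y i \<in> borel_measurable M" if "i \<ge> 1" for i
    using \<open>M.indep_vars (\<lambda>_. borel) Y {1..}\<close> that by (simp add: M.indep_vars_def)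
  define \<nu> where "\<nu> = distr M borel (Y 1)"
  \<comment> \<open>The larger of the two third moments, so that the common law of the
    \<open>Y i\<close> and the normal law are standardized with the same constant.\<close>
  define \<rho> where "\<rho> = max (\<integral>x. \<bar>x\<bar> ^ 3 \<partial>\<nu>) (\<integral>x. \<bar>x\<bar> ^ 3 \<partial>std_normal_distribution)"
  have std_Y: "standardized_law \<rho> \<nu>"
  proof -
    have "(\<integral>\<^sup>+ \<omega>. ennreal (\<bar>Y 1 \<omega>\<bar> ^ 3) \<partial>M) \<le> (SUP i\<in>{1..}. \<integral>\<^sup>+ \<omega>. ennreal (\<bar>Y i \<omega>\<bar> ^ 3) \<partial>M)"
      by (rule SUP_upper) simp
    then have "(\<integral>\<^sup>+ \<omega>. ennreal (\<bar>Y 1 \<omega>\<bar> ^ 3) \<partial>M) < \<infinity>"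
      using assms(6) by (rule le_less_trans)
    then have "integrable M (\<lambda>\<omega>. \<bar>Y 1 \<omega>\<bar> ^ 3)" by (intro integrableI_bounded) auto
    then show ?thesis
      using assms(4)[of 1] assms(5)[of 1]
      by (simp add: standardized_law_def \<nu>_def \<rho>_def integral_distr integrable_distr_eq)
  qed
  have std_N: "standardized_law \<rho> std_normal_distribution"
    unfolding standardized_law_def
  proof (intro conjI real_dist_normal_dist)
    show "integrable std_normal_distribution (\<lambda>x. \<bar>x\<bar> ^ 3)"
      using integrable_abs[OF integrable_std_normal_distribution_moment[of 3]] by (simp add: power_abs)
    show "(\<integral>x. x \<partial>std_normal_distribution) = 0" using integral_std_normal_distribution_moment_odd[of 1] by simp
    show "(\<integral>x. x\<^sup>2 \<partial>std_normal_distribution) = 1" using std_normal_distribution_even_moments(1)[of 1] by simp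
  qed (simp add: \<rho>_def)
  have on: "inner (e i) (e j) = (if i = j then 1 else 0)" if "i \<ge> 1" "j \<ge> 1" for i j
    using \<open>orthonormal_basis e\<close> that by (simp add: orthonormal_basis_def)
  define Hq where "Hq n x = (\<Sum>i\<in>{1..N n}. \<Sum>j\<in>{1..N n}. f n i j * x i * x j)" for n and x :: "nat \<Rightarrow> real"
  \<comment> \<open>Bundled into one predicate so that a single choice of eigenvalues for each n
    satisfies all four facts.\<close>
  define good where "good n lam \<longleftrightarrow> G n \<in> borel_measurable \<Omega> \<and>
      (\<forall>t. char (distr \<Omega> borel (G n)) t = exp (\<Sum>k\<in>{1..N n}. gamma_exponent (t * (2 * lam k)) / 2)) \<and>
      (\<Sum>k\<in>{1..N n}. (lam k)\<^sup>2) = (\<Sum>i\<in>{1..N n}. influence (N n) (f n) i) \<and>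
      (AE \<omega> in \<Omega>. G n \<omega> = Hq n (\<lambda>i\<in>{1..N n}. W (e i) \<omega>))" for n lam
  have "\<exists>lam. good n lam" if n: "n \<ge> 1" for n
  proof -
    have G: "G n = I\<^sub>2 (\<Sum>i\<in>{1..N n}. \<Sum>j\<in>{1..N n}. f n i j *\<^sub>R T (e i) (e j))"
      using assms(15,16) n by simp
    have Kon: "inner (e i) (e j) = (if i = j then 1 else 0)" if "i \<in> {1..N n}" "j \<in> {1..N n}" for i j
      using on that by simp
    from double_integral_quadratic_form[OF assms(13,14), where K = "{1..N n}" and e = e and f = "f n",
        OF finite_atLeastAtMost Kon assms(8,9)[OF n], folded G]
    show ?thesis unfolding good_def by (simp add: influence_def Hq_def)
  qed
  then have "\<forall>n. \<exists>lam. n \<ge> 1 \<longrightarrow> good n lam" by blast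
  from choice[OF this] obtain lam where lam: "\<And>n. n \<ge> 1 \<Longrightarrow> good n (lam n)" by blast
  have Gm[measurable]: "G n \<in> borel_measurable \<Omega>"
    and Gchar: "char (distr \<Omega> borel (G n)) t = exp (\<Sum>k\<in>{1..N n}. gamma_exponent (t * (2 * lam n k)) / 2)"
    and Glam: "(\<Sum>k\<in>{1..N n}. (lam n k)\<^sup>2) = (\<Sum>i\<in>{1..N n}. influence (N n) (f n) i)"
    and GAE: "AE \<omega> in \<Omega>. G n \<omega> = Hq n (\<lambda>i\<in>{1..N n}. W (e i) \<omega>)" if "n \<ge> 1" for n t
    using lam[OF that] unfolding good_def by blast+
  define a b where "a = 1 / \<alpha>\<^sub>1" and "b = - 1 / \<alpha>\<^sub>2"
  have ab: "a \<noteq> 0" "b \<noteq> 0" "a \<noteq> b"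
    using \<open>\<alpha>\<^sub>1 > 0\<close> \<open>\<alpha>\<^sub>2 > 0\<close> by (auto simp: a_def b_def field_simps)
  have Xchar: "char (distr P borel X) t = exp (p\<^sub>1 * gamma_exponent (t * a) + p\<^sub>2 * gamma_exponent (t * b))" for t
    unfolding assms(23) a_def b_def by (rule char_bilateral_gamma_law) fact+
  \<comment> \<open>Shifted to \<open>Suc n\<close> because the data are specified for
    \<open>n \<ge> 1\<close>. With weight 1/2 and \<open>2 * lam\<close> the power sums are the
    cumulants up to the factor \<open>fact (j - 1)\<close>, which cancels.\<close>
  have sums: "(\<lambda>n. \<Sum>k\<in>{1..N (Suc n)}. (2 * lam (Suc n) k) ^ j / 2) \<longlonglongrightarrow> p\<^sub>1 * a ^ j + p\<^sub>2 * b ^ j"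
    if j: "j \<in> {2..6}" for j
  proof -
    have cG: "cumulant j \<Omega> (G (Suc n)) = of_real (fact (j - 1) * (\<Sum>k\<in>{1..N (Suc n)}. (2 * lam (Suc n) k) ^ j / 2))" for n
      using cumulant_eq_power_sum[where M = \<Omega> and G = "G (Suc n)" and K = "{1..N (Suc n)}" and w = "\<lambda>_. 1 / 2"
          and m = "\<lambda>k. 2 * lam (Suc n) k" and j = j] j
      by (simp add: Gchar mult_ac)
    \<comment> \<open>The two gamma components are indexed by \<open>bool\<close>, so the same lemma
      handles X.\<close>
    have cX: "cumulant j P X = of_real (fact (j - 1) * (p\<^sub>1 * a ^ j + p\<^sub>2 * b ^ j))"
      using cumulant_eq_power_sum[where M = P and G = X and K = UNIV and w = "\<lambda>k. if k then p\<^sub>1 else p\<^sub>2"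
          and m = "\<lambda>k. if k then a else b" and j = j] j
      by (simp add: Xchar UNIV_bool mult_ac add_ac)
    have "(\<lambda>n. cumulant j \<Omega> (G (Suc n))) \<longlonglongrightarrow> cumulant j P X"
      using assms(27)[OF j] by (rule LIMSEQ_Suc)
    then have "(\<lambda>n. fact (j - 1) * (\<Sum>k\<in>{1..N (Suc n)}. (2 * lam (Suc n) k) ^ j / 2)) \<longlonglongrightarrow> fact (j - 1) * (p\<^sub>1 * a ^ j + p\<^sub>2 * b ^ j)"
      unfolding cG cX tendsto_of_real_iff .
    then show ?thesis by (subst (asm) tendsto_mult_left_iff) auto
  qed
  have "weak_conv_m (\<lambda>n. distr \<Omega> borel (G (Suc n))) (distr P borel X)"
  proof (rule levy_continuity)
    fix t
    have "(\<lambda>n. \<Sum>k\<in>{1..N (Suc n)}. gamma_exponent (t * (2 * lam (Suc n) k)) / 2)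
        \<longlonglongrightarrow> p\<^sub>1 * gamma_exponent (t * a) + p\<^sub>2 * gamma_exponent (t * b)"
      using ab sums by (intro gamma_exponent_sum_tendsto) auto
    then show "(\<lambda>n. char (distr \<Omega> borel (G (Suc n))) t) \<longlonglongrightarrow> char (distr P borel X) t"
      by (simp add: Gchar Xchar tendsto_exp)
  qed auto
  then obtain d where d: "d \<longlonglongrightarrow> 0" and
    dle: "\<And>n h. h \<in> smooth_test_functions3 \<Longrightarrow>
      \<bar>(\<integral>x. h x \<partial>distr \<Omega> borel (G (Suc n))) - (\<integral>x. h x \<partial>distr P borel X)\<bar> \<le> d n"
    by (rule weak_conv_imp_uniform_smooth[rotated 2]) auto
  define \<tau> where "\<tau> n = Max ((\<lambda>i. influence (N n) (f n) i) ` {1..N n})" for n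
  define V where "V n = (\<Sum>i\<in>{1..N n}. influence (N n) (f n) i)" for n
  define C where "C = 8 / 3 * \<rho> * (3 + \<rho>)"
  have \<rho>0: "0 \<le> \<rho>" by (simp add: \<rho>_def max.coboundedI1)
  have C0: "0 \<le> C" using \<rho>0 by (simp add: C_def)
  have comparison: "\<bar>(\<integral>\<omega>. h (homogeneous_sum2 (N n) (f n) Y \<omega>) \<partial>M) - (\<integral>\<omega>. h (G n \<omega>) \<partial>\<Omega>)\<bar> \<le> C * (sqrt (\<tau> n) * V n)"
    if n: "n \<ge> 1" and Nn: "N n \<ge> 1" and h: "h \<in> smooth_test_functions3" for n h
  proof -
    let ?I = "{1..N n}"
    have [measurable]: "h \<in> borel_measurable borel"
      using smooth_test_functions3D(2)[OF h] by (intro borel_measurable_continuous_onI continuous_at_imp_continuous_on) auto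
    have hm: "(\<lambda>x. h (Hq n x)) \<in> borel_measurable (\<Pi>\<^sub>M i\<in>?I. borel)"
      unfolding Hq_def by measurable
    have Yt: "(\<lambda>\<omega>. \<lambda>i\<in>?I. Y i \<omega>) \<in> measurable M (\<Pi>\<^sub>M i\<in>?I. borel)"
      by (intro measurable_restrict Ym) auto
    have Wt: "(\<lambda>\<omega>. \<lambda>i\<in>?I. W (e i) \<omega>) \<in> measurable \<Omega> (\<Pi>\<^sub>M i\<in>?I. borel)"
      by (intro measurable_restrict measurable_W)
    have "M.indep_vars (\<lambda>_. borel) Y ?I"
      using assms(2) by (rule M.indep_vars_subset) auto
    \<comment> \<open>The product form of independence is for a nonempty index set, hence
      \<open>N n \<ge> 1\<close>.\<close>
    then have "distr M (\<Pi>\<^sub>M i\<in>?I. borel) (\<lambda>\<omega>. \<lambda>i\<in>?I. Y i \<omega>) = (\<Pi>\<^sub>M i\<in>?I. distr M borel (Y i))"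
      using Nn by (subst (asm) M.indep_vars_iff_distr_eq_PiM') auto
    also have "\<dots> = (\<Pi>\<^sub>M i\<in>?I. \<nu>)"
      by (intro PiM_cong refl) (unfold \<nu>_def, rule assms(3), simp)
    finally have dY: "distr M (\<Pi>\<^sub>M i\<in>?I. borel) (\<lambda>\<omega>. \<lambda>i\<in>?I. Y i \<omega>) = (\<Pi>\<^sub>M i\<in>?I. \<nu>)" .
    have dW: "distr \<Omega> (\<Pi>\<^sub>M i\<in>?I. borel) (\<lambda>\<omega>. \<lambda>i\<in>?I. W (e i) \<omega>) = (\<Pi>\<^sub>M i\<in>?I. std_normal_distribution)"
      by (rule orthonormal_distr) (use on in auto)
    have "(\<integral>\<omega>. h (homogeneous_sum2 (N n) (f n) Y \<omega>) \<partial>M) = (\<integral>\<omega>. h (Hq n (\<lambda>i\<in>?I. Y i \<omega>)) \<partial>M)"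
      by (intro Bochner_Integration.integral_cong refl) (simp add: homogeneous_sum2_def Hq_def)
    also have "\<dots> = (\<integral>x. h (Hq n x) \<partial>(\<Pi>\<^sub>M i\<in>?I. \<nu>))"
      unfolding dY[symmetric] by (rule integral_distr[OF Yt hm, symmetric])
    finally have EY: "(\<integral>\<omega>. h (homogeneous_sum2 (N n) (f n) Y \<omega>) \<partial>M) = (\<integral>x. h (Hq n x) \<partial>(\<Pi>\<^sub>M i\<in>?I. \<nu>))" .
    have "(\<integral>\<omega>. h (G n \<omega>) \<partial>\<Omega>) = (\<integral>\<omega>. h (Hq n (\<lambda>i\<in>?I. W (e i) \<omega>)) \<partial>\<Omega>)"
    proof (rule integral_cong_AE)
      show "(\<lambda>\<omega>. h (G n \<omega>)) \<in> borel_measurable \<Omega>" using Gm[OF n] by measurable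
      show "(\<lambda>\<omega>. h (Hq n (\<lambda>i\<in>?I. W (e i) \<omega>))) \<in> borel_measurable \<Omega>" by (rule measurable_compose[OF Wt hm])
      show "AE \<omega> in \<Omega>. h (G n \<omega>) = h (Hq n (\<lambda>i\<in>?I. W (e i) \<omega>))" using GAE[OF n] by eventually_elim simp
    qed
    also have "\<dots> = (\<integral>x. h (Hq n x) \<partial>(\<Pi>\<^sub>M i\<in>?I. std_normal_distribution))"
      unfolding dW[symmetric] by (rule integral_distr[OF Wt hm, symmetric])
    finally have EG: "(\<integral>\<omega>. h (G n \<omega>) \<partial>\<Omega>) = (\<integral>x. h (Hq n x) \<partial>(\<Pi>\<^sub>M i\<in>?I. std_normal_distribution))" .
    have "\<bar>(\<integral>\<omega>. h (homogeneous_sum2 (N n) (f n) Y \<omega>) \<partial>M) - (\<integral>\<omega>. h (G n \<omega>) \<partial>\<Omega>)\<bar>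
        \<le> C * (\<Sum>i\<in>?I. sqrt (influence (N n) (f n) i) ^ 3)"
      unfolding EY EG Hq_def C_def influence_def
      by (rule lindeberg_quadratic_form[OF h std_Y std_N]) (use assms(8,9)[OF n] in auto)
    also have "\<dots> \<le> C * (\<Sum>i\<in>?I. sqrt (\<tau> n) * influence (N n) (f n) i)"
    proof (intro mult_left_mono[OF _ C0] sum_mono)
      fix i assume i: "i \<in> ?I"
      have 0: "0 \<le> influence (N n) (f n) i" by (simp add: influence_def sum_nonneg)
      have "influence (N n) (f n) i \<le> \<tau> n" unfolding \<tau>_def using i by (intro Max_ge) auto
      then have "sqrt (influence (N n) (f n) i) * influence (N n) (f n) i \<le> sqrt (\<tau> n) * influence (N n) (f n) i"
        using 0 by (intro mult_right_mono real_sqrt_le_mono)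
      then show "sqrt (influence (N n) (f n) i) ^ 3 \<le> sqrt (\<tau> n) * influence (N n) (f n) i"
        using 0 by (simp add: power3_eq_cube mult.commute)
    qed
    finally show ?thesis by (simp add: V_def sum_distrib_left)
  qed
  \<comment> \<open>\<open>d\<close> was obtained for the sequence \<open>G (Suc n)\<close>, hence
    the index \<open>n - 1\<close>.\<close>
  define \<delta> where "\<delta> n = C * (sqrt (\<tau> n) * V n) + d (n - 1)" for n
  have \<delta>: "\<delta> \<longlonglongrightarrow> 0"
  proof -
    \<comment> \<open>The power sum of order 2 is twice the total influence, so the cumulant
      hypothesis for \<open>j = 2\<close> makes \<open>V\<close> converge, and a factor tending to 0
      beats it.\<close>
    have "(\<lambda>n. 1 / 2 * (\<Sum>k\<in>{1..N (Suc n)}. (2 * lam (Suc n) k) ^ 2 / 2)) \<longlonglongrightarrow> 1 / 2 * (p\<^sub>1 * a ^ 2 + p\<^sub>2 * b ^ 2)"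
      by (intro tendsto_mult_left sums) simp
    also have "(\<lambda>n. 1 / 2 * (\<Sum>k\<in>{1..N (Suc n)}. (2 * lam (Suc n) k) ^ 2 / 2)) = (\<lambda>n. V (Suc n))"
    proof
      fix n
      have "V (Suc n) = (\<Sum>k\<in>{1..N (Suc n)}. (lam (Suc n) k)\<^sup>2)" unfolding V_def by (rule Glam[symmetric]) simp
      then show "1 / 2 * (\<Sum>k\<in>{1..N (Suc n)}. (2 * lam (Suc n) k) ^ 2 / 2) = V (Suc n)"
        by (simp add: sum_distrib_left power_mult_distrib)
    qed
    finally have V: "V \<longlonglongrightarrow> 1 / 2 * (p\<^sub>1 * a ^ 2 + p\<^sub>2 * b ^ 2)" by (rule LIMSEQ_imp_Suc)
    have "\<tau> \<longlonglongrightarrow> 0" unfolding \<tau>_def by fact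
    then have "(\<lambda>n. sqrt (\<tau> n)) \<longlonglongrightarrow> 0" using tendsto_real_sqrt by fastforce
    then have "(\<lambda>n. C * (sqrt (\<tau> n) * V n)) \<longlonglongrightarrow> C * (0 * (1 / 2 * (p\<^sub>1 * a ^ 2 + p\<^sub>2 * b ^ 2)))"
      by (intro tendsto_intros V)
    moreover have "(\<lambda>n. d (n - 1)) \<longlonglongrightarrow> 0" by (rule LIMSEQ_imp_Suc) (simp add: d)
    ultimately have "\<delta> \<longlonglongrightarrow> C * (0 * (1 / 2 * (p\<^sub>1 * a ^ 2 + p\<^sub>2 * b ^ 2))) + 0"
      unfolding \<delta>_def by (rule tendsto_add)
    then show ?thesis by simp
  qed
  have ev: "\<forall>\<^sub>F n in sequentially. n \<ge> 1 \<and> N n \<ge> 1"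
    using \<open>filterlim N at_top sequentially\<close> by (simp add: eventually_conj eventually_ge_at_top filterlim_at_top)
  have main: "\<bar>(\<integral>\<omega>. h (homogeneous_sum2 (N n) (f n) Y \<omega>) \<partial>M) - (\<integral>\<omega>. h (X \<omega>) \<partial>P)\<bar> \<le> \<delta> n"
    if n: "n \<ge> 1 \<and> N n \<ge> 1" and h: "h \<in> smooth_test_functions3" for n h
  proof -
    have [measurable]: "h \<in> borel_measurable borel"
      using smooth_test_functions3D(2)[OF h] by (intro borel_measurable_continuous_onI continuous_at_imp_continuous_on) auto
    have "\<bar>(\<integral>\<omega>. h (G n \<omega>) \<partial>\<Omega>) - (\<integral>\<omega>. h (X \<omega>) \<partial>P)\<bar> \<le> d (n - 1)"
      using dle[OF h, of "n - 1"] Gm[of n] n by (simp add: integral_distr)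
    with comparison[OF _ _ h, of n] n show ?thesis unfolding \<delta>_def by linarith
  qed
  have "(\<lambda>n. d3_dist M (homogeneous_sum2 (N n) (f n) Y) P X) \<longlonglongrightarrow> 0"
  proof (rule tendsto_sandwich[OF _ _ tendsto_const \<delta>])
    show "\<forall>\<^sub>F n in sequentially. 0 \<le> d3_dist M (homogeneous_sum2 (N n) (f n) Y) P X"
      using ev by eventually_elim (rule d3_dist_le(1)[OF main])
    show "\<forall>\<^sub>F n in sequentially. d3_dist M (homogeneous_sum2 (N n) (f n) Y) P X \<le> \<delta> n"
      using ev by eventually_elim (rule d3_dist_le(2)[OF main])
  qed
  moreover have "weak_conv_m (\<lambda>n. distr M borel (homogeneous_sum2 (N n) (f n) Y)) (distr P borel X)"
  proof (rule uniform_smooth_imp_weak_conv[OF _ _ \<delta>])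
    have Hm[measurable]: "homogeneous_sum2 (N n) (f n) Y \<in> borel_measurable M" for n
      unfolding homogeneous_sum2_def[abs_def]
      by (intro borel_measurable_sum borel_measurable_times borel_measurable_const Ym) auto
    show "real_distribution (distr M borel (homogeneous_sum2 (N n) (f n) Y))" for n by simp
    show "real_distribution (distr P borel X)" by simp
    show "\<forall>\<^sub>F n in sequentially. \<forall>h\<in>smooth_test_functions3.
       \<bar>(\<integral>x. h x \<partial>distr M borel (homogeneous_sum2 (N n) (f n) Y)) - (\<integral>x. h x \<partial>distr P borel X)\<bar> \<le> \<delta> n"
      using ev
    proof eventually_elim
      case (elim n)
      show ?case
      proof
        fix h assume h: "h \<in> smooth_test_functions3"
        have [measurable]: "h \<in> borel_measurable borel"
          using smooth_test_functions3D(2)[OF h] by (intro borel_measurable_continuous_onI continuous_at_imp_continuous_on) auto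
        show "\<bar>(\<integral>x. h x \<partial>distr M borel (homogeneous_sum2 (N n) (f n) Y)) - (\<integral>x. h x \<partial>distr P borel X)\<bar> \<le> \<delta> n"
          using main[OF elim h] by (simp add: integral_distr)
      qed
    qed
  qed
  ultimately show ?thesis ..
qed

end
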